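(* Let $\mathfrak s=(s_1,\dots,s_r)\in\mathbb N^r$ ($r\ge1$) and $\mathfrak Q=(Q_1,\dots,Q_r)\in\overline K[t]^r$ with $\|Q_r\|<|\theta|_\infty^{s_rq/(q-1)}$ and $\|Q_i\|\le|\theta|_\infty^{s_iq/(q-1)}$ for $1\le i\le r-1$. Let $E'$ be the Anderson $t$-module attached to the Anderson–Thakur dual $t$-motive $\mathcal M'_{\mathfrak s,\mathfrak Q}$ and $\mathbf v_{\mathfrak s,\mathfrak Q}=\delta_1(Q_r^{(-1)}(t-\theta)^{s_r}m_r)$. Then we have the split-logarithmic identity $$\mathrm{Log}^!_{E'}(\mathbf v_{\mathfrak s,\mathfrak Q})=\delta_0\begin{pmatrix}(-1)^{r-1}\mathfrak L^*(s_r,\dots,s_1)\Omega^{-(s_1+\dots+s_r)}\\(-1)^{r-2}\mathfrak L^*(s_r,\dots,s_2)\Omega^{-(s_2+\dots+s_r)}\\ \vdots\\ \mathfrak L^*(s_r)\Omega^{-s_r}\end{pmatrix}.$$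
   Context: Notation: $\mathbb F_q$ finite field, $A=\mathbb F_q[\theta]$, $K=\mathbb F_q(\theta)$, $\mathbb C_\infty$ completion of an algebraic closure of $\mathbb F_q((1/\theta))$, $|\theta|_\infty=q$, $\overline K\subset\mathbb C_\infty$ algebraic closure of $K$, $\|\sum c_jt^j\|=\max|c_j|_\infty$. Twisting: $(\sum c_jt^j)^{(i)}=\sum c_j^{q^i}t^j$ ($i\in\mathbb Z$), extended to power series. $\overline K[t,\sigma]$: $t$ central, $\sigma c=c^{1/q}\sigma$. Put $d_\ell=s_\ell+\dots+s_r$ and $d=d_1+\dots+d_r$. The dual $t$-motive $\mathcal M'=\mathcal M'_{\mathfrak s,\mathfrak Q}$ is the free $\overline K[t]$-module with basis $m_1,\dots,m_r$ and $\sigma$ acting $\sigma$-semilinearly ($\sigma(gm)=g^{(-1)}\sigma m$) with $\sigma m_1=(t-\theta)^{d_1}m_1$ and $\sigma m_\ell=Q_{\ell-1}^{(-1)}(t-\theta)^{d_{\ell-1}}m_{\ell-1}+(t-\theta)^{d_\ell}m_\ell$ for $2\le\ell\le r$. It is free over $\overline K[\sigma]$ with basis $w_1,\dots,w_d$ given in order by $(t-\theta)^{d_1-1}m_1,\dots,(t-\theta)m_1,m_1,\dots,(t-\theta)^{d_r-1}m_r,\dots,m_r$. Every $m\in\mathcal M'$ is uniquely $\sum_{i\ge0}\sum_jc_{i,j}\sigma^iw_j$ ($c_{i,j}\in\overline K$); $\delta_1(m)=\sum_i(c_{i,1}^{q^i},\dots,c_{i,d}^{q^i})^\top\in\overline K^d$.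 The Anderson $t$-module $E':A\to\mathrm{Mat}_d(\overline K)[\tau]$ is determined by $E'_a(\delta_1(m))=\delta_1(a(t)m)$, where $a(t)$ is $a$ with $\theta$ replaced by $t$; write $E'_a=d[a]+\sum_{k\ge1}E'_{a,k}\tau^k$, acting on $\mathbb C_\infty^d$ with $\tau$ raising entries to the $q$-th power. $\mathrm{Exp}_{E'}=\sum Q_i\tau^i$ ($Q_0=I_d$) is the unique series with $\mathrm{Exp}_{E'}d[a]=E'_a\mathrm{Exp}_{E'}$, $\mathrm{Log}_{E'}=\sum P_i\tau^i$ its formal inverse; the domain of convergence of $\mathrm{Log}_{E'}$ is the set of $\mathbf u$ with $\sum P_i\mathbf u^{(i)}$ convergent. A split-logarithmic identity $\mathrm{Log}^!_{E'}(\mathbf Z)=\mathbf z$ means: there are finitely many $(a_i,\mathbf u_i)\in A\times\mathbb C_\infty^d$, each $\mathbf u_i$ in the domain of convergence of $\mathrm{Log}_{E'}$, with $\mathbf z=\sum_id[a_i]\mathrm{Log}_{E'}(\mathbf u_i)$ and $\mathbf Z=\sum_iE'_{a_i}\mathbf u_i$. $\delta_0$ on column vectors $(g_1,\dots,g_r)^\top$ of functions of $t$ analytic near $t=\theta$: writing $g_\ell=\sum_{i\ge0}c_{i,\ell}(t-\theta)^i$ near $\theta$, $\delta_0(g)=(c_{d_1-1,1},\dots,c_{0,1},\dots,c_{d_r-1,r},\dots,c_{0,r})^\top$. $\Omega(t)=(-\theta)^{-q/(q-1)}\prod_{i\ge1}(1-t/\theta^{q^i})$ for a fixed $(q-1)$st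 root of $-\theta$. For the reversed tuple $(s_j,\dots,s_\ell)$ ($j\ge\ell$) with polynomials $(Q_j,\dots,Q_\ell)$, $\mathfrak L^*(s_j,\dots,s_\ell)=\sum_{i_j\ge i_{j-1}\ge\dots\ge i_\ell\ge0}(\Omega^{s_\ell}Q_\ell)^{(i_\ell)}\cdots(\Omega^{s_j}Q_j)^{(i_j)}$ (an entire function of $t$). *)

theory Defs
  imports
    "HOL-Analysis.Infinite_Sum"
    "HOL-Library.FuncSet"
    "HOL-Computational_Algebra.Computational_Algebra"
    "Jordan_Normal_Form.Matrix"
begin

definition absv :: "'c::{zero,metric_space} \<Rightarrow> real" where
  "absv x = dist x 0"

definition algebraic_closure_in :: "'c::field set \<Rightarrow> 'c set" where
  "algebraic_closure_in S = {x. \<exists>p. p \<noteq> 0 \<and> set (coeffs p) \<subseteq> S \<and> poly p x = 0}"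

definition gauss_norm :: "'c::{zero,metric_space} poly \<Rightarrow> real" where
  "gauss_norm p = Max ((\<lambda>j. absv (coeff p j)) ` {..degree p})"

definition fps_value :: "'c::{field,metric_space} fps \<Rightarrow> 'c \<Rightarrow> 'c" where
  "fps_value f x = (\<Sum>n. fps_nth f n * x ^ n)"

definition taylor_coeff :: "'c::{field,metric_space} \<Rightarrow> ('c \<Rightarrow> 'c) \<Rightarrow> nat \<Rightarrow> 'c" where
  "taylor_coeff a g =
     (THE c. \<exists>e>0. \<forall>x. dist x a < e \<longrightarrow> (\<lambda>i. c i * (x - a) ^ i) sums g x)"

text \<open>
  The type \<open>'c\<close> is a completion of an algebraic closure of the field of Laurent series in
  \<open>1/\<theta>\<close> over the finite field \<open>'f\<close>. The library's Laurent series indeterminate plays the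
  role of \<open>1/\<theta>\<close>, so a series of subdegree \<open>n\<close> has absolute value \<open>q\<^sup>-\<^sup>n\<close>. The metric of \<open>'c\<close>
  is the one of its absolute value, and completeness is part of the class \<open>complete_space\<close>.
\<close>

locale C_infinity =
  fixes q :: nat and \<iota> :: "'f::{field,finite} fls \<Rightarrow> 'c::{field,complete_space}"
  assumes q_eq: "q = card (UNIV :: 'f set)"
    and dist_absv: "\<And>x y :: 'c. dist x y = absv (x - y)"
    and absv_mult: "\<And>x y :: 'c. absv (x * y) = absv x * absv y"
    and absv_ultrametric: "\<And>x y :: 'c. absv (x + y) \<le> max (absv x) (absv y)"
    and emb_one: "\<iota> 1 = 1"
    and emb_add: "\<And>x y. \<iota> (x + y) = \<iota> x + \<iota> y"
    and emb_mult: "\<And>x y. \<iota> (x * y) = \<iota> x * \<iota> y"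
    and absv_emb: "\<And>x. x \<noteq> 0 \<Longrightarrow> absv (\<iota> x) = real q powi (- fls_subdegree x)"
    and alg_closed: "\<And>p :: 'c poly. set (coeffs p) \<subseteq> algebraic_closure_in (range \<iota>) \<Longrightarrow>
      degree p > 0 \<Longrightarrow> \<exists>x \<in> algebraic_closure_in (range \<iota>). poly p x = 0"
    and dense: "closure (algebraic_closure_in (range \<iota>)) = UNIV"
begin

definition theta :: 'c ("\<theta>") where
  "\<theta> = \<iota> fls_X_inv"

text \<open>
  Elements of \<open>A = F\<^sub>q[\<theta>]\<close> are represented by \<open>a :: 'f poly\<close>; \<open>poly_t a\<close> is \<open>a(t)\<close>, and
  \<open>a\<close> itself, as an element of \<open>'c\<close>, is \<open>poly (poly_t a) \<theta>\<close>.
\<close>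

definition poly_t :: "'f poly \<Rightarrow> 'c poly" where
  "poly_t a = map_poly (\<lambda>c. \<iota> (fls_const c)) a"

definition K :: "'c set" where
  "K = {poly (poly_t a) \<theta> / poly (poly_t b) \<theta> | a b. b \<noteq> 0}"

definition Kbar :: "'c set" where
  "Kbar = algebraic_closure_in K"

definition frob :: "int \<Rightarrow> 'c \<Rightarrow> 'c" where
  "frob i c = (if 0 \<le> i then c ^ (q ^ nat i) else (THE x. x ^ (q ^ nat (- i)) = c))"

definition twist_poly :: "int \<Rightarrow> 'c poly \<Rightarrow> 'c poly" where
  "twist_poly i p = map_poly (frob i) p"

definition twist_fps :: "int \<Rightarrow> 'c fps \<Rightarrow> 'c fps" where
  "twist_fps i f = Abs_fps (\<lambda>n. frob i (fps_nth f n))"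

text \<open>
  Entire functions are represented by their power series in \<open>t\<close>, since twisting acts on
  coefficients; infinite products and sums of such series are taken coefficientwise.
  The parameter \<open>\<eta>\<close> is the chosen \<open>(q-1)\<close>st root of \<open>-\<theta>\<close>, so that
  \<open>(-\<theta>)\<^bsup>-q/(q-1)\<^esup>\<close> is \<open>\<eta>\<^sup>-\<^sup>q\<close>.
\<close>

definition Omega :: "'c \<Rightarrow> 'c fps" where
  "Omega \<eta> = fps_const (inverse (\<eta> ^ q)) *
     Abs_fps (\<lambda>n. lim (\<lambda>N. fps_nth (\<Prod>i=1..N. 1 - fps_const (inverse (\<theta> ^ (q ^ i))) * fps_X) n))"

text \<open>\<open>L_star \<eta> s Q j l\<close> is the series attached to the reversed tuple \<open>(s\<^sub>j, \<dots>, s\<^sub>l)\<close>.\<close>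

definition L_star :: "'c \<Rightarrow> (nat \<Rightarrow> nat) \<Rightarrow> (nat \<Rightarrow> 'c poly) \<Rightarrow> nat \<Rightarrow> nat \<Rightarrow> 'c fps" where
  "L_star \<eta> s Q j l = Abs_fps (\<lambda>n.
     \<Sum>\<^sub>\<infinity>i \<in> {i \<in> {l..j} \<rightarrow>\<^sub>E (UNIV :: nat set). \<forall>k\<in>{l..<j}. i k \<le> i (Suc k)}.
       fps_nth (\<Prod>k=l..j. twist_fps (int (i k)) (Omega \<eta> ^ s k * fps_of_poly (Q k))) n)"

end

text \<open>
  An element \<open>\<Sum>\<^sub>l f\<^sub>l m\<^sub>l\<close> of the dual motive is the coordinate function \<open>l \<mapsto> f\<^sub>l\<close>, which vanishes
  outside \<open>{1..r}\<close>. Vectors and matrices of size \<open>dim_E\<close> are indexed from \<open>0\<close>, as in the list \<open>w\<close>.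
  Elements \<open>\<Sum>\<^sub>k E\<^sub>k \<tau>\<^sup>k\<close> of the rings of twisted polynomials and twisted power series are the
  sequences of their coefficient matrices.
\<close>

locale Anderson_Thakur = C_infinity q \<iota>
  for q and \<iota> :: "'f::{field,finite} fls \<Rightarrow> 'c::{field,complete_space}" +
  fixes r :: nat and s :: "nat \<Rightarrow> nat" and Q :: "nat \<Rightarrow> 'c poly"
begin

definition tail_weight :: "nat \<Rightarrow> nat" ("\<d>") where
  "\<d> l = (\<Sum>i=l..r. s i)"

definition dim_E :: nat where
  "dim_E = (\<Sum>l=1..r. \<d> l)"

abbreviation t_theta :: "'c poly" where
  "t_theta \<equiv> [:- \<theta>, 1:]"

definition motive :: "(nat \<Rightarrow> 'c poly) set" where
  "motive = {f. (\<forall>l. set (coeffs (f l)) \<subseteq> Kbar) \<and> (\<forall>l. l \<notin> {1..r} \<longrightarrow> f l = 0)}"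

definition sigma_m :: "nat \<Rightarrow> nat \<Rightarrow> 'c poly" where
  "sigma_m l = (\<lambda>k.
     if k = l then t_theta ^ \<d> l
     else if 2 \<le> l \<and> k = l - 1 then twist_poly (- 1) (Q (l - 1)) * t_theta ^ \<d> (l - 1)
     else 0)"

definition sigma :: "(nat \<Rightarrow> 'c poly) \<Rightarrow> nat \<Rightarrow> 'c poly" where
  "sigma f = (\<lambda>k. \<Sum>l=1..r. twist_poly (- 1) (f l) * sigma_m l k)"

definition w :: "(nat \<Rightarrow> 'c poly) list" where
  "w = concat (map (\<lambda>l. map (\<lambda>e k. if k = l then t_theta ^ e else 0) (rev [0..<\<d> l])) [1..<Suc r])"

definition is_sigma_expansion :: "(nat \<Rightarrow> 'c poly) \<Rightarrow> (nat \<Rightarrow> nat \<Rightarrow> 'c) \<Rightarrow> bool" where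
  "is_sigma_expansion m c \<longleftrightarrow>
     (\<forall>i j. c i j \<in> Kbar) \<and> (\<forall>i j. dim_E \<le> j \<longrightarrow> c i j = 0) \<and> finite {i. \<exists>j. c i j \<noteq> 0} \<and>
     m = (\<lambda>k. \<Sum>i | \<exists>j. c i j \<noteq> 0. \<Sum>j<dim_E. [:c i j:] * (sigma ^^ i) (w ! j) k)"

definition sigma_coeff :: "(nat \<Rightarrow> 'c poly) \<Rightarrow> nat \<Rightarrow> nat \<Rightarrow> 'c" where
  "sigma_coeff m = (THE c. is_sigma_expansion m c)"

definition delta1 :: "(nat \<Rightarrow> 'c poly) \<Rightarrow> 'c vec" where
  "delta1 m = vec dim_E (\<lambda>j. \<Sum>i | \<exists>j. sigma_coeff m i j \<noteq> 0. frob (int i) (sigma_coeff m i j))"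

definition delta0 :: "(nat \<Rightarrow> 'c \<Rightarrow> 'c) \<Rightarrow> 'c vec" where
  "delta0 g = vec_of_list
     (concat (map (\<lambda>l. map (\<lambda>e. taylor_coeff \<theta> (g l) e) (rev [0..<\<d> l])) [1..<Suc r]))"

definition tau_apply :: "(nat \<Rightarrow> 'c mat) \<Rightarrow> 'c vec \<Rightarrow> 'c vec" where
  "tau_apply E u = vec dim_E (\<lambda>j.
     \<Sum>k | E k \<noteq> 0\<^sub>m dim_E dim_E. (E k *\<^sub>v map_vec (frob (int k)) u) $ j)"

definition tau_mult :: "(nat \<Rightarrow> 'c mat) \<Rightarrow> (nat \<Rightarrow> 'c mat) \<Rightarrow> nat \<Rightarrow> 'c mat" where
  "tau_mult A B n = mat dim_E dim_E (\<lambda>(i, j).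
     \<Sum>k\<le>n. (A k * map_mat (frob (int k)) (B (n - k))) $$ (i, j))"

definition tau_const :: "'c mat \<Rightarrow> nat \<Rightarrow> 'c mat" where
  "tau_const M n = (if n = 0 then M else 0\<^sub>m dim_E dim_E)"

definition t_module :: "'f poly \<Rightarrow> nat \<Rightarrow> 'c mat" where
  "t_module a = (THE E.
     (\<forall>k. E k \<in> carrier_mat dim_E dim_E \<and> elements_mat (E k) \<subseteq> Kbar) \<and>
     finite {k. E k \<noteq> 0\<^sub>m dim_E dim_E} \<and>
     (\<forall>m\<in>motive. tau_apply E (delta1 m) = delta1 (\<lambda>l. poly_t a * m l)))"

definition Exp_coeff :: "nat \<Rightarrow> 'c mat" where
  "Exp_coeff = (THE X.
     (\<forall>i. X i \<in> carrier_mat dim_E dim_E) \<and> X 0 = 1\<^sub>m dim_E \<and>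
     (\<forall>a. tau_mult X (tau_const (t_module a 0)) = tau_mult (t_module a) X))"

definition Log_coeff :: "nat \<Rightarrow> 'c mat" where
  "Log_coeff = (THE P.
     (\<forall>i. P i \<in> carrier_mat dim_E dim_E) \<and>
     tau_mult P Exp_coeff = tau_const (1\<^sub>m dim_E) \<and>
     tau_mult Exp_coeff P = tau_const (1\<^sub>m dim_E))"

definition Log_domain :: "'c vec set" where
  "Log_domain = {u \<in> carrier_vec dim_E.
     \<forall>j<dim_E. summable (\<lambda>i. (Log_coeff i *\<^sub>v map_vec (frob (int i)) u) $ j)}"

definition Log :: "'c vec \<Rightarrow> 'c vec" where
  "Log u = vec dim_E (\<lambda>j. \<Sum>i. (Log_coeff i *\<^sub>v map_vec (frob (int i)) u) $ j)"

definition split_log :: "'c vec \<Rightarrow> 'c vec \<Rightarrow> bool" where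
  "split_log Z z \<longleftrightarrow>
     (\<exists>(n::nat) a u. (\<forall>i<n. u i \<in> Log_domain) \<and>
        z = vec dim_E (\<lambda>j. \<Sum>i<n. (t_module (a i) 0 *\<^sub>v Log (u i)) $ j) \<and>
        Z = vec dim_E (\<lambda>j. \<Sum>i<n. tau_apply (t_module (a i)) (u i) $ j))"

definition special_point :: "'c vec" where
  "special_point =
     delta1 (\<lambda>l. if l = r then twist_poly (- 1) (Q r) * t_theta ^ s r else 0)"

end

end

theory Submission
  imports "HOL-Algebra.Finite_Extensions" Defs
begin

text \<open>
  On the motive, \<open>\<sigma>\<close> has a formal inverse once functions with poles at \<open>\<theta>\<^sup>q, \<theta>\<^bsup>q^2\<^esup>, \<dots>\<close> are allowed, and
  the \<open>i\<close>-th coefficient of \<open>Log\<close> has the columns \<open>\<delta>\<^sub>0(\<sigma>\<^sup>-\<^sup>i w\<^sub>j)\<close>: since \<open>\<delta>\<^sub>0\<close> kills \<open>\<sigma>M\<close> and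
  intertwines \<open>a(t)\<close> with \<open>d[a]\<close>, these matrices satisfy \<open>P E'\<^sub>a = d[a] P\<close>.

  The point is \<open>\<delta>\<^sub>1(\<sigma>h) = \<delta>\<^sub>1(h)\<close> for \<open>h = \<Sum>\<^sub>l (-1)\<^bsup>r-l\<^esup> Q\<^sub>l \<cdots> Q\<^sub>r m\<^sub>l\<close>. Write \<open>h = \<Sum>\<^sub>k t\<^sup>k h\<^sub>k\<close> where \<open>h\<^sub>k\<close>
  has constant coordinates. Each \<open>h\<^sub>k\<close> is a combination of the \<open>w\<^sub>j\<close>, so \<open>Log(\<delta>\<^sub>1(h\<^sub>k)) = \<Sum>\<^sub>i \<delta>\<^sub>0(\<sigma>\<^sup>-\<^sup>i h\<^sub>k)\<close>,
  which converges by the bounds on the norms of the \<open>Q\<^sub>i\<close>. Hence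
  \<open>\<Sum>\<^sub>k d[\<theta>\<^sup>k] Log(\<delta>\<^sub>1(h\<^sub>k)) = \<Sum>\<^sub>i \<delta>\<^sub>0(\<sigma>\<^sup>-\<^sup>i h)\<close>, and the coordinates of \<open>\<sigma>\<^sup>-\<^sup>i h\<close> are, up to powers of
  \<open>\<Omega>\<close>, the parts of \<open>L\<^sup>*\<close> whose largest index is \<open>i\<close>.
\<close>

section \<open>Algebraic elements\<close>

text \<open>The coordinates of h may have degree beyond d_l, so h itself need not be a combination
  of the w_j and its Log has no direct formula. Each h_k is one: as d_l >= 1, every m_l is itself
  among the w_j, so no positive power of sigma enters. Every coordinate of h contains Q_r, which is
  why the strict bound sits there: the n-th twist of that factor decays like the q^n-th power of a
  number below 1, while the twists of the other factors stay bounded. All estimates use the Gauss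
  norm on the disc of radius |theta|^q. Omega has no zero strictly inside, so division by it
  preserves boundedness; theta lies strictly inside, so Taylor coefficients at theta are continuous
  for this norm; and the ultrametric inequality keeps the constants from growing under iteration.
  The module, Exp and Log are definite descriptions, so uniqueness must accompany existence. Exp is
  obtained as the formal inverse of the matrices of Log, not the other way round.\<close>

lemma algebraic_closure_in_subfield:
  fixes S :: "'a::field set"
  assumes one: "1 \<in> S" and diff: "\<And>x y. x \<in> S \<Longrightarrow> y \<in> S \<Longrightarrow> x - y \<in> S"
    and mult: "\<And>x y. x \<in> S \<Longrightarrow> y \<in> S \<Longrightarrow> x * y \<in> S"
    and inv: "\<And>x. x \<in> S \<Longrightarrow> inverse x \<in> S"
    and x: "x \<in> algebraic_closure_in S" and y: "y \<in> algebraic_closure_in S"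
  shows "x + y \<in> algebraic_closure_in S" "x * y \<in> algebraic_closure_in S"
    "- x \<in> algebraic_closure_in S"
proof -
  \<comment> \<open>The type-class field is repackaged as a record so that
    \<open>R.subfield_of_algebraics\<close> applies. Polynomials over the record list the leading
    coefficient first, hence every \<open>rev\<close> below.\<close>
  define R :: "'a ring" where
    "R = \<lparr>carrier = UNIV, monoid.mult = (*), one = 1, ring.zero = 0, add = (+)\<rparr>"
  have R_simps [simp]: "carrier R = UNIV" "monoid.mult R = (*)" "one R = 1" "ring.zero R = 0"
    "add R = (+)"
    by (simp_all add: R_def)
  interpret R: field R
  proof -
    have "\<exists>y. x + y = 0" for x :: 'a by (rule exI[of _ "- x"]) simp
    moreover have "\<exists>y. x * y = 1" if "x \<noteq> 0" for x :: 'a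
      by (rule exI[of _ "inverse x"]) (use that in simp)
    ultimately show "field R"
      unfolding R_def by unfold_locales (auto simp: algebra_simps Units_def)
  qed
  have zero: "0 \<in> S" using diff[OF one one] by simp
  have neg: "- z \<in> S" if "z \<in> S" for z using diff[OF zero that] by simp
  have add: "u + v \<in> S" if "u \<in> S" "v \<in> S" for u v using diff[OF that(1) neg[OF that(2)]] by simp
  have a_inv: "a_inv R z = - z" for z
    using R.minus_equality[of "- z" z] by simp
  have m_inv: "m_inv R z = inverse z" if "z \<noteq> 0" for z
    using R.inv_char[of z "inverse z"] that by simp
  have sub: "subring S R"
    by (rule R.subringI) (use one neg mult add in \<open>auto simp: a_inv\<close>)
  have subf: "subfield S R"
    by (rule R.subfieldI'[OF sub]) (use inv m_inv in auto)
  have pow: "z [^]\<^bsub>R\<^esub> (n::nat) = z ^ n" for z n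
    by (induction n) (simp_all add: mult.commute)
  have ev: "R.eval (rev cs) z = poly (Poly cs) z" for cs z
    by (induction cs) (simp_all add: R.eval_append pow mult.commute)
  have carr: "p \<in> carrier (S [X]\<^bsub>R\<^esub>) \<longleftrightarrow> p = [] \<or> (set p \<subseteq> S \<and> hd p \<noteq> 0)" for p
    by (auto simp: univ_poly_def polynomial_def)
  have alg: "(R.algebraic over S) z \<longleftrightarrow> z \<in> algebraic_closure_in S" for z
  proof
    assume "(R.algebraic over S) z"
    then obtain p where p: "p \<in> carrier (S [X]\<^bsub>R\<^esub>)" "p \<noteq> []" "R.eval p z = \<zero>\<^bsub>R\<^esub>"
      using R.algebraicE[OF sub] by auto
    define f where "f = Poly (rev p)"
    have cf: "coeffs f = rev p"
      using p(1,2) carr[of p] by (cases p) (auto simp: f_def)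
    have "poly f z = 0" using p(3) ev[of "rev p" z] by (simp add: f_def)
    moreover have "f \<noteq> 0" using cf p(2) by auto
    moreover have "set (coeffs f) \<subseteq> S" using p(1,2) carr[of p] cf by simp
    ultimately show "z \<in> algebraic_closure_in S" by (auto simp: algebraic_closure_in_def)
  next
    assume "z \<in> algebraic_closure_in S"
    then obtain f where f: "f \<noteq> 0" "set (coeffs f) \<subseteq> S" "poly f z = 0"
      by (auto simp: algebraic_closure_in_def)
    show "(R.algebraic over S) z"
    proof (rule R.algebraicI)
      show "rev (coeffs f) \<in> carrier (S [X]\<^bsub>R\<^esub>)"
        using f last_coeffs_eq_coeff_degree[of f] by (auto simp: carr hd_rev)
      show "rev (coeffs f) \<noteq> []" using f by simp
      show "R.eval (rev (coeffs f)) z = \<zero>\<^bsub>R\<^esub>" using f ev by simp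
    qed
  qed
  have sf: "subfield (algebraic_closure_in S) R"
    using R.subfield_of_algebraics[OF subf] by (simp add: alg)
  note sE = subringE[OF subfieldE(1)[OF sf]]
  show "x + y \<in> algebraic_closure_in S" using sE(7)[OF x y] by simp
  show "x * y \<in> algebraic_closure_in S" using sE(6)[OF x y] by simp
  show "- x \<in> algebraic_closure_in S" using sE(5)[OF x] by (simp add: a_inv)
qed

section \<open>Finite fields and additivity of the q-th power\<close>

text \<open>Multiplication by a nonzero \<open>x\<close> permutes the nonzero elements; comparing
  the products over all of them gives \<open>x ^ (q - 1) = 1\<close>.\<close>

lemma finite_field_power_card:
  fixes x :: "'f::{field,finite}"
  shows "x ^ card (UNIV :: 'f set) = x"
proof (cases "x = 0")
  case False
  let ?N = "UNIV - {0::'f}"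
  have "(\<Prod>y\<in>?N. x * y) = (\<Prod>y\<in>?N. y)"
    by (rule prod.reindex_bij_witness[of _ "\<lambda>y. y / x" "\<lambda>y. x * y"]) (use False in auto)
  then have "x ^ card ?N * \<Prod>?N = \<Prod>?N" by (simp add: prod.distrib)
  then have "x ^ card ?N = 1" by (simp add: prod_zero_iff)
  moreover have "card (UNIV :: 'f set) = Suc (card ?N)"
    by (simp add: card_Diff_singleton finite_UNIV_card_ge_0)
  ultimately show ?thesis by (simp only: power_Suc mult_1_right)
qed (simp add: finite_UNIV_card_ge_0)

text \<open>\<open>(X + 1)\<^sup>q - X\<^sup>q - 1\<close> has degree below \<open>q\<close> and vanishes on the whole field.\<close>
lemma of_nat_card_choose_eq_0:
  assumes "0 < k" "k < card (UNIV :: 'f::{field,finite} set)"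
  shows "of_nat (card (UNIV :: 'f set) choose k) = (0::'f)"
proof -
  define n where "n = card (UNIV :: 'f set)"
  define p :: "'f poly" where "p = [:1, 1:] ^ n - monom 1 n - 1"
  have n0: "n > 0" by (simp add: n_def finite_UNIV_card_ge_0)
  have c: "coeff p i = (if i = 0 \<or> i = n then 0 else of_nat (n choose i))" for i
  proof -
    have "coeff ([:1, 1:] ^ n :: 'f poly) i = of_nat (n choose i)"
      using coeff_linear_poly_power[of i n 1 1] by (cases "i \<le> n") (auto simp: coeff_eq_0 degree_linear_power binomial_eq_0)
    then show ?thesis using n0 by (auto simp: p_def)
  qed
  have "p = 0"
  proof (rule ccontr)
    assume nz: "p \<noteq> 0"
    have "degree p < n"
    proof (rule ccontr)
      assume "\<not> degree p < n"
      then have "coeff p (degree p) = 0" by (auto simp: c binomial_eq_0)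
      with nz show False by simp
    qed
    moreover have "poly p x = 0" for x
      using finite_field_power_card[of "1 + x"] finite_field_power_card[of x]
      by (simp add: p_def n_def poly_monom)
    ultimately show False
      using card_poly_roots_bound[OF nz] by (simp add: n_def)
  qed
  then have "coeff p k = 0" by simp
  with assms show ?thesis by (auto simp: c n_def)
qed

text \<open>Kept general in the ring because it is applied both to \<open>'c\<close> and to power
  series over \<open>'c\<close>.\<close>

lemma power_add_of_choose_eq_0:
  fixes x y :: "'a::comm_ring_1"
  assumes "n > 0" "\<And>k. 0 < k \<Longrightarrow> k < n \<Longrightarrow> of_nat (n choose k) = (0::'a)"
  shows "(x + y) ^ n = x ^ n + y ^ n"
proof -
  have "(x + y) ^ n = (\<Sum>k\<le>n. of_nat (n choose k) * x ^ k * y ^ (n - k))"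
    by (rule binomial_ring)
  also have "\<dots> = (\<Sum>k\<in>{0,n}. of_nat (n choose k) * x ^ k * y ^ (n - k))"
    by (rule sum.mono_neutral_right) (use assms in auto)
  finally show ?thesis using assms(1) by (simp add: add.commute)
qed

text \<open>The alternating sum is back substitution in a bidiagonal linear system. It serves twice:
  for the operator \<open>T\<close> and for explicit preimages under \<open>sigma\<close>.\<close>

lemma alternating_sum_rec:
  fixes a x :: "nat \<Rightarrow> 'a::comm_ring_1"
  assumes "l \<le> n"
  shows "(\<Sum>k=l..n. (-1) ^ (k - l) * (\<Prod>j=l..<k. a j) * x k)
    = x l - a l * (\<Sum>k=Suc l..n. (-1) ^ (k - Suc l) * (\<Prod>j=Suc l..<k. a j) * x k)"
proof -
  have "(\<Sum>k=Suc l..n. (-1) ^ (k - l) * (\<Prod>j=l..<k. a j) * x k)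
      = (\<Sum>k=Suc l..n. - (a l * ((-1) ^ (k - Suc l) * (\<Prod>j=Suc l..<k. a j) * x k)))"
  proof (rule sum.cong[OF refl])
    fix k assume "k \<in> {Suc l..n}"
    then have k: "l < k" and e: "k - l = Suc (k - Suc l)" by auto
    show "(-1) ^ (k - l) * (\<Prod>j=l..<k. a j) * x k
      = - (a l * ((-1) ^ (k - Suc l) * (\<Prod>j=Suc l..<k. a j) * x k))"
      unfolding e prod.atLeast_Suc_lessThan[OF k] by (simp add: mult.assoc)
  qed
  then show ?thesis
    using assms by (simp add: sum.atLeast_Suc_atMost sum_negf sum_distrib_left)
qed

context C_infinity
begin

section \<open>Absolute value and Frobenius\<close>

lemma emb_zero [simp]: "\<iota> 0 = 0"
  using emb_add[of 0 0] by (metis add_cancel_left_right add.right_neutral)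

lemma emb_of_nat: "\<iota> (of_nat n) = of_nat n"
  by (induction n) (simp_all add: emb_one emb_add)

lemma emb_uminus: "\<iota> (- x) = - \<iota> x"
  by (rule minus_unique[symmetric]) (simp flip: emb_add)

lemma emb_diff: "\<iota> (x - y) = \<iota> x - \<iota> y"
  using emb_add[of x "- y"] by (simp add: emb_uminus)

lemma emb_inverse: "\<iota> (inverse x) = inverse (\<iota> x)"
proof (cases "x = 0")
  case False
  then have "\<iota> x * \<iota> (inverse x) = 1" by (simp flip: emb_mult add: emb_one)
  then show ?thesis by (metis inverse_unique)
qed simp

lemma emb_power: "\<iota> (x ^ n) = \<iota> x ^ n"
  by (induction n) (simp_all add: emb_one emb_mult)

lemma q_ge_2: "q \<ge> 2"
proof -
  have "card {0, 1::'f} \<le> card (UNIV :: 'f set)" by (rule card_mono) auto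
  then show ?thesis by (simp add: q_eq)
qed

lemma q_pos [simp]: "q > 0" using q_ge_2 by simp
lemma q_nonzero [simp]: "q \<noteq> 0" using q_ge_2 by simp

lemma absv_0 [simp]: "absv (0::'c) = 0" by (simp add: absv_def)
lemma absv_nonneg [simp]: "absv (x::'c) \<ge> 0" by (simp add: absv_def)
lemma absv_eq_0 [simp]: "absv (x::'c) = 0 \<longleftrightarrow> x = 0" by (simp add: absv_def)
lemma absv_1 [simp]: "absv (1::'c) = 1"
  using absv_mult[of 1 1] absv_eq_0[of 1] by simp
lemma absv_power: "absv ((x::'c) ^ n) = absv x ^ n"
  by (induction n) (simp_all add: absv_mult)
lemma absv_uminus [simp]: "absv (- x) = absv (x::'c)"
proof -
  have "absv (-1::'c) ^ 2 = 1" by (simp flip: absv_power)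
  then have "absv (-1::'c) = 1" using absv_nonneg[of "-1"] by (simp add: power2_eq_1_iff)
  then show ?thesis using absv_mult[of "-1" x] by simp
qed
lemma absv_minus_commute: "absv (x - y) = absv (y - (x::'c))"
  using absv_uminus[of "x - y"] by simp
lemma absv_inverse: "absv (inverse (x::'c)) = inverse (absv x)"
proof (cases "x = 0")
  case False
  then have "absv x * absv (inverse x) = 1" by (simp flip: absv_mult)
  then show ?thesis by (metis inverse_unique)
qed simp
lemma absv_add_le: "absv (x::'c) \<le> C \<Longrightarrow> absv y \<le> C \<Longrightarrow> absv (x + y) \<le> C"
  using absv_ultrametric[of x y] by simp
lemma absv_diff_le: "absv (x::'c) \<le> C \<Longrightarrow> absv y \<le> C \<Longrightarrow> absv (x - y) \<le> C"
  using absv_add_le[of x C "- y"] by simp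
lemma absv_sum_le:
  assumes "0 \<le> C" "\<And>a. a \<in> A \<Longrightarrow> absv (f a :: 'c) \<le> C"
  shows "absv (sum f A) \<le> C"
  using assms by (induction A rule: infinite_finite_induct) (auto intro: absv_add_le)

lemma absv_theta: "absv \<theta> = real q"
  using absv_emb[of fls_X_inv] by (simp add: theta_def)

lemma theta_nonzero [simp]: "\<theta> \<noteq> 0"
  using absv_theta absv_eq_0[of \<theta>] q_pos by auto

lemma of_nat_q_choose: "0 < k \<Longrightarrow> k < q \<Longrightarrow> of_nat (q choose k) = (0::'c)"
  using of_nat_card_choose_eq_0[where 'f = 'f, of k]
  by (metis emb_of_nat emb_zero fls_const_0 fls_of_nat q_eq)

lemma power_q_add: "(x + y :: 'c) ^ q = x ^ q + y ^ q"
  by (rule power_add_of_choose_eq_0) (simp_all add: of_nat_q_choose)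

text \<open>The \<open>i\<close>-fold Frobenius, free of the case distinction and the description in \<open>frob\<close>.\<close>

definition fr :: "nat \<Rightarrow> 'c \<Rightarrow> 'c" where "fr i x = x ^ (q ^ i)"

lemma frob_of_nat: "frob (int i) = fr i"
  by (simp add: frob_def fr_def fun_eq_iff)
lemma fr_0_left [simp]: "fr 0 x = x" by (simp add: fr_def)
lemma fr_fr: "fr i (fr j x) = fr (i + j) x"
  by (simp add: fr_def power_add power_mult[symmetric] ac_simps)
lemma fr_mult: "fr i (x * y) = fr i x * fr i y" by (simp add: fr_def power_mult_distrib)
lemma fr_zero [simp]: "fr i 0 = 0" by (simp add: fr_def)
lemma fr_one [simp]: "fr i 1 = 1" by (simp add: fr_def)
lemma fr_add: "fr i (x + y) = fr i x + fr i y"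
proof (induction i)
  case (Suc i)
  have "fr (Suc i) z = fr i z ^ q" for z
    by (simp add: fr_def mult.commute flip: power_mult)
  with Suc show ?case by (simp add: power_q_add)
qed simp
lemma fr_uminus: "fr i (- x) = - fr i x"
  by (rule minus_unique[symmetric]) (simp flip: fr_add)
lemma fr_diff: "fr i (x - y) = fr i x - fr i y"
  using fr_add[of i x "- y"] by (simp add: fr_uminus)
lemma fr_sum: "fr i (sum f A) = (\<Sum>a\<in>A. fr i (f a))"
  by (induction A rule: infinite_finite_induct) (simp_all add: fr_add)
lemma fr_power: "fr i (x ^ n) = fr i x ^ n"
  by (simp add: fr_def power_mult[symmetric] ac_simps)
lemma fr_eq_0 [simp]: "fr i x = 0 \<longleftrightarrow> x = 0" by (simp add: fr_def)
lemma fr_inj: "fr i x = fr i y \<longleftrightarrow> x = y"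
  using fr_eq_0[of i "x - y"] by (simp add: fr_diff)
lemma fr_inverse: "fr i (inverse x) = inverse (fr i x)" by (simp add: fr_def power_inverse)
lemma absv_fr: "absv (fr i x) = absv x ^ (q ^ i)" by (simp add: fr_def absv_power)

text \<open>Consequently every twist fixes \<open>a(t)\<close>, which is why \<open>sigma\<close>
  and \<open>T\<close> commute with multiplication by it.\<close>

lemma fr_const: "fr i (\<iota> (fls_const c)) = \<iota> (fls_const c)"
proof -
  have p: "fls_const c ^ n = fls_const (c ^ n)" for n
    by (induction n) simp_all
  have "c ^ q = c" using finite_field_power_card[of c] q_eq by simp
  then have 1: "fr 1 (\<iota> (fls_const c)) = \<iota> (fls_const c)"
    using p[of q] by (simp add: fr_def flip: emb_power)
  show ?thesis
  proof (induction i)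
    case (Suc i) then show ?case using fr_fr[of i 1 "\<iota> (fls_const c)"] 1 by simp
  qed simp
qed

section \<open>The algebraic closure of \<open>K\<close>\<close>

lemma poly_t_coeff: "coeff (poly_t a) n = \<iota> (fls_const (coeff a n))"
  by (simp add: poly_t_def coeff_map_poly[of "\<lambda>c. \<iota> (fls_const c)"])

lemma poly_t_diff: "poly_t (a - b) = poly_t a - poly_t b"
proof -
  have "fls_const (x - y) = fls_const x - fls_const y" for x y :: 'f
    by (rule fls_eqI) simp
  then show ?thesis by (simp add: poly_eq_iff poly_t_coeff emb_diff)
qed

lemma poly_t_mult: "poly_t (a * b) = poly_t a * poly_t b"
proof -
  have s: "\<iota> (fls_const (sum f A)) = (\<Sum>x\<in>A. \<iota> (fls_const (f x)))" for f :: "nat \<Rightarrow> 'f" and A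
    by (induction A rule: infinite_finite_induct) (simp_all add: emb_add flip: fls_plus_const)
  show ?thesis
    by (simp add: poly_eq_iff poly_t_coeff coeff_mult s emb_mult flip: fls_const_mult_const)
qed

lemma poly_t_1: "poly_t 1 = 1"
  by (simp add: poly_eq_iff poly_t_coeff coeff_1 emb_one)

lemma poly_t_monom: "poly_t (monom 1 n) = monom 1 n"
  by (simp add: poly_eq_iff poly_t_coeff emb_one)

lemma absv_const: "absv (\<iota> (fls_const c)) = (if c = 0 then 0 else 1)"
  using absv_emb[of "fls_const c"] by simp

text \<open>The leading term has absolute value \<open>q ^ degree a\<close>, strictly above all
  others, so nothing can cancel it: \<open>\<theta>\<close> is transcendental over the finite field,
  and the denominators in \<open>K\<close> do not vanish.\<close>

lemma poly_t_theta_nonzero: assumes "a \<noteq> 0" shows "poly (poly_t a) \<theta> \<noteq> 0"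
proof -
  let ?n = "degree a" and ?f = "\<lambda>i. coeff (poly_t a) i * \<theta> ^ i"
  have deg: "degree (poly_t a) \<le> ?n"
    by (rule degree_le) (simp add: poly_t_coeff coeff_eq_0)
  have split: "poly (poly_t a) \<theta> = ?f ?n + sum ?f {..<?n}"
  proof -
    have "poly (poly_t a) \<theta> = sum ?f {..degree (poly_t a)}" by (rule poly_altdef)
    also have "\<dots> = sum ?f {..?n}"
      by (rule sum.mono_neutral_left) (use deg in \<open>auto simp: coeff_eq_0\<close>)
    finally show ?thesis by (simp add: lessThan_Suc_atMost[symmetric] add.commute)
  qed
  have lead: "absv (?f ?n) = real q ^ ?n"
    using assms by (simp add: absv_mult absv_power absv_theta poly_t_coeff absv_const)
  have low: "absv (sum ?f {..<?n}) < real q ^ ?n"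
  proof (cases "?n")
    case (Suc m)
    have "absv (sum ?f {..<?n}) \<le> real q ^ m"
    proof (rule absv_sum_le)
      fix i assume "i \<in> {..<?n}"
      then have "absv (?f i) \<le> 1 * real q ^ i" "i \<le> m"
        using Suc by (auto simp: absv_mult absv_power absv_theta poly_t_coeff absv_const)
      moreover have "real q ^ i \<le> real q ^ m"
        using \<open>i \<le> m\<close> q_ge_2 by (intro power_increasing) auto
      ultimately show "absv (?f i) \<le> real q ^ m" by simp
    qed simp
    also have "\<dots> < real q ^ ?n" using q_ge_2 Suc by (intro power_strict_increasing) auto
    finally show ?thesis .
  qed simp
  show ?thesis
  proof
    assume "poly (poly_t a) \<theta> = 0"
    then have "?f ?n = - sum ?f {..<?n}" using split by (simp add: eq_neg_iff_add_eq_0)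
    then have "absv (?f ?n) = absv (sum ?f {..<?n})" by (simp only: absv_uminus)
    with lead low show False by simp
  qed
qed

lemma K_one: "1 \<in> K"
  unfolding K_def by (rule CollectI, rule exI[of _ 1], rule exI[of _ 1]) (simp add: poly_t_1)

lemma K_diff: assumes "x \<in> K" "y \<in> K" shows "x - y \<in> K"
proof -
  obtain a b c d where *: "x = poly (poly_t a) \<theta> / poly (poly_t b) \<theta>" "b \<noteq> 0"
    "y = poly (poly_t c) \<theta> / poly (poly_t d) \<theta>" "d \<noteq> 0"
    using assms unfolding K_def by blast
  have "x - y = poly (poly_t (a * d - c * b)) \<theta> / poly (poly_t (b * d)) \<theta>"
    unfolding *(1,3) using poly_t_theta_nonzero[OF *(2)] poly_t_theta_nonzero[OF *(4)]
    by (simp add: poly_t_diff poly_t_mult diff_frac_eq)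
  then show ?thesis unfolding K_def
    by (intro CollectI exI[of _ "a * d - c * b"] exI[of _ "b * d"]) (use * in simp)
qed

lemma K_mult: assumes "x \<in> K" "y \<in> K" shows "x * y \<in> K"
proof -
  obtain a b c d where *: "x = poly (poly_t a) \<theta> / poly (poly_t b) \<theta>" "b \<noteq> 0"
    "y = poly (poly_t c) \<theta> / poly (poly_t d) \<theta>" "d \<noteq> 0"
    using assms unfolding K_def by blast
  have "x * y = poly (poly_t (a * c)) \<theta> / poly (poly_t (b * d)) \<theta>"
    using * by (simp add: poly_t_mult)
  then show ?thesis unfolding K_def
    by (intro CollectI exI[of _ "a * c"] exI[of _ "b * d"]) (use * in simp)
qed

lemma K_inverse: assumes "x \<in> K" shows "inverse x \<in> K"
proof -
  obtain a b where *: "x = poly (poly_t a) \<theta> / poly (poly_t b) \<theta>" "b \<noteq> 0"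
    using assms unfolding K_def by blast
  show ?thesis
  proof (cases "a = 0")
    case True
    then have "x = 0" using * by (simp add: poly_t_def)
    then show ?thesis using K_diff[OF K_one K_one] by simp
  next
    case False
    then show ?thesis unfolding K_def
      by (intro CollectI exI[of _ b] exI[of _ a]) (use *(1) in simp)
  qed
qed

lemma poly_t_in_K: "poly (poly_t a) \<theta> \<in> K"
  unfolding K_def by (rule CollectI, rule exI[of _ a], rule exI[of _ 1]) (simp add: poly_t_1)

lemma K_in_Kbar: assumes "x \<in> K" shows "x \<in> Kbar"
proof -
  have "- x \<in> K" using K_diff[OF K_diff[OF K_one K_one] assms] by simp
  then show ?thesis
    unfolding Kbar_def algebraic_closure_in_def using K_one
    by (auto intro!: exI[of _ "[:- x, 1:]"])
qed

lemmas Kbar_ring = algebraic_closure_in_subfield[OF K_one K_diff K_mult K_inverse, folded Kbar_def]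

lemma Kbar_add: "x \<in> Kbar \<Longrightarrow> y \<in> Kbar \<Longrightarrow> x + y \<in> Kbar" by (rule Kbar_ring(1))
lemma Kbar_mult: "x \<in> Kbar \<Longrightarrow> y \<in> Kbar \<Longrightarrow> x * y \<in> Kbar" by (rule Kbar_ring(2))
lemma Kbar_uminus: "x \<in> Kbar \<Longrightarrow> - x \<in> Kbar" by (rule Kbar_ring(3))
lemma Kbar_0 [simp]: "0 \<in> Kbar" using K_in_Kbar K_diff[OF K_one K_one] by simp
lemma Kbar_1 [simp]: "1 \<in> Kbar" by (rule K_in_Kbar[OF K_one])
lemma Kbar_power: "x \<in> Kbar \<Longrightarrow> x ^ n \<in> Kbar"
  by (induction n) (auto intro: Kbar_mult)
lemma Kbar_sum: "(\<And>a. a \<in> A \<Longrightarrow> f a \<in> Kbar) \<Longrightarrow> sum f A \<in> Kbar"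
  by (induction A rule: infinite_finite_induct) (auto intro: Kbar_add)
lemma Kbar_fr: "x \<in> Kbar \<Longrightarrow> fr i x \<in> Kbar" by (simp add: fr_def Kbar_power)
lemma Kbar_theta: "\<theta> \<in> Kbar"
  using K_in_Kbar[OF poly_t_in_K[of "monom 1 1"]] by (simp add: poly_t_monom poly_monom)
lemma Kbar_const: "\<iota> (fls_const c) \<in> Kbar"
  using K_in_Kbar[OF poly_t_in_K[of "[:c:]"]] by (simp add: poly_t_def map_poly_pCons)

lemma K_subset_range: "K \<subseteq> range \<iota>"
proof
  fix x assume "x \<in> K"
  have p: "poly (poly_t a) \<theta> \<in> range \<iota>" for a
  proof (induction a)
    case (pCons c a)
    then obtain y where y: "poly (poly_t a) \<theta> = \<iota> y" by auto
    have "poly (poly_t (pCons c a)) \<theta> = \<iota> (fls_const c + fls_X_inv * y)"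
      using y by (simp add: poly_t_def map_poly_pCons emb_add emb_mult theta_def)
    then show ?case by simp
  qed (auto simp: poly_t_def intro!: range_eqI[of _ _ 0])
  from \<open>x \<in> K\<close> obtain a b where x: "x = poly (poly_t a) \<theta> / poly (poly_t b) \<theta>"
    unfolding K_def by blast
  obtain y z where "poly (poly_t a) \<theta> = \<iota> y" "poly (poly_t b) \<theta> = \<iota> z"
    using p[of a] p[of b] by auto
  then have "x = \<iota> (y * inverse z)" using x by (simp only: emb_mult emb_inverse divide_inverse)
  then show "x \<in> range \<iota>" by simp
qed

lemma algebraic_closure_in_mono: "S \<subseteq> T \<Longrightarrow> algebraic_closure_in S \<subseteq> algebraic_closure_in T"
  by (auto simp: algebraic_closure_in_def)

text \<open>If \<open>p\<close> annihilates \<open>x ^ n\<close>, then \<open>p\<close> composed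
  with the n-th power annihilates \<open>x\<close> and has the same coefficients, interspersed with
  zeros.\<close>

lemma Kbar_root_closed:
  assumes "x ^ n \<in> Kbar" "n > 0"
  shows "x \<in> Kbar"
proof -
  obtain p where p: "p \<noteq> 0" "set (coeffs p) \<subseteq> K" "poly p (x ^ n) = 0"
    using assms(1) by (auto simp: Kbar_def algebraic_closure_in_def)
  define P where "P = pcompose p (monom 1 n)"
  have zK: "0 \<in> K" using K_diff[OF K_one K_one] by simp
  have "coeff P i \<in> K" for i
  proof -
    have "coeff P i = (if n dvd i then coeff p (i div n) else 0)"
    proof -
      have "P = (\<Sum>j\<le>degree p. monom (coeff p j) (n * j))"
        unfolding P_def pcompose_altdef poly_altdef
        by (simp add: degree_map_poly coeff_map_poly monom_power smult_monom mult.commute)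
      then have "coeff P i = (\<Sum>j\<le>degree p. if n * j = i then coeff p j else 0)"
        by (simp add: coeff_sum)
      also have "\<dots> = (if n dvd i then coeff p (i div n) else 0)"
      proof (cases "n dvd i")
        case True
        then have "(n * j = i) = (j = i div n)" for j using assms(2) by auto
        then show ?thesis using True by (simp add: coeff_eq_0)
      next
        case False
        then have "n * j \<noteq> i" for j by auto
        then show ?thesis using False by simp
      qed
      finally show ?thesis .
    qed
    moreover have "range (coeff p) \<subseteq> K" using p(2) zK by (simp add: range_coeff)
    ultimately show ?thesis using zK by auto
  qed
  then have "set (coeffs P) \<subseteq> K" by (auto simp: coeffs_def)
  moreover have "P \<noteq> 0"
  proof
    assume "P = 0"
    then have "degree (monom (1::'c) n) = 0"
      using p(1) pcompose_eq_0_iff[of "monom 1 n" p] assms(2) by (auto simp: P_def degree_monom_eq)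
    then show False using assms(2) by (simp add: degree_monom_eq)
  qed
  moreover have "poly P x = 0" using p(3) by (simp add: P_def poly_pcompose poly_monom)
  ultimately show ?thesis by (auto simp: Kbar_def algebraic_closure_in_def)
qed

text \<open>The assumption \<open>alg_closed\<close> only provides a root algebraic over the Laurent
  series field; \<open>Kbar_root_closed\<close> brings it back into \<open>Kbar\<close>.\<close>

lemma Kbar_qroot: assumes "c \<in> Kbar" obtains x where "x \<in> Kbar" "fr 1 x = c"
proof -
  define p where "p = monom 1 q - [:c:]"
  have cl: "Kbar \<subseteq> algebraic_closure_in (range \<iota>)"
    unfolding Kbar_def by (rule algebraic_closure_in_mono[OF K_subset_range])
  have "coeff p i \<in> Kbar" for i
    using assms Kbar_uminus[OF assms] q_pos by (auto simp: p_def coeff_pCons split: nat.split)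
  then have "set (coeffs p) \<subseteq> algebraic_closure_in (range \<iota>)" using cl by (auto simp: coeffs_def)
  moreover have "coeff p q = 1" using q_pos by (simp add: p_def coeff_pCons split: nat.split)
  then have "degree p > 0" using le_degree[of p q] less_le_trans[OF q_pos] by simp
  ultimately obtain x where "poly p x = 0" using alg_closed by blast
  then have "x ^ q = c" by (simp add: p_def poly_monom)
  then show thesis using that[of x] Kbar_root_closed[of x q] assms by (simp add: fr_def)
qed

text \<open>The description inside \<open>frob\<close> denotes on \<open>Kbar\<close>: a q-th root
  exists there, and it is unique because the q-th power is additive with trivial kernel.\<close>

lemma frob_m1: assumes "c \<in> Kbar" shows "frob (-1) c \<in> Kbar" "fr 1 (frob (-1) c) = c"
proof -
  obtain x where x: "x \<in> Kbar" "fr 1 x = c" using Kbar_qroot[OF assms] .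
  have "frob (-1) c = x"
    unfolding frob_def using x fr_inj[of 1] by (auto simp: fr_def intro!: the_equality)
  with x show "frob (-1) c \<in> Kbar" "fr 1 (frob (-1) c) = c" by auto
qed

lemma frob_m1_fr: "x \<in> Kbar \<Longrightarrow> frob (-1) (fr 1 x) = x"
  using frob_m1[of "fr 1 x"] fr_inj[of 1] Kbar_fr by blast

lemma frob_m1_0 [simp]: "frob (-1) 0 = 0" using frob_m1_fr[of 0] by simp

lemma theta_power_inj: "\<theta> ^ m = \<theta> ^ n \<Longrightarrow> m = n"
proof -
  assume "\<theta> ^ m = \<theta> ^ n"
  then have "real q ^ m = real q ^ n" by (metis absv_power absv_theta)
  then show "m = n" using q_ge_2 by (simp add: power_inject_exp)
qed

text \<open>Gives enough arguments to recover the coefficients of an additive polynomial from its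
  values.\<close>

lemma infinite_Kbar: "infinite Kbar"
proof -
  have "inj (\<lambda>n. \<theta> ^ n)" by (rule injI) (rule theta_power_inj)
  then have "infinite (range (\<lambda>n. \<theta> ^ n))" by (rule range_inj_infinite)
  then show ?thesis using Kbar_power[OF Kbar_theta] by (meson finite_subset image_subsetI)
qed

section \<open>Polynomials over the algebraic closure of K\<close>

definition Kpoly :: "'c poly set" where "Kpoly = {p. \<forall>i. coeff p i \<in> Kbar}"

lemma Kpoly_iff: "p \<in> Kpoly \<longleftrightarrow> set (coeffs p) \<subseteq> Kbar"
proof
  assume "set (coeffs p) \<subseteq> Kbar"
  then have "range (coeff p) \<subseteq> Kbar" using range_coeff[of p] by simp
  then show "p \<in> Kpoly" by (auto simp: Kpoly_def)
qed (auto simp: coeffs_def Kpoly_def)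

lemma Kpoly_0 [simp]: "0 \<in> Kpoly" by (simp add: Kpoly_def)
lemma Kpoly_1 [simp]: "1 \<in> Kpoly" by (simp add: Kpoly_def coeff_1)
lemma Kpoly_add: "p \<in> Kpoly \<Longrightarrow> p' \<in> Kpoly \<Longrightarrow> p + p' \<in> Kpoly"
  by (simp add: Kpoly_def Kbar_add)
lemma Kpoly_uminus: "p \<in> Kpoly \<Longrightarrow> - p \<in> Kpoly" by (simp add: Kpoly_def Kbar_uminus)
lemma Kpoly_diff: "p \<in> Kpoly \<Longrightarrow> p' \<in> Kpoly \<Longrightarrow> p - p' \<in> Kpoly"
  using Kpoly_add[of p "- p'"] Kpoly_uminus[of p'] by simp
lemma Kpoly_mult: "p \<in> Kpoly \<Longrightarrow> p' \<in> Kpoly \<Longrightarrow> p * p' \<in> Kpoly"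
  by (simp add: Kpoly_def coeff_mult Kbar_sum Kbar_mult)
lemma Kpoly_power: "p \<in> Kpoly \<Longrightarrow> p ^ n \<in> Kpoly"
  by (induction n) (auto intro: Kpoly_mult)
lemma Kpoly_sum: "(\<And>a. a \<in> A \<Longrightarrow> f a \<in> Kpoly) \<Longrightarrow> sum f A \<in> Kpoly"
  by (induction A rule: infinite_finite_induct) (auto intro: Kpoly_add)
lemma Kpoly_prod: "(\<And>a. a \<in> A \<Longrightarrow> f a \<in> Kpoly) \<Longrightarrow> prod f A \<in> Kpoly"
  by (induction A rule: infinite_finite_induct) (auto intro: Kpoly_mult)
lemma Kpoly_const: "c \<in> Kbar \<Longrightarrow> [:c:] \<in> Kpoly"
  by (simp add: Kpoly_def coeff_pCons split: nat.split)
lemma Kpoly_poly_t: "poly_t a \<in> Kpoly" by (simp add: Kpoly_def poly_t_coeff Kbar_const)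
lemma Kpoly_t_theta: "[:- \<theta>, 1:] \<in> Kpoly"
  by (simp add: Kpoly_def coeff_pCons Kbar_theta Kbar_uminus split: nat.split)

section \<open>Limits and series\<close>

lemma absv_pos: "x \<noteq> 0 \<Longrightarrow> 0 < absv (x::'c)"
  unfolding absv_def by (simp add: zero_less_dist_iff)

lemma tendsto_zero_squeeze:
  fixes f g :: "'x \<Rightarrow> real"
  assumes "(g \<longlongrightarrow> 0) F" "\<And>x. 0 \<le> f x" "\<And>x. f x \<le> g x"
  shows "(f \<longlongrightarrow> 0) F"
  by (rule tendsto_sandwich[OF _ _ tendsto_const assms(1)]) (simp_all add: assms)

lemma tendsto_absv_iff: "(f \<longlongrightarrow> (l::'c)) F \<longleftrightarrow> ((\<lambda>x. absv (f x - l)) \<longlongrightarrow> 0) F"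
  using tendsto_dist_iff[of f l F] by (simp add: dist_absv)

text \<open>The metric of \<open>'c\<close> is tied to its field operations only through the locale
  assumptions, so their continuity is derived from \<open>absv\<close>.\<close>

lemma ct_tendsto_add:
  assumes "(f \<longlongrightarrow> (l::'c)) F" "(g \<longlongrightarrow> m) F"
  shows "((\<lambda>x. f x + g x) \<longlongrightarrow> l + m) F"
proof -
  have a: "((\<lambda>x. absv (f x - l) + absv (g x - m)) \<longlongrightarrow> 0) F"
    using tendsto_add[OF assms[unfolded tendsto_absv_iff]] by simp
  have b: "absv (f x + g x - (l + m)) \<le> absv (f x - l) + absv (g x - m)" for x
    unfolding add_diff_add
    by (rule order_trans[OF absv_ultrametric]) (rule max.boundedI, simp_all)
  show ?thesis
    unfolding tendsto_absv_iff by (rule tendsto_zero_squeeze[OF a _ b]) simp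
qed

lemma ct_tendsto_cmult:
  assumes "(f \<longlongrightarrow> (l::'c)) F"
  shows "((\<lambda>x. c * f x) \<longlongrightarrow> c * l) F"
  using tendsto_mult_left[OF assms[unfolded tendsto_absv_iff], of "absv c"]
  by (simp add: tendsto_absv_iff absv_mult flip: right_diff_distrib)

lemma ct_tendsto_diff:
  assumes "(f \<longlongrightarrow> (l::'c)) F" "(g \<longlongrightarrow> m) F"
  shows "((\<lambda>x. f x - g x) \<longlongrightarrow> l - m) F"
  using ct_tendsto_add[OF assms(1) ct_tendsto_cmult[OF assms(2), of "-1"]] by simp

lemma ct_tendsto_fr:
  assumes "(f \<longlongrightarrow> l) F"
  shows "((\<lambda>x. fr i (f x)) \<longlongrightarrow> fr i l) F"
proof -
  have "((\<lambda>x. absv (f x - l) ^ (q ^ i)) \<longlongrightarrow> 0 ^ (q ^ i)) F"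
    by (intro tendsto_power assms[unfolded tendsto_absv_iff])
  then show ?thesis
    by (simp add: tendsto_absv_iff[of "\<lambda>x. fr i (f x)"] absv_fr power_0_left flip: fr_diff)
qed

lemma ct_limit_le:
  assumes "(f \<longlongrightarrow> (l::'c)) F" "F \<noteq> bot" "eventually (\<lambda>x. absv (f x) \<le> C) F"
  shows "absv l \<le> C"
proof -
  have "((\<lambda>x. absv (f x)) \<longlongrightarrow> absv l) F"
    unfolding absv_def by (intro tendsto_dist assms tendsto_const)
  then show ?thesis using assms tendsto_upperbound by blast
qed

lemma absv_partial_sum_diff:
  fixes m n :: nat
  assumes "0 \<le> C" "\<And>i. m \<le> i \<Longrightarrow> absv (f i :: 'c) \<le> C" "m \<le> n"
  shows "absv (sum f {..<n} - sum f {..<m}) \<le> C"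
proof -
  have "sum f {..<n} - sum f {..<m} = sum f {m..<n}"
    using sum_diff_nat_ivl[of 0 m n f] assms(3) by (simp add: atLeast0LessThan)
  then show ?thesis using assms by (auto intro!: absv_sum_le)
qed

text \<open>In an ultrametric, a difference of partial sums is no larger than its largest term, so
  terms tending to zero already make the partial sums Cauchy.\<close>

lemma ct_summable:
  assumes "(\<lambda>n. absv (f n :: 'c)) \<longlonglongrightarrow> 0"
  shows "summable f"
proof -
  have "Cauchy (\<lambda>n. sum f {..<n})"
  proof (rule metric_CauchyI)
    fix e :: real assume "e > 0"
    then obtain N where N: "\<And>n. n \<ge> N \<Longrightarrow> absv (f n) < e / 2"
      using LIMSEQ_D[OF assms, of "e / 2"] by auto
    have N2: "absv (sum f {..<n} - sum f {..<N}) \<le> e / 2" if "n \<ge> N" for n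
      using absv_partial_sum_diff[of "e / 2" N f n] N \<open>e > 0\<close> that by (auto intro: less_imp_le)
    have "absv (sum f {..<m} - sum f {..<n}) < e" if "m \<ge> N" "n \<ge> N" for m n
      using absv_diff_le[OF N2[OF that(1)] N2[OF that(2)]] \<open>e > 0\<close> by simp
    then show "\<exists>M. \<forall>m\<ge>M. \<forall>n\<ge>M. dist (sum f {..<m}) (sum f {..<n}) < e"
      by (intro exI[of _ N]) (simp add: dist_absv)
  qed
  then show ?thesis
    unfolding summable_def sums_def using Cauchy_convergent convergent_def by blast
qed

lemma ct_sums_add: "f sums (a::'c) \<Longrightarrow> g sums b \<Longrightarrow> (\<lambda>n. f n + g n) sums (a + b)"
  unfolding sums_def using ct_tendsto_add by (simp add: sum.distrib)

lemma ct_sums_cmult: "f sums (a::'c) \<Longrightarrow> (\<lambda>n. c * f n) sums (c * a)"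
  unfolding sums_def using ct_tendsto_cmult by (simp flip: sum_distrib_left)

lemma ct_sums_diff: "f sums (a::'c) \<Longrightarrow> g sums b \<Longrightarrow> (\<lambda>n. f n - g n) sums (a - b)"
  unfolding sums_def using ct_tendsto_diff by (simp add: sum_subtractf)

lemma ct_sums_sum:
  "(\<And>a. a \<in> A \<Longrightarrow> f a sums (l a :: 'c)) \<Longrightarrow> (\<lambda>n. \<Sum>a\<in>A. f a n) sums (\<Sum>a\<in>A. l a)"
proof (induction A rule: infinite_finite_induct)
  case (insert x F)
  then show ?case using ct_sums_add[of "f x" "l x"] by simp
qed (simp_all add: sums_def)

lemma ct_sums_tail_le:
  assumes "f sums (a::'c)" "\<And>i. N \<le> i \<Longrightarrow> absv (f i) \<le> C" "0 \<le> C"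
  shows "absv (a - sum f {..<N}) \<le> C"
proof (rule ct_limit_le)
  show "(\<lambda>n. sum f {..<n} - sum f {..<N}) \<longlonglongrightarrow> a - sum f {..<N}"
    using assms(1) unfolding sums_def by (intro ct_tendsto_diff tendsto_const)
  show "eventually (\<lambda>n. absv (sum f {..<n} - sum f {..<N}) \<le> C) sequentially"
    using absv_partial_sum_diff[OF assms(3,2)] by (auto intro: eventually_sequentiallyI[of N])
qed simp

lemma ct_sums_le:
  assumes "f sums (a::'c)" "\<And>i. absv (f i) \<le> C"
  shows "absv a \<le> C"
  using ct_sums_tail_le[OF assms(1), of 0 C] assms(2) order_trans[OF absv_nonneg assms(2)] by simp

section \<open>Bounded power series\<close>

text \<open>The absolute value of \<open>\<theta> ^ q\<close>, the zero of Omega nearest to the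
  origin. The radius exceeds \<open>q\<close>, so evaluation near \<open>\<theta>\<close> converges
  geometrically.\<close>

definition R :: real where "R = real q ^ q"

lemma R_gt: "real q < R"
  using power_strict_increasing[of 1 q "real q"] q_ge_2 by (simp add: R_def)

lemma R_gt_1: "1 < R" using R_gt q_ge_2 by linarith
lemma R_pos [simp]: "0 < R" "0 \<le> R" "R \<noteq> 0" using R_gt_1 by simp_all

text \<open>The Gauss norm on the disc of radius \<open>R = |\<theta>|\<^sup>q\<close>, up to the first zero of \<open>\<Omega>\<close>, is at most \<open>C\<close>.\<close>
definition gb :: "real \<Rightarrow> 'c fps \<Rightarrow> bool" where
  "gb C f \<longleftrightarrow> (\<forall>n. absv (fps_nth f n) * R ^ n \<le> C)"

definition bdd :: "'c fps \<Rightarrow> bool" where "bdd f \<longleftrightarrow> (\<exists>C. gb C f)"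

lemma gb_nth: "gb C f \<Longrightarrow> absv (fps_nth f n) \<le> C / R ^ n"
  by (simp add: gb_def field_simps)

lemma gb_nonneg: "gb C f \<Longrightarrow> 0 \<le> C"
  unfolding gb_def by (rule order_trans[OF absv_nonneg[of "fps_nth f 0"]]) (metis mult_1_right power_0)

lemma gb_mono: "gb C f \<Longrightarrow> C \<le> D \<Longrightarrow> gb D f"
  unfolding gb_def using order_trans by blast

lemma gb_add: "gb C f \<Longrightarrow> gb C g \<Longrightarrow> gb C (f + g)"
  unfolding gb_def using absv_add_le[of "fps_nth f n" "C / R ^ n" "fps_nth g n" for n]
  by (simp add: field_simps)

lemma gb_uminus: "gb C f \<Longrightarrow> gb C (- f)" by (simp add: gb_def)

lemma gb_diff: "gb C f \<Longrightarrow> gb C g \<Longrightarrow> gb C (f - g)"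
  using gb_add[of C f "- g"] gb_uminus[of C g] by simp

lemma gb_zero: "0 \<le> C \<Longrightarrow> gb C 0" by (simp add: gb_def)

lemma gb_sum: "0 \<le> C \<Longrightarrow> (\<And>a. a \<in> A \<Longrightarrow> gb C (f a)) \<Longrightarrow> gb C (sum f A)"
  by (induction A rule: infinite_finite_induct) (auto intro: gb_add gb_zero)

lemma gb_mult:
  assumes "gb C f" "gb D g"
  shows "gb (C * D) (f * g)"
  unfolding gb_def
proof
  fix n
  have "absv (fps_nth (f * g) n) \<le> C * D / R ^ n"
    unfolding fps_mult_nth
  proof (rule absv_sum_le)
    fix i assume i: "i \<in> {0..n}"
    have "absv (fps_nth f i * fps_nth g (n - i)) \<le> (C / R ^ i) * (D / R ^ (n - i))"
      unfolding absv_mult using assms gb_nonneg[OF assms(1)] by (intro mult_mono gb_nth) auto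
    also have "\<dots> = C * D / R ^ n" using i by (simp flip: power_add)
    finally show "absv (fps_nth f i * fps_nth g (n - i)) \<le> C * D / R ^ n" .
  qed (use assms gb_nonneg in auto)
  then show "absv (fps_nth (f * g) n) * R ^ n \<le> C * D" by (simp add: field_simps)
qed

lemma gb_const: "gb (absv c) (fps_const c)" by (simp add: gb_def)

lemma gb_one: "gb 1 1" using gb_const[of 1] by simp

lemma gb_power: "gb C f \<Longrightarrow> gb (C ^ n) (f ^ n)"
  by (induction n) (auto intro: gb_mult gb_one)

lemma gb_prod: "(\<And>a. a \<in> A \<Longrightarrow> gb (C a) (f a)) \<Longrightarrow> gb (prod C A) (prod f A)"
  by (induction A rule: infinite_finite_induct) (auto intro: gb_mult gb_one)

lemma gb_X: "gb R fps_X" by (simp add: gb_def)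

lemma gauss_norm_ge: "absv (coeff p i) \<le> gauss_norm (p :: 'c poly)"
proof (cases "i \<le> degree p")
  case True
  then show ?thesis unfolding gauss_norm_def by (intro Max_ge) auto
next
  case False
  have "absv (coeff p 0) \<le> gauss_norm p" unfolding gauss_norm_def by (intro Max_ge) auto
  then show ?thesis using False order_trans[OF absv_nonneg] by (simp add: coeff_eq_0)
qed

lemma gauss_norm_nonneg: "0 \<le> gauss_norm (p :: 'c poly)"
  by (rule order_trans[OF absv_nonneg gauss_norm_ge])

lemma gb_of_poly: "gb (gauss_norm p * R ^ degree p) (fps_of_poly p)"
  unfolding gb_def
proof
  fix n
  show "absv (fps_nth (fps_of_poly p) n) * R ^ n \<le> gauss_norm p * R ^ degree p"
  proof (cases "n \<le> degree p")
    case True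
    have "absv (coeff p n) * R ^ n \<le> gauss_norm p * R ^ degree p"
      using R_gt_1 True by (intro mult_mono power_increasing gauss_norm_ge gauss_norm_nonneg) auto
    then show ?thesis by simp
  next
    case False
    then show ?thesis using gauss_norm_nonneg by (simp add: coeff_eq_0)
  qed
qed

lemma bdd_add: "bdd f \<Longrightarrow> bdd g \<Longrightarrow> bdd (f + g)"
  unfolding bdd_def by (meson gb_add gb_mono max.cobounded1 max.cobounded2)
lemma bdd_mult: "bdd f \<Longrightarrow> bdd g \<Longrightarrow> bdd (f * g)"
  unfolding bdd_def by (meson gb_mult)
lemma bdd_const [simp]: "bdd (fps_const c)" unfolding bdd_def using gb_const by blast
lemma bdd_0 [simp]: "bdd 0" using bdd_const[of 0] by simp
lemma bdd_1 [simp]: "bdd 1" using bdd_const[of 1] by simp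
lemma bdd_uminus: "bdd f \<Longrightarrow> bdd (- f)" unfolding bdd_def by (meson gb_uminus)
lemma bdd_diff: "bdd f \<Longrightarrow> bdd g \<Longrightarrow> bdd (f - g)"
  using bdd_add[of f "- g"] bdd_uminus by simp
lemma bdd_X [simp]: "bdd fps_X" unfolding bdd_def using gb_X by blast
lemma bdd_of_poly [simp]: "bdd (fps_of_poly p)" unfolding bdd_def using gb_of_poly by blast
lemma bdd_power: "bdd f \<Longrightarrow> bdd (f ^ n)" by (induction n) (auto intro: bdd_mult)
lemma bdd_sum: "(\<And>a. a \<in> A \<Longrightarrow> bdd (f a)) \<Longrightarrow> bdd (sum f A)"
  by (induction A rule: infinite_finite_induct) (auto intro: bdd_add)
section \<open>Values and Taylor coefficients\<close>

lemma fps_value_sums: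
  assumes "bdd f" "absv x \<le> real q"
  shows "(\<lambda>n. fps_nth f n * x ^ n) sums fps_value f x"
proof -
  obtain C where C: "gb C f" using assms(1) by (auto simp: bdd_def)
  have le: "absv (fps_nth f n * x ^ n) \<le> C * (real q / R) ^ n" for n
  proof -
    have "absv (fps_nth f n * x ^ n) \<le> (C / R ^ n) * real q ^ n"
      unfolding absv_mult absv_power using C assms(2) gb_nonneg[OF C]
      by (intro mult_mono gb_nth power_mono) auto
    then show ?thesis by (simp add: power_divide)
  qed
  have "(\<lambda>n. C * (real q / R) ^ n) \<longlonglongrightarrow> C * 0"
    using R_gt by (intro tendsto_mult tendsto_const LIMSEQ_power_zero) simp
  then have "(\<lambda>n. C * (real q / R) ^ n) \<longlonglongrightarrow> 0" by simp
  then have "(\<lambda>n. absv (fps_nth f n * x ^ n)) \<longlonglongrightarrow> 0"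
    by (rule tendsto_zero_squeeze) (simp_all add: le)
  then show ?thesis unfolding fps_value_def by (intro summable_sums ct_summable)
qed

lemma fps_value_add:
  assumes "bdd f" "bdd g" "absv x \<le> real q"
  shows "fps_value (f + g) x = fps_value f x + fps_value g x"
  using ct_sums_add[OF fps_value_sums[OF assms(1,3)] fps_value_sums[OF assms(2,3)]]
    sums_unique2[OF fps_value_sums[OF bdd_add[OF assms(1,2)] assms(3)]]
  by (simp add: algebra_simps)

lemma fps_value_cmult:
  assumes "bdd f" "absv x \<le> real q"
  shows "fps_value (fps_const c * f) x = c * fps_value f x"
  using ct_sums_cmult[OF fps_value_sums[OF assms], of c]
    sums_unique2[OF fps_value_sums[OF bdd_mult[OF bdd_const assms(1)] assms(2), of c]]
  by (simp add: algebra_simps)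

lemma fps_value_X_mult:
  assumes "bdd f" "absv x \<le> real q"
  shows "fps_value (fps_X * f) x = x * fps_value f x"
proof -
  have "(\<lambda>N. \<Sum>n<N. x * (fps_nth f n * x ^ n)) \<longlonglongrightarrow> x * fps_value f x"
    using ct_sums_cmult[OF fps_value_sums[OF assms], of x] by (simp add: sums_def)
  moreover have "(\<Sum>n<Suc N. fps_nth (fps_X * f) n * x ^ n) = (\<Sum>n<N. x * (fps_nth f n * x ^ n))" for N
    by (subst sum.lessThan_Suc_shift) (simp add: algebra_simps)
  ultimately have "(\<lambda>n. fps_nth (fps_X * f) n * x ^ n) sums (x * fps_value f x)"
    unfolding sums_def by (subst filterlim_sequentially_Suc[symmetric]) simp
  then show ?thesis
    using sums_unique2[OF fps_value_sums[OF bdd_mult[OF bdd_X assms(1)] assms(2)]] by simp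
qed

lemma fps_value_const [simp]: "fps_value (fps_const c) x = c"
proof -
  have "(\<lambda>n. fps_nth (fps_const c) n * x ^ n) sums (\<Sum>n<1. fps_nth (fps_const c) n * x ^ n)"
    unfolding sums_def by (rule tendsto_eventually, rule eventually_sequentiallyI[of 1])
      (rule sum.mono_neutral_right, auto)
  then show ?thesis unfolding fps_value_def by (simp add: sums_iff)
qed

lemma fps_value_0 [simp]: "fps_value 0 x = 0"
  using fps_value_const[of 0] by simp

lemma fps_value_le:
  assumes "gb C f" "absv x \<le> real q"
  shows "absv (fps_value f x) \<le> C"
proof (rule ct_sums_le)
  show "(\<lambda>n. fps_nth f n * x ^ n) sums fps_value f x"
    using assms by (intro fps_value_sums) (auto simp: bdd_def)
  fix n
  have "absv (fps_nth f n * x ^ n) \<le> absv (fps_nth f n) * R ^ n"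
    unfolding absv_mult absv_power using assms(2) R_gt by (intro mult_left_mono power_mono) auto
  then show "absv (fps_nth f n * x ^ n) \<le> C" using assms(1) order_trans unfolding gb_def by blast
qed

section \<open>Divided differences and multiplicativity of evaluation\<close>

definition lin :: "'c \<Rightarrow> 'c fps" where "lin x = fps_X - fps_const x"

lemma lin_nonzero [simp]: "lin x \<noteq> 0"
proof
  assume "lin x = 0"
  then have "fps_nth (lin x) 1 = 0" by simp
  then show False by (simp add: lin_def)
qed

lemma bdd_lin [simp]: "bdd (lin x)" by (simp add: lin_def bdd_diff)

lemma fps_value_lin_mult:
  assumes "bdd f" "absv x \<le> real q" "absv y \<le> real q"
  shows "fps_value (lin y * f) x = (x - y) * fps_value f x"
proof -
  have "lin y * f = fps_X * f + fps_const (- y) * f" by (simp add: lin_def algebra_simps fps_const_neg[symmetric] del: fps_const_neg)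
  then have "fps_value (lin y * f) x = x * fps_value f x + - y * fps_value f x"
    using assms by (simp only: fps_value_add fps_value_X_mult fps_value_cmult bdd_mult bdd_X bdd_const)
  then show ?thesis by (simp add: left_diff_distrib)
qed

text \<open>The divided difference \<open>(f - f(x)) / (t - x)\<close>.\<close>
definition dq :: "'c \<Rightarrow> 'c fps \<Rightarrow> 'c fps" where
  "dq x f = Abs_fps (\<lambda>n. fps_value (fps_shift (Suc n) f) x)"

lemma gb_shift: "gb C f \<Longrightarrow> gb (C / R ^ n) (fps_shift n f)"
  using gb_nth[of C f "m + n" for m] by (simp add: gb_def field_simps power_add)

lemma bdd_shift: "bdd f \<Longrightarrow> bdd (fps_shift n f)" unfolding bdd_def using gb_shift by blast

text \<open>Each divided difference gains a factor \<open>1 / R\<close>; iterated, this gain makes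
  the Taylor remainders tend to zero.\<close>

lemma gb_dq:
  assumes "gb C f" "absv x \<le> real q"
  shows "gb (C / R) (dq x f)"
  unfolding gb_def
proof
  fix n
  have "absv (fps_nth (dq x f) n) \<le> C / R ^ Suc n"
    using fps_value_le[OF gb_shift[OF assms(1), of "Suc n"] assms(2)] by (simp add: dq_def)
  then show "absv (fps_nth (dq x f) n) * R ^ n \<le> C / R" by (simp add: field_simps)
qed

lemma bdd_dq: "bdd f \<Longrightarrow> absv x \<le> real q \<Longrightarrow> bdd (dq x f)"
  unfolding bdd_def using gb_dq by blast

lemma dq_decomp:
  assumes "bdd f" "absv x \<le> real q"
  shows "f = fps_const (fps_value f x) + lin x * dq x f"
proof -
  \<comment> \<open>Horner's rule: the tail from \<open>n\<close> on evaluates to its first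
    coefficient plus \<open>x\<close> times the value of the tail from \<open>n + 1\<close>
    on.\<close>
  have s: "fps_value (fps_shift n f) x = fps_nth f n + x * fps_nth (dq x f) n" for n
  proof -
    have "fps_shift n f = fps_const (fps_nth f n) + fps_X * fps_shift (Suc n) f"
      by (rule fps_ext) (auto simp: fps_X_mult_nth)
    then show ?thesis
      using assms by (simp add: fps_value_add fps_value_X_mult bdd_mult bdd_shift dq_def)
  qed
  show ?thesis
  proof (rule fps_ext)
    fix n
    show "fps_nth f n = fps_nth (fps_const (fps_value f x) + lin x * dq x f) n"
    proof (cases n)
      case 0
      then show ?thesis using s[of 0] by (simp add: lin_def algebra_simps)
    next
      case (Suc m)
      have "fps_nth (dq x f) m = fps_value (fps_shift n f) x" by (simp add: dq_def Suc)
      then show ?thesis using s[of n] Suc by (simp add: lin_def algebra_simps)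
    qed
  qed
qed

text \<open>Writing both factors as value plus multiple of \<open>t - x\<close>, the product becomes
  a constant plus a multiple of \<open>t - x\<close>, and the latter vanishes at \<open>x\<close>.
  No Cauchy product of convergent series is needed.\<close>

lemma fps_value_mult:
  assumes "bdd f" "bdd g" "absv x \<le> real q"
  shows "fps_value (f * g) x = fps_value f x * fps_value g x"
proof -
  let ?a = "fps_value f x" and ?b = "fps_value g x"
  let ?h = "fps_const ?a * dq x g + fps_const ?b * dq x f + lin x * (dq x f * dq x g)"
  have "f * g = (fps_const ?a + lin x * dq x f) * (fps_const ?b + lin x * dq x g)"
    using dq_decomp[OF assms(1,3)] dq_decomp[OF assms(2,3)] by simp
  also have "\<dots> = fps_const (?a * ?b) + lin x * ?h"
    by (simp add: algebra_simps flip: fps_const_mult)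
  finally have "f * g = fps_const (?a * ?b) + lin x * ?h" .
  moreover have "bdd ?h" using assms by (intro bdd_add bdd_mult bdd_dq) auto
  ultimately show ?thesis
    using assms(3) by (simp add: fps_value_add bdd_mult fps_value_lin_mult del: fps_const_mult)
qed

lemma fps_value_power:
  assumes "bdd f" "absv x \<le> real q"
  shows "fps_value (f ^ n) x = fps_value f x ^ n"
  using fps_value_const[of 1 x] by (induction n) (simp_all add: assms fps_value_mult bdd_power)

lemma dq_lin_mult:
  assumes "bdd f" "absv x \<le> real q"
  shows "dq x (lin x * f) = f"
proof -
  have "lin x * f = lin x * dq x (lin x * f)"
    using dq_decomp[OF bdd_mult[OF bdd_lin assms(1)] assms(2), of x] assms
    by (simp add: fps_value_lin_mult)
  then show ?thesis by simp
qed

lemma dq_add: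
  assumes "bdd f" "bdd g" "absv x \<le> real q"
  shows "dq x (f + g) = dq x f + dq x g"
  by (rule fps_ext) (simp add: dq_def fps_shift_add fps_value_add assms bdd_shift)

lemma dq_cmult:
  assumes "bdd f" "absv x \<le> real q"
  shows "dq x (fps_const c * f) = fps_const c * dq x f"
proof (rule fps_ext)
  fix n
  have "fps_shift (Suc n) (fps_const c * f) = fps_const c * fps_shift (Suc n) f"
    by (rule fps_ext) simp
  then show "fps_nth (dq x (fps_const c * f)) n = fps_nth (fps_const c * dq x f) n"
    by (simp add: dq_def fps_value_cmult assms bdd_shift)
qed

lemma dq_const [simp]: "dq x (fps_const c) = 0"
proof (rule fps_ext)
  fix n
  have "fps_shift (Suc n) (fps_const c) = 0" by (rule fps_ext) simp
  then show "fps_nth (dq x (fps_const c)) n = fps_nth 0 n" by (simp add: dq_def)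
qed

lemma dq_0 [simp]: "dq x 0 = 0"
  using dq_const[of x 0] by (simp del: dq_const)

lemma absv_theta_le [simp]: "absv \<theta> \<le> real q" by (simp add: absv_theta)

text \<open>The \<open>e\<close>-th Taylor coefficient at \<open>\<theta>\<close>. Iterating divided differences avoids interchanging
  double series.\<close>
definition D :: "nat \<Rightarrow> 'c fps \<Rightarrow> 'c" where "D e f = fps_value ((dq \<theta> ^^ e) f) \<theta>"

lemma bdd_dq_pow: "bdd f \<Longrightarrow> bdd ((dq \<theta> ^^ e) f)"
  by (induction e) (auto intro: bdd_dq)

lemma dq_pow_add: "bdd f \<Longrightarrow> bdd g \<Longrightarrow> (dq \<theta> ^^ e) (f + g) = (dq \<theta> ^^ e) f + (dq \<theta> ^^ e) g"
  by (induction e) (auto simp: dq_add bdd_dq_pow)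

lemma dq_pow_cmult: "bdd f \<Longrightarrow> (dq \<theta> ^^ e) (fps_const c * f) = fps_const c * (dq \<theta> ^^ e) f"
  by (induction e) (auto simp: dq_cmult bdd_dq_pow)

lemma gb_dq_pow: "gb C f \<Longrightarrow> gb (C / R ^ e) ((dq \<theta> ^^ e) f)"
proof (induction e)
  case (Suc e)
  then show ?case using gb_dq[of "C / R ^ e" "(dq \<theta> ^^ e) f" \<theta>] by (simp add: field_simps)
qed simp

lemma D_add: "bdd f \<Longrightarrow> bdd g \<Longrightarrow> D e (f + g) = D e f + D e g"
  by (simp add: D_def dq_pow_add fps_value_add bdd_dq_pow)
lemma D_cmult: "bdd f \<Longrightarrow> D e (fps_const c * f) = c * D e f"
  by (simp add: D_def dq_pow_cmult fps_value_cmult bdd_dq_pow)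
lemma D_0 [simp]: "D e 0 = 0" using D_cmult[of 0 e 0] by simp
lemma D_uminus: "bdd f \<Longrightarrow> D e (- f) = - D e f"
  using D_cmult[of f e "-1"] by (simp add: fps_const_neg[symmetric] del: fps_const_neg)
lemma D_diff: "bdd f \<Longrightarrow> bdd g \<Longrightarrow> D e (f - g) = D e f - D e g"
  using D_add[of f "- g" e] by (simp add: D_uminus bdd_uminus)
lemma D_sum: "(\<And>a. a \<in> A \<Longrightarrow> bdd (f a)) \<Longrightarrow> D e (sum f A) = (\<Sum>a\<in>A. D e (f a))"
  by (induction A rule: infinite_finite_induct) (auto simp: D_add bdd_sum)

text \<open>Continuity of the Taylor coefficients for the Gauss norm: this is what lets them pass
  through infinite sums of power series.\<close>

lemma D_le: assumes "gb C f" shows "absv (D e f) \<le> C"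
proof -
  have "absv (D e f) \<le> C / R ^ e"
    unfolding D_def by (rule fps_value_le[OF gb_dq_pow[OF assms]]) simp
  also have "\<dots> \<le> C" using gb_nonneg[OF assms] R_gt_1 by (simp add: divide_le_eq mult_le_cancel_left1 one_le_power)
  finally show ?thesis .
qed

lemma D_lin_mult: "bdd f \<Longrightarrow> D e (lin \<theta> * f) = (if e = 0 then 0 else D (e - 1) f)"
  by (cases e) (simp_all add: D_def fps_value_lin_mult funpow_Suc_right dq_lin_mult del: funpow.simps)

lemma D_lin_pow_mult: "bdd f \<Longrightarrow> D e (lin \<theta> ^ d * f) = (if e < d then 0 else D (e - d) f)"
proof (induction d arbitrary: e)
  case (Suc d)
  then show ?case
    using D_lin_mult[of "lin \<theta> ^ d * f" e] by (auto simp: bdd_mult bdd_power mult.assoc)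
qed simp

lemma D_one: "D e 1 = (if e = 0 then 1 else 0)"
proof (cases e)
  case 0 then show ?thesis using fps_value_const[of 1 \<theta>] by (simp add: D_def)
next
  case (Suc d)
  have "(dq \<theta> ^^ d) 0 = 0" by (induction d) auto
  then show ?thesis using Suc dq_const[of \<theta> 1]
    by (simp add: D_def funpow_Suc_right del: funpow.simps dq_const)
qed

lemma D_lin_pow: "D e (lin \<theta> ^ d) = (if e = d then 1 else 0)"
  using D_lin_pow_mult[of 1 e d] by (auto simp: D_one)

lemma D_expand:
  assumes "bdd f"
  shows "f = (\<Sum>e<d. fps_const (D e f) * lin \<theta> ^ e) + lin \<theta> ^ d * (dq \<theta> ^^ d) f"
proof (induction d)
  case (Suc d)
  have gen: "u ^ d * (c + u * h) = c * u ^ d + u ^ Suc d * h" for u c h :: "'c fps"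
    by (simp add: algebra_simps)
  have "(dq \<theta> ^^ d) f = fps_const (D d f) + lin \<theta> * (dq \<theta> ^^ Suc d) f"
    using dq_decomp[OF bdd_dq_pow[OF assms, of d], of \<theta>] by (simp add: D_def)
  then have "lin \<theta> ^ d * (dq \<theta> ^^ d) f
      = fps_const (D d f) * lin \<theta> ^ d + lin \<theta> ^ Suc d * (dq \<theta> ^^ Suc d) f"
    unfolding gen[symmetric] by (rule arg_cong)
  then show ?case using Suc by (simp add: add.assoc)
qed simp

text \<open>After \<open>N\<close> terms the remainder is exactly \<open>(x - \<theta>) ^ N\<close>
  times the N-th divided difference at \<open>x\<close>. The first factor is at most 1, the second
  at most \<open>C / R ^ N\<close>.\<close>

lemma D_taylor_sums:
  assumes "bdd f" "absv (x - \<theta>) \<le> 1"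
  shows "(\<lambda>i. D i f * (x - \<theta>) ^ i) sums fps_value f x"
proof -
  have x: "absv x \<le> real q"
    using absv_add_le[of "x - \<theta>" "real q" \<theta>] assms(2) q_ge_2 by simp
  obtain C where C: "gb C f" using assms(1) by (auto simp: bdd_def)
  have lp: "fps_value (lin \<theta> ^ n * g) x = (x - \<theta>) ^ n * fps_value g x" if "bdd g" for n g
    using that x by (induction n) (simp_all add: mult.assoc fps_value_lin_mult bdd_mult bdd_power)
  have "fps_value f x - (\<Sum>i<N. D i f * (x - \<theta>) ^ i)
      = (x - \<theta>) ^ N * fps_value ((dq \<theta> ^^ N) f) x" for N
  proof -
    have s: "fps_value (\<Sum>i<N. fps_const (D i f) * lin \<theta> ^ i) x = (\<Sum>i<N. D i f * (x - \<theta>) ^ i)"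
    proof (induction N)
      case (Suc N)
      then show ?case
        using x lp[of 1 N] fps_value_const[of 1 x]
        by (simp add: fps_value_add bdd_sum bdd_mult bdd_power fps_value_cmult)
    qed simp
    show ?thesis
      by (subst D_expand[OF assms(1), of N])
        (simp add: fps_value_add x bdd_sum bdd_mult bdd_power bdd_dq_pow assms(1) s lp)
  qed
  moreover have "absv ((x - \<theta>) ^ N * fps_value ((dq \<theta> ^^ N) f) x) \<le> C * (1 / R) ^ N" for N
  proof -
    have "absv ((x - \<theta>) ^ N * fps_value ((dq \<theta> ^^ N) f) x) \<le> 1 * (C / R ^ N)"
      unfolding absv_mult absv_power
      using assms(2) fps_value_le[OF gb_dq_pow[OF C, of N] x] by (intro mult_mono) (auto intro: power_le_one)
    then show ?thesis by (simp add: power_divide)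
  qed
  ultimately have le: "absv ((\<Sum>i<N. D i f * (x - \<theta>) ^ i) - fps_value f x) \<le> C * (1 / R) ^ N" for N
    by (subst absv_minus_commute) simp
  have "(\<lambda>N. C * (1 / R) ^ N) \<longlonglongrightarrow> C * 0"
    using R_gt_1 by (intro tendsto_mult tendsto_const LIMSEQ_power_zero) simp
  then have "(\<lambda>N. C * (1 / R) ^ N) \<longlonglongrightarrow> 0" by simp
  then show ?thesis
    unfolding sums_def tendsto_absv_iff by (rule tendsto_zero_squeeze) (simp_all add: le)
qed

text \<open>If \<open>c k\<close> is the first nonzero coefficient, then at a small nonzero
  \<open>y\<close> the term \<open>c k * y ^ k\<close> dominates the tail, which is of order
  \<open>y ^ (k + 1)\<close>. Powers of \<open>inverse \<theta>\<close> supply such points.\<close>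

lemma power_series_zero_unique:
  assumes e: "e > 0" and z: "\<And>y. absv y < e \<Longrightarrow> (\<lambda>i. c i * y ^ i) sums (0::'c)"
  shows "c k = 0"
proof (induction k rule: less_induct)
  case (less k)
  show ?case
  proof (rule ccontr)
    assume nz: "c k \<noteq> 0"
    define p where "p = (\<lambda>n. inverse \<theta> ^ n)"
    have ap: "absv (p n) = (1 / real q) ^ n" for n
      unfolding p_def absv_power absv_inverse absv_theta by (simp add: inverse_eq_divide)
    have lim: "(\<lambda>n. absv (p n)) \<longlonglongrightarrow> 0"
      unfolding ap using q_ge_2 by (intro LIMSEQ_power_zero) simp
    have pn0: "absv (p n) > 0" for n unfolding ap by (simp)
    obtain n0 where n0: "absv (p n0) < e"
      using LIMSEQ_D[OF lim e] by (auto simp: )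
    define y0 where "y0 = p n0"
    have y0: "absv y0 > 0" using pn0 by (simp add: y0_def)
    have "(\<lambda>i. sum (\<lambda>i. c i * y0 ^ i) {..<Suc i} - sum (\<lambda>i. c i * y0 ^ i) {..<i}) \<longlonglongrightarrow> 0 - 0"
      using z[OF n0[folded y0_def]] unfolding sums_def
      by (intro ct_tendsto_diff) (auto intro: LIMSEQ_Suc simp del: sum.lessThan_Suc)
    then have "(\<lambda>i. c i * y0 ^ i) \<longlonglongrightarrow> 0" by simp
    then have "(\<lambda>i. absv (c i * y0 ^ i)) \<longlonglongrightarrow> 0" by (simp add: tendsto_absv_iff)
    then have "Bseq (\<lambda>i. absv (c i * y0 ^ i))" by (intro convergent_imp_Bseq convergentI)
    then obtain M where M: "M > 0" "\<And>i. absv (c i * y0 ^ i) \<le> M"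
      by (auto simp: Bseq_def)
    have ci: "absv (c i) \<le> M / absv y0 ^ i" for i
      using M(2)[of i] y0 by (simp add: absv_mult absv_power field_simps)
    \<comment> \<open>Exactly the size of \<open>y\<close> below which the bound
      \<open>M * (absv y / absv y0) ^ Suc k\<close> for the tail falls short of the term of index
      \<open>k\<close>.\<close>
    define B where "B = absv (c k) * absv y0 ^ Suc k / M"
    have "B > 0" unfolding B_def
      using M(1) y0 absv_pos[OF nz] by (intro divide_pos_pos mult_pos_pos zero_less_power)
    then obtain n1 where n1: "\<And>n. n \<ge> n1 \<Longrightarrow> absv (p n) < min B (min e (absv y0))"
      using LIMSEQ_D[OF lim, of "min B (min e (absv y0))"] e y0 by auto
    define y where "y = p n1"
    have y: "absv y < B" "absv y < e" "absv y < absv y0" "absv y > 0"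
      using n1[of n1] pn0 by (auto simp: y_def)
    have "absv (0 - sum (\<lambda>i. c i * y ^ i) {..<Suc k}) \<le> M * (absv y / absv y0) ^ Suc k"
    proof (rule ct_sums_tail_le[OF z[OF y(2)]])
      fix i assume i: "Suc k \<le> i"
      have "absv (c i * y ^ i) \<le> (M / absv y0 ^ i) * absv y ^ i"
        unfolding absv_mult absv_power by (intro mult_right_mono ci) auto
      also have "\<dots> = M * (absv y / absv y0) ^ i" by (simp add: power_divide)
      also have "\<dots> \<le> M * (absv y / absv y0) ^ Suc k"
        using M(1) y i by (intro mult_left_mono power_decreasing) auto
      finally show "absv (c i * y ^ i) \<le> M * (absv y / absv y0) ^ Suc k" .
    qed (use M in auto)
    moreover have "sum (\<lambda>i. c i * y ^ i) {..<Suc k} = c k * y ^ k"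
      using less by simp
    ultimately have "absv (c k) * absv y ^ k \<le> M * (absv y / absv y0) ^ Suc k"
      by (simp add: absv_mult absv_power)
    then have "absv (c k) * absv y ^ k * absv y0 ^ Suc k \<le> M * absv y * absv y ^ k"
      using y0 by (simp add: power_divide field_simps)
    then have "absv (c k) * absv y0 ^ Suc k \<le> M * absv y"
      using y(4) by (simp add: mult.commute mult.left_commute)
    then have "B \<le> absv y" using M(1) by (simp add: B_def field_simps)
    with y(1) show False by simp
  qed
qed

text \<open>Resolves the description in \<open>taylor_coeff\<close>: existence is the Taylor series,
  uniqueness the identity theorem applied to the difference of two expansions.\<close>

lemma taylor_coeff_eq_D:
  assumes "bdd f" "\<And>x. absv (x - \<theta>) \<le> 1 \<Longrightarrow> g x = fps_value f x"
  shows "taylor_coeff \<theta> g = (\<lambda>e. D e f)"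
  unfolding taylor_coeff_def
proof (rule the_equality)
  show "\<exists>e>0. \<forall>x. dist x \<theta> < e \<longrightarrow> (\<lambda>i. D i f * (x - \<theta>) ^ i) sums g x"
    using D_taylor_sums[OF assms(1)] assms(2) by (intro exI[of _ 1]) (auto simp: dist_absv)
next
  fix c assume "\<exists>e>0. \<forall>x. dist x \<theta> < e \<longrightarrow> (\<lambda>i. c i * (x - \<theta>) ^ i) sums g x"
  then obtain e where e: "e > 0" "\<And>x. dist x \<theta> < e \<Longrightarrow> (\<lambda>i. c i * (x - \<theta>) ^ i) sums g x" by blast
  have "c k - D k f = 0" for k
  proof (rule power_series_zero_unique)
    show "min e 1 > 0" using e by simp
    fix y :: 'c assume y: "absv y < min e 1"
    have 1: "(\<lambda>i. c i * y ^ i) sums g (\<theta> + y)" using e(2)[of "\<theta> + y"] y by (simp add: dist_absv)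
    have 2: "(\<lambda>i. D i f * y ^ i) sums g (\<theta> + y)"
      using D_taylor_sums[OF assms(1), of "\<theta> + y"] assms(2)[of "\<theta> + y"] y by simp
    show "(\<lambda>i. (c i - D i f) * y ^ i) sums 0"
      using ct_sums_diff[OF 1 2] by (simp add: left_diff_distrib)
  qed
  then show "c = (\<lambda>e. D e f)" by auto
qed

section \<open>Twisting power series\<close>

definition tw :: "nat \<Rightarrow> 'c fps \<Rightarrow> 'c fps" where "tw i f = Abs_fps (\<lambda>n. fr i (fps_nth f n))"

lemma tw_nth [simp]: "fps_nth (tw i f) n = fr i (fps_nth f n)" by (simp add: tw_def)
lemma twist_fps_of_nat: "twist_fps (int i) f = tw i f" by (simp add: twist_fps_def tw_def frob_of_nat)
lemma tw_0_left [simp]: "tw 0 f = f" by (simp add: fps_ext)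
lemma tw_tw: "tw i (tw j f) = tw (i + j) f" by (simp add: fps_ext fr_fr)
lemma tw_add: "tw i (f + g) = tw i f + tw i g" by (simp add: fps_ext fr_add)
lemma tw_diff: "tw i (f - g) = tw i f - tw i g" by (simp add: fps_ext fr_diff)
lemma tw_uminus: "tw i (- f) = - tw i f" by (simp add: fps_ext fr_uminus)
lemma tw_mult: "tw i (f * g) = tw i f * tw i g"
  by (simp add: fps_ext fps_mult_nth fr_sum fr_mult)
lemma tw_const: "tw i (fps_const c) = fps_const (fr i c)" by (rule fps_ext) simp
lemma tw_zero [simp]: "tw i 0 = 0" by (rule fps_ext) simp
lemma tw_one [simp]: "tw i 1 = 1" using tw_const[of i 1] by simp
lemma tw_X [simp]: "tw i fps_X = fps_X" by (rule fps_ext) simp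
lemma tw_power: "tw i (f ^ n) = tw i f ^ n" by (induction n) (simp_all add: tw_mult)
lemma tw_prod: "tw i (prod f A) = (\<Prod>a\<in>A. tw i (f a))"
  by (induction A rule: infinite_finite_induct) (simp_all add: tw_mult)
lemma tw_sum: "tw i (sum f A) = (\<Sum>a\<in>A. tw i (f a))"
  by (induction A rule: infinite_finite_induct) (simp_all add: tw_add)
lemma tw_poly_t: "tw i (fps_of_poly (poly_t a)) = fps_of_poly (poly_t a)"
  by (rule fps_ext) (simp add: poly_t_coeff fr_const)
lemma tw_lin: "tw i (lin x) = lin (fr i x)" by (simp add: lin_def tw_diff tw_const)
lemma fps_of_poly_t_theta: "fps_of_poly [:- \<theta>, 1:] = lin \<theta>"
  by (simp add: lin_def fps_of_poly_pCons)

lemma gb_tw: assumes "gb C f" shows "gb (C ^ (q ^ i)) (tw i f)"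
  unfolding gb_def
proof
  fix n
  have "R ^ n \<le> (R ^ n) ^ (q ^ i)"
    using R_gt_1 by (intro self_le_power one_le_power) auto
  then have "absv (fps_nth (tw i f) n) * R ^ n \<le> absv (fps_nth f n) ^ (q ^ i) * (R ^ n) ^ (q ^ i)"
    by (simp add: absv_fr mult_left_mono)
  also have "\<dots> = (absv (fps_nth f n) * R ^ n) ^ (q ^ i)" by (simp add: power_mult_distrib)
  also have "\<dots> \<le> C ^ (q ^ i)" using assms by (intro power_mono) (auto simp: gb_def)
  finally show "absv (fps_nth (tw i f) n) * R ^ n \<le> C ^ (q ^ i)" .
qed

lemma bdd_tw: "bdd f \<Longrightarrow> bdd (tw i f)" unfolding bdd_def using gb_tw by blast

text \<open>Sharper than \<open>gb_tw\<close> applied to \<open>gb_of_poly\<close>: twisting raises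
  coefficients to powers but leaves \<open>t\<close> alone, so the contribution
  \<open>R ^ degree p\<close> of the degree does not depend on \<open>i\<close>. Decay in
  \<open>i\<close> is read off from the Gauss norm of \<open>p\<close> alone.\<close>

lemma gb_tw_poly: "gb (gauss_norm p ^ (q ^ i) * R ^ degree p) (tw i (fps_of_poly p))"
  unfolding gb_def
proof
  fix n
  show "absv (fps_nth (tw i (fps_of_poly p)) n) * R ^ n \<le> gauss_norm p ^ (q ^ i) * R ^ degree p"
  proof (cases "n \<le> degree p")
    case True
    have "absv (coeff p n) ^ (q ^ i) * R ^ n \<le> gauss_norm p ^ (q ^ i) * R ^ degree p"
      using R_gt_1 True
      by (intro mult_mono power_increasing power_mono gauss_norm_ge gauss_norm_nonneg zero_le_power) auto
    then show ?thesis by (simp add: absv_fr)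
  next
    case False
    then show ?thesis using gauss_norm_nonneg by (simp add: coeff_eq_0)
  qed
qed

section \<open>The function \<open>\<Omega>\<close>\<close>

definition ompart :: "nat \<Rightarrow> 'c fps" where
  "ompart N = (\<Prod>i=1..N. 1 - fps_const (inverse (\<theta> ^ (q ^ i))) * fps_X)"

definition W :: "'c fps" where "W = Abs_fps (\<lambda>n. lim (\<lambda>N. fps_nth (ompart N) n))"

lemma Omega_eq: "Omega \<eta> = fps_const (inverse (\<eta> ^ q)) * W"
  by (simp add: Omega_def W_def ompart_def)

lemma absv_theta_power_ge: assumes "i \<ge> 1" shows "R \<le> absv (\<theta> ^ (q ^ i))"
proof -
  have "real q ^ q \<le> real q ^ (q ^ i)"
    using q_ge_2 assms by (intro power_increasing self_le_power) auto
  then show ?thesis by (simp add: R_def absv_power absv_theta)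
qed

text \<open>The zero \<open>\<theta> ^ (q ^ i)\<close> has absolute value at least \<open>R\<close>,
  so on this disc the linear factor is no larger than its constant term 1.\<close>

lemma gb_factor:
  assumes "i \<ge> 1" shows "gb 1 (1 - fps_const (inverse (\<theta> ^ (q ^ i))) * fps_X)"
proof -
  have "gb (absv (inverse (\<theta> ^ (q ^ i))) * R) (fps_const (inverse (\<theta> ^ (q ^ i))) * fps_X)"
    by (intro gb_mult gb_const gb_X)
  moreover have "absv (inverse (\<theta> ^ (q ^ i))) * R \<le> 1"
    unfolding absv_inverse using absv_theta_power_ge[OF assms] absv_pos[of "\<theta> ^ (q ^ i)"]
    by (simp add: inverse_eq_divide divide_le_eq)
  ultimately show ?thesis by (intro gb_diff gb_one) (rule gb_mono)
qed

lemma gb_ompart: "gb 1 (ompart N)"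
  using gb_prod[of "{1..N}" "\<lambda>_. 1"] gb_factor unfolding ompart_def by simp

lemma ompart_Suc: "ompart (Suc N) = ompart N * (1 - fps_const (inverse (\<theta> ^ (q ^ Suc N))) * fps_X)"
  by (simp add: ompart_def)

text \<open>Consecutive partial products differ by a multiple of
  \<open>inverse (\<theta> ^ (q ^ Suc N))\<close>, which tends to zero; ultrametric summability of
  the differences does the rest.\<close>

lemma ompart_tendsto: "(\<lambda>N. fps_nth (ompart N) n) \<longlonglongrightarrow> fps_nth W n"
proof -
  let ?d = "\<lambda>N. fps_nth (ompart (Suc N)) n - fps_nth (ompart N) n"
  have le: "absv (?d N) \<le> R * (1 / real q) ^ N" for N
  proof -
    have "ompart (Suc N) - ompart N = - (ompart N * (fps_const (inverse (\<theta> ^ (q ^ Suc N))) * fps_X))"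
      by (simp add: ompart_Suc algebra_simps)
    moreover have "gb (1 * (absv (inverse (\<theta> ^ (q ^ Suc N))) * R))
        (ompart N * (fps_const (inverse (\<theta> ^ (q ^ Suc N))) * fps_X))"
      by (intro gb_mult gb_const gb_X gb_ompart)
    ultimately have "gb (absv (inverse (\<theta> ^ (q ^ Suc N))) * R) (ompart (Suc N) - ompart N)"
      using gb_uminus by simp
    from gb_nth[OF this, of n]
    have "absv (?d N) \<le> absv (inverse (\<theta> ^ (q ^ Suc N))) * R / R ^ n" by simp
    also have "\<dots> \<le> absv (inverse (\<theta> ^ (q ^ Suc N))) * R"
    proof -
      have "x / R ^ n \<le> x" if "0 \<le> x" for x
        using mult_left_mono[of 1 "R ^ n" x] that R_gt_1 by (simp add: divide_le_eq one_le_power)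
      then show ?thesis by (meson R_pos(2) absv_nonneg mult_nonneg_nonneg)
    qed
    also have "absv (inverse (\<theta> ^ (q ^ Suc N))) \<le> (1 / real q) ^ N"
    proof -
      have "N < 2 ^ N" by simp
      also have "(2::nat) ^ N \<le> q ^ N" using q_ge_2 by (intro power_mono) auto
      also have "\<dots> \<le> q ^ Suc N" using q_ge_2 by (intro power_increasing) auto
      finally have "real q ^ N \<le> real q ^ (q ^ Suc N)" using q_ge_2 by (intro power_increasing) auto
      then have "1 / real q ^ (q ^ Suc N) \<le> 1 / real q ^ N"
        using q_ge_2 by (intro divide_left_mono) auto
      then show ?thesis
        unfolding absv_inverse absv_power absv_theta power_one_over by (simp only: inverse_eq_divide)
    qed
    finally show ?thesis by (simp add: mult.commute)
  qed
  have "(\<lambda>N. R * (1 / real q) ^ N) \<longlonglongrightarrow> R * 0"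
    using q_ge_2 by (intro tendsto_mult tendsto_const LIMSEQ_power_zero) simp
  then have "(\<lambda>N. R * (1 / real q) ^ N) \<longlonglongrightarrow> 0" by simp
  then have "(\<lambda>N. absv (?d N)) \<longlonglongrightarrow> 0" by (rule tendsto_zero_squeeze) (simp_all add: le)
  then have "summable ?d" by (rule ct_summable)
  then obtain L where "(\<lambda>N. sum ?d {..<N}) \<longlonglongrightarrow> L"
    by (auto simp: summable_def sums_def)
  moreover have "sum ?d {..<N} = fps_nth (ompart N) n - fps_nth (ompart 0) n" for N
    by (rule sum_lessThan_telescope)
  ultimately have "(\<lambda>N. fps_nth (ompart N) n - fps_nth (ompart 0) n) \<longlonglongrightarrow> L" by simp
  from ct_tendsto_add[OF this tendsto_const[of "fps_nth (ompart 0) n"]]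
  have *: "(\<lambda>N. fps_nth (ompart N) n) \<longlonglongrightarrow> L + fps_nth (ompart 0) n" by simp
  then show ?thesis using limI[OF *] by (simp add: W_def)
qed

lemma gb_W: "gb 1 W"
  unfolding gb_def
proof
  fix n
  have "absv (fps_nth W n) \<le> 1 / R ^ n"
    by (rule ct_limit_le[OF ompart_tendsto]) (auto intro: gb_nth gb_ompart always_eventually)
  then show "absv (fps_nth W n) * R ^ n \<le> 1" by (simp add: field_simps)
qed

lemma W_nth_0: "fps_nth W 0 = 1"
proof -
  have "fps_nth (ompart N) 0 = 1" for N by (induction N) (simp_all add: ompart_Suc, simp add: ompart_def)
  then show ?thesis using LIMSEQ_unique[OF ompart_tendsto[of 0]] tendsto_const by simp
qed

text \<open>Twisting once moves the i-th factor of the product to the (i+1)-st, so only the first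
  factor is missing. The identity holds for partial products and passes to the limit in each
  coefficient.\<close>

lemma W_functional: "W = (1 - fps_const (inverse (\<theta> ^ q)) * fps_X) * tw 1 W"
proof (rule fps_ext)
  fix n
  let ?c = "inverse (\<theta> ^ q)"
  let ?p = "\<lambda>f. fps_nth f n - ?c * (if n = 0 then 0 else fps_nth f (n - 1))"
  have p: "fps_nth ((1 - fps_const ?c * fps_X) * f) n = ?p f" for f
    by (simp add: left_diff_distrib mult.assoc)
  have tw1: "tw 1 (ompart N) = (\<Prod>i=2..Suc N. 1 - fps_const (inverse (\<theta> ^ (q ^ i))) * fps_X)" for N
  proof -
    have "tw 1 (ompart N) = (\<Prod>i=1..N. 1 - fps_const (inverse (\<theta> ^ (q ^ Suc i))) * fps_X)"
      unfolding ompart_def tw_prod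
      by (intro prod.cong refl) (simp add: tw_diff tw_mult tw_const fr_inverse fr_power,
          simp add: fr_def mult.commute flip: power_mult)
    also have "\<dots> = (\<Prod>i=2..Suc N. 1 - fps_const (inverse (\<theta> ^ (q ^ i))) * fps_X)"
      using prod.shift_bounds_cl_Suc_ivl[of "\<lambda>i. 1 - fps_const (inverse (\<theta> ^ (q ^ i))) * fps_X" 1 N]
      by (simp add: numeral_2_eq_2)
    finally show ?thesis .
  qed
  have om: "ompart (Suc N) = (1 - fps_const ?c * fps_X) * tw 1 (ompart N)" for N
    unfolding tw1 unfolding ompart_def
    by (subst prod.atLeast_Suc_atMost) (simp_all add: numeral_2_eq_2)
  have "(\<lambda>N. ?p (tw 1 (ompart N))) \<longlonglongrightarrow> ?p (tw 1 W)"
    by (cases n) (auto intro!: ct_tendsto_diff ct_tendsto_cmult ct_tendsto_fr ompart_tendsto)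
  then have "(\<lambda>N. fps_nth (ompart (Suc N)) n) \<longlonglongrightarrow> ?p (tw 1 W)"
    unfolding om p .
  moreover have "(\<lambda>N. fps_nth (ompart (Suc N)) n) \<longlonglongrightarrow> fps_nth W n"
    by (rule LIMSEQ_Suc[OF ompart_tendsto])
  ultimately show "fps_nth W n = fps_nth ((1 - fps_const ?c * fps_X) * tw 1 W) n"
    unfolding p by (rule LIMSEQ_unique[symmetric])
qed

text \<open>Each coefficient of the inverse is minus a sum of products of coefficients already
  bounded, and the weights multiply to \<open>R ^ n\<close>. Applied to \<open>W\<close>, it makes
  \<open>iOm\<close> bounded.\<close>

lemma gb_fps_inverse:
  assumes "gb 1 f" "fps_nth f 0 = 1"
  shows "gb 1 (inverse f)"
proof -
  have "absv (fps_nth (inverse f) n) \<le> 1 / R ^ n" for n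
  proof (induction n rule: less_induct)
    case (less n)
    show ?case
    proof (cases n)
      case 0
      then show ?thesis using assms(2) by simp
    next
      case (Suc m)
      have "fps_nth (f * inverse f) n = 0"
        using assms(2) Suc by (simp add: inverse_mult_eq_1')
      then have "fps_nth (inverse f) n + (\<Sum>i=1..n. fps_nth f i * fps_nth (inverse f) (n - i)) = 0"
        unfolding fps_mult_nth using assms(2) by (simp add: sum.atLeast_Suc_atMost)
      then have "fps_nth (inverse f) n = - (\<Sum>i=1..n. fps_nth f i * fps_nth (inverse f) (n - i))"
        by (simp add: eq_neg_iff_add_eq_0)
      then have "absv (fps_nth (inverse f) n) = absv (\<Sum>i=1..n. fps_nth f i * fps_nth (inverse f) (n - i))"
        by (simp only: absv_uminus)
      also have "\<dots> \<le> 1 / R ^ n"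
      proof (rule absv_sum_le)
        fix i assume i: "i \<in> {1..n}"
        have "absv (fps_nth f i * fps_nth (inverse f) (n - i)) \<le> (1 / R ^ i) * (1 / R ^ (n - i))"
          unfolding absv_mult using i by (intro mult_mono gb_nth[OF assms(1)] less) auto
        also have "\<dots> = 1 / R ^ n" using i by (simp flip: power_add)
        finally show "absv (fps_nth f i * fps_nth (inverse f) (n - i)) \<le> 1 / R ^ n" .
      qed simp
      finally show ?thesis .
    qed
  qed
  then show ?thesis by (simp add: gb_def field_simps)
qed

end

locale C_infinity_root = C_infinity q \<iota>
  for q and \<iota> :: "'f::{field,finite} fls \<Rightarrow> 'c::{field,complete_space}" +
  fixes \<eta> :: 'c
  assumes eta: "\<eta> ^ (q - 1) = - C_infinity.theta \<iota>"
begin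

abbreviation Om :: "'c fps" where "Om \<equiv> Omega \<eta>"

definition iOm :: "'c fps" where "iOm = inverse Om"

lemma eta_nonzero [simp]: "\<eta> \<noteq> 0"
  using eta q_ge_2 by (auto simp: power_0_left)

lemma absv_eta_pos: "absv \<eta> > 0"
  by (simp add: absv_pos)

text \<open>Origin of the exponent q/(q-1) in the norm hypotheses: \<open>absv \<eta> ^ q\<close> is
  the inverse of the absolute value of Omega at 0.\<close>

lemma absv_eta_power: "absv \<eta> ^ q = real q powr (real q / (real q - 1))"
proof -
  have "absv \<eta> ^ (q - 1) = real q"
    using arg_cong[OF eta, of absv] by (simp add: absv_power absv_theta)
  then have "absv \<eta> powr (real q - 1) = real q"
    using absv_eta_pos q_ge_2 by (simp add: powr_realpow[symmetric] of_nat_diff)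
  then have "real q powr (real q / (real q - 1)) = (absv \<eta> powr (real q - 1)) powr (real q / (real q - 1))"
    by simp
  also have "\<dots> = absv \<eta> powr real q" using q_ge_2 by (simp add: powr_powr)
  also have "\<dots> = absv \<eta> ^ q" using absv_eta_pos by (simp add: powr_realpow)
  finally show ?thesis by simp
qed

lemma Om_nth_0: "fps_nth Om 0 \<noteq> 0" by (simp add: Omega_eq W_nth_0)

lemma Om_iOm: "Om * iOm = 1" "iOm * Om = 1"
  unfolding iOm_def using inverse_mult_eq_1[OF Om_nth_0] inverse_mult_eq_1'[OF Om_nth_0] by auto

lemma bdd_Om [simp]: "bdd Om"
  unfolding Omega_eq using gb_W by (intro bdd_mult bdd_const) (auto simp: bdd_def)

lemma bdd_iOm [simp]: "bdd iOm"
proof -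
  have "iOm = fps_const (\<eta> ^ q) * inverse W"
    by (simp add: iOm_def Omega_eq fps_inverse_mult fps_const_inverse)
  then show ?thesis
    using gb_fps_inverse[OF gb_W W_nth_0] by (auto intro!: bdd_mult simp: bdd_def[of "inverse W"])
qed

text \<open>The root enters here: \<open>\<eta> ^ (q * q)\<close> equals
  \<open>- \<theta> ^ q * \<eta> ^ q\<close>, and this constant turns the factor
  \<open>1 - t / \<theta> ^ q\<close> of \<open>W_functional\<close> into
  \<open>t - \<theta> ^ q\<close>.\<close>

lemma Om_functional: "Om = lin (fr 1 \<theta>) * tw 1 Om"
proof -
  have "\<eta> ^ (q * q) = (\<eta> ^ (q - 1)) ^ q * \<eta> ^ q"
    using q_ge_2 by (simp add: algebra_simps flip: power_mult power_add)
  also have "(\<eta> ^ (q - 1)) ^ q = - (\<theta> ^ q)"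
    unfolding eta using fr_uminus[of 1 \<theta>] by (simp add: fr_def)
  finally have e: "inverse (\<eta> ^ q) = inverse (\<eta> ^ (q * q)) * - (\<theta> ^ q)" by (simp add: field_simps)
  have l: "fps_const (- (\<theta> ^ q)) * (1 - fps_const (inverse (\<theta> ^ q)) * fps_X) = lin (\<theta> ^ q)"
  proof -
    have "fps_const (- (\<theta> ^ q)) * (1 - fps_const (inverse (\<theta> ^ q)) * fps_X)
      = fps_const (- (\<theta> ^ q)) - fps_const (- (\<theta> ^ q) * inverse (\<theta> ^ q)) * fps_X"
      by (simp add: right_diff_distrib mult.assoc flip: fps_const_mult del: fps_const_neg)
    also have "- (\<theta> ^ q) * inverse (\<theta> ^ q) = - 1" by simp
    finally show ?thesis by (simp add: lin_def fps_const_neg[symmetric] del: fps_const_neg)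
  qed
  have "Om = fps_const (inverse (\<eta> ^ (q * q))) * (fps_const (- (\<theta> ^ q)) * (1 - fps_const (inverse (\<theta> ^ q)) * fps_X) * tw 1 W)"
    unfolding Omega_eq e by (subst W_functional) (simp add: mult.assoc flip: fps_const_mult del: fps_const_neg)
  also have "\<dots> = lin (\<theta> ^ q) * (fps_const (inverse (\<eta> ^ (q * q))) * tw 1 W)"
    unfolding l by (simp add: ac_simps)
  also have "fps_const (inverse (\<eta> ^ (q * q))) * tw 1 W = tw 1 Om"
    by (simp add: Omega_eq tw_mult tw_const fr_inverse fr_power) (simp add: fr_def flip: power_mult)
  finally show ?thesis unfolding fr_def[of 1 \<theta>] power_one_right .
qed

lemma gb_tw_Om: "gb (inverse (absv \<eta> ^ q) ^ (q ^ i)) (tw i Om)"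
proof -
  have "gb (absv (inverse (\<eta> ^ q))) Om"
    unfolding Omega_eq using gb_mult[OF gb_const gb_W] by simp
  from gb_tw[OF this] show ?thesis by (simp add: absv_inverse absv_power)
qed

end

locale AT_setup = Anderson_Thakur q \<iota> r s Q + C_infinity_root q \<iota> \<eta>
  for q and \<iota> :: "'f::{field,finite} fls \<Rightarrow> 'c::{field,complete_space}"
    and r :: nat and s :: "nat \<Rightarrow> nat" and Q :: "nat \<Rightarrow> 'c poly" and \<eta> :: 'c +
  assumes r_ge_1: "r \<ge> 1"
    and s_ge_1: "\<And>i. i \<in> {1..r} \<Longrightarrow> s i \<ge> 1"
    and Q_Kpoly: "\<And>i. i \<in> {1..r} \<Longrightarrow> Q i \<in> Kpoly"
begin

section \<open>Indexing of the basis\<close>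

text \<open>The common order of \<open>w\<close> and \<open>delta0\<close>, recorded once: position
  \<open>j\<close> belongs to \<open>(t - \<theta>) ^ e\<close> in coordinate \<open>l\<close>. With
  \<open>sum_ix\<close>, sums over \<open>j\<close> become double sums free of that order.\<close>

definition ix :: "(nat \<times> nat) list" where
  "ix = concat (map (\<lambda>l. map (\<lambda>e. (l, e)) (rev [0..<\<d> l])) [1..<Suc r])"

definition ixl :: "nat \<Rightarrow> nat" where "ixl j = fst (ix ! j)"
definition ixe :: "nat \<Rightarrow> nat" where "ixe j = snd (ix ! j)"

lemma length_ix: "length ix = dim_E"
proof -
  have "length ix = sum_list (map \<d> [1..<Suc r])"
    by (simp add: ix_def length_concat o_def)
  also have "\<dots> = sum \<d> {1..<Suc r}" by (simp only: sum_list_distinct_conv_sum_set distinct_upt set_upt)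
  finally show ?thesis by (simp only: dim_E_def atLeastLessThanSuc_atLeastAtMost)
qed

lemma set_ix: "set ix = Sigma {1..r} (\<lambda>l. {..<\<d> l})"
  by (auto simp: ix_def)

lemma distinct_ix: "distinct ix"
proof -
  have "card (set ix) = dim_E" unfolding set_ix dim_E_def by (subst card_SigmaI) auto
  then show ?thesis by (simp add: length_ix card_distinct)
qed

lemma ix_nth: assumes "j < dim_E" shows "ixl j \<in> {1..r}" "ixe j < \<d> (ixl j)"
  using nth_mem[of j ix] assms by (auto simp: length_ix set_ix ixl_def ixe_def)

lemma ix_inj: "i < dim_E \<Longrightarrow> j < dim_E \<Longrightarrow> ixl i = ixl j \<Longrightarrow> ixe i = ixe j \<Longrightarrow> i = j"
  using nth_eq_iff_index_eq[OF distinct_ix, of i j] by (simp add: length_ix ixl_def ixe_def prod_eq_iff)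

lemma sum_ix: "(\<Sum>j<dim_E. F (ixl j) (ixe j)) = (\<Sum>l=1..r. \<Sum>e<\<d> l. F l e)"
proof -
  have "bij_betw (\<lambda>j. ix ! j) {..<dim_E} (set ix)"
    using bij_betw_nth[OF distinct_ix] by (simp add: length_ix)
  then have "(\<Sum>j<dim_E. case_prod F (ix ! j)) = sum (case_prod F) (set ix)"
    by (rule sum.reindex_bij_betw)
  also have "\<dots> = (\<Sum>l=1..r. \<Sum>e<\<d> l. F l e)"
    unfolding set_ix by (subst sum.Sigma) auto
  finally show ?thesis by (simp add: ixl_def ixe_def case_prod_beta)
qed

lemma w_nth: assumes "j < dim_E" shows "w ! j = (\<lambda>k. if k = ixl j then t_theta ^ ixe j else 0)"
proof -
  have "w = map (\<lambda>(l, e) k. if k = l then t_theta ^ e else 0) ix"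
    unfolding w_def ix_def map_concat by (simp add: o_def)
  then show ?thesis unfolding ixl_def ixe_def using assms by (simp add: length_ix case_prod_beta)
qed

lemma d_rec: "l \<le> r \<Longrightarrow> \<d> l = s l + \<d> (Suc l)"
  by (simp add: tail_weight_def sum.atLeast_Suc_atMost)

lemma d_pos: "l \<in> {1..r} \<Longrightarrow> \<d> l \<ge> 1"
  using s_ge_1[of l] d_rec[of l] by simp

section \<open>The motive\<close>

lemma motive_iff: "m \<in> motive \<longleftrightarrow> (\<forall>l. m l \<in> Kpoly) \<and> (\<forall>l. l \<notin> {1..r} \<longrightarrow> m l = 0)"
  by (simp add: motive_def Kpoly_iff)

lemma motive_Kpoly: "m \<in> motive \<Longrightarrow> m l \<in> Kpoly" by (simp add: motive_iff)
lemma motive_outside: "m \<in> motive \<Longrightarrow> l \<notin> {1..r} \<Longrightarrow> m l = 0" by (simp add: motive_iff)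
lemma motive_0: "(\<lambda>_. 0) \<in> motive" by (simp add: motive_iff)
lemma motive_add: "m \<in> motive \<Longrightarrow> m' \<in> motive \<Longrightarrow> (\<lambda>k. m k + m' k) \<in> motive"
  by (simp add: motive_iff Kpoly_add)
lemma motive_mult: "p \<in> Kpoly \<Longrightarrow> m \<in> motive \<Longrightarrow> (\<lambda>k. p * m k) \<in> motive"
  by (simp add: motive_iff Kpoly_mult)
lemma motive_sum: "(\<And>a. a \<in> S \<Longrightarrow> m a \<in> motive) \<Longrightarrow> (\<lambda>k. \<Sum>a\<in>S. m a k) \<in> motive"
  by (auto simp: motive_iff intro!: Kpoly_sum sum.neutral)
lemma motive_w: "j < dim_E \<Longrightarrow> w ! j \<in> motive"
  using ix_nth[of j] by (auto simp: motive_iff w_nth Kpoly_power Kpoly_t_theta)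

lemma twist_m1_coeff: "coeff (twist_poly (-1) p) i = frob (-1) (coeff p i)"
  by (simp add: twist_poly_def coeff_map_poly)

lemma Kpoly_twist_m1: "p \<in> Kpoly \<Longrightarrow> twist_poly (-1) p \<in> Kpoly"
  by (simp add: Kpoly_def twist_m1_coeff frob_m1)

lemma tw_twist_m1: "p \<in> Kpoly \<Longrightarrow> tw 1 (fps_of_poly (twist_poly (-1) p)) = fps_of_poly p"
  by (rule fps_ext) (simp add: twist_m1_coeff frob_m1 Kpoly_def del: One_nat_def)

lemma twist_m1_0 [simp]: "twist_poly (-1) 0 = 0" by (simp add: twist_poly_def)

text \<open>Only coordinates \<open>k\<close> and \<open>k + 1\<close> of \<open>m\<close>
  contribute, and both bring the factor \<open>t_theta ^ \<d> k\<close>. This divisibility is what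
  makes Taylor coefficients of order below \<open>\<d> k\<close> vanish on the image of
  \<open>sigma\<close>.\<close>

lemma sigma_nth:
  assumes "m \<in> motive"
  shows "sigma m k = (if k \<in> {1..r} then t_theta ^ \<d> k *
    (twist_poly (-1) (m k) + twist_poly (-1) (m (Suc k)) * twist_poly (-1) (Q k)) else 0)"
proof -
  have sm: "sigma_m l k = (if l = k then t_theta ^ \<d> k else 0) +
      (if l = Suc k then (if 1 \<le> k then twist_poly (-1) (Q k) * t_theta ^ \<d> k else 0) else 0)"
    if "l \<in> {1..r}" for l
    using that by (auto simp: sigma_m_def)
  have "sigma m k = (\<Sum>l=1..r. twist_poly (-1) (m l) * ((if l = k then t_theta ^ \<d> k else 0) +
      (if l = Suc k then (if 1 \<le> k then twist_poly (-1) (Q k) * t_theta ^ \<d> k else 0) else 0)))"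
    unfolding sigma_def by (rule sum.cong[OF refl]) (simp only: sm)
  also have "\<dots> = (\<Sum>l=1..r. (if l = k then twist_poly (-1) (m k) * t_theta ^ \<d> k else 0)) +
     (\<Sum>l=1..r. if l = Suc k then (if 1 \<le> k then twist_poly (-1) (m (Suc k)) * (twist_poly (-1) (Q k) * t_theta ^ \<d> k) else 0) else 0)"
    unfolding sum.distrib[symmetric] by (rule sum.cong[OF refl]) (auto simp: distrib_left)
  also have "\<dots> = (if k \<in> {1..r} then t_theta ^ \<d> k *
    (twist_poly (-1) (m k) + twist_poly (-1) (m (Suc k)) * twist_poly (-1) (Q k)) else 0)"
    using motive_outside[OF assms, of "Suc k"] by (auto simp: sum.delta distrib_left ac_simps)
  finally show ?thesis .
qed

lemma sigma_motive: assumes "m \<in> motive" shows "sigma m \<in> motive"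
  using assms Q_Kpoly
  by (auto simp: motive_iff[of "sigma m"] sigma_nth[OF assms] motive_Kpoly
      intro!: Kpoly_mult Kpoly_add Kpoly_power Kpoly_t_theta Kpoly_twist_m1)

lemma sigma_pow_motive: "m \<in> motive \<Longrightarrow> (sigma ^^ i) m \<in> motive"
  by (induction i) (auto intro: sigma_motive)

section \<open>The inverse of \<open>\<sigma>\<close>\<close>

text \<open>
  Scaling the \<open>l\<close>-th coordinate by \<open>\<Omega>\<^bsup>d\<^sub>l\<^esup>\<close> turns \<open>\<sigma>\<^sup>-\<^sup>1\<close> into an operator without poles, because
  \<open>\<Omega> = (t - \<theta>\<^sup>q) \<Omega>\<^sup>(\<^sup>1\<^sup>)\<close>. It preserves bounded power series.
\<close>

definition A :: "nat \<Rightarrow> 'c fps" where "A k = Om ^ s k * fps_of_poly (Q k)"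

definition N :: "(nat \<Rightarrow> 'c poly) \<Rightarrow> nat \<Rightarrow> 'c fps" where
  "N m l = Om ^ \<d> l * fps_of_poly (m l)"

text \<open>The inverse of \<open>sigma\<close> in the coordinates \<open>N\<close>, in closed form;
  \<open>T_rec\<close> is the form used in proofs. The value 0 at index 0 matches the convention
  that motive elements vanish outside \<open>{1..r}\<close>.\<close>

definition T :: "(nat \<Rightarrow> 'c fps) \<Rightarrow> nat \<Rightarrow> 'c fps" where
  "T g l = (if l = 0 then 0 else \<Sum>k=l..r. (-1) ^ (k - l) * (\<Prod>j=l..<k. A j) * tw 1 (g k))"

lemma T_outside: "l \<notin> {1..r} \<Longrightarrow> T g l = 0" by (auto simp: T_def)

lemma T_rec:
  "l \<in> {1..r} \<Longrightarrow> T g l = tw 1 (g l) - A l * T g (Suc l)"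
  using alternating_sum_rec[of l r A "\<lambda>k. tw 1 (g k)"] by (simp add: T_def)

text \<open>Downward induction, since coordinate \<open>l\<close> of \<open>T\<close> depends on its
  coordinate \<open>l + 1\<close>. The base covers all indices outside \<open>{1..r}\<close>,
  including 0.\<close>

lemma coordinate_induct:
  assumes "\<And>l. l \<notin> {1..r} \<Longrightarrow> P l" "\<And>l. l \<in> {1..r} \<Longrightarrow> P (Suc l) \<Longrightarrow> P l"
  shows "P (l::nat)"
proof (induction "Suc r - l" arbitrary: l)
  case 0 then show ?case using assms(1) by simp
next
  case (Suc n)
  show ?case
  proof (cases "l \<in> {1..r}")
    case True
    then show ?thesis using Suc(1)[of "Suc l"] Suc(2) assms(2) by simp
  qed (rule assms(1))
qed

lemma T_add: "T (\<lambda>l. g l + h l) = (\<lambda>l. T g l + T h l)"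
proof
  show "T (\<lambda>l. g l + h l) l = T g l + T h l" for l
    by (induction l rule: coordinate_induct) (simp_all add: T_outside T_rec tw_add algebra_simps)
qed

lemma T_mult: "T (\<lambda>l. f * g l) = (\<lambda>l. tw 1 f * T g l)"
proof
  show "T (\<lambda>l. f * g l) l = tw 1 f * T g l" for l
    by (induction l rule: coordinate_induct) (simp_all add: T_outside T_rec tw_mult algebra_simps)
qed

lemma T_0: "T (\<lambda>l. 0) = (\<lambda>l. 0)"
  using T_mult[of 0 "\<lambda>l. 0"] by simp

lemma bdd_A: "bdd (A k)" by (simp add: A_def bdd_mult bdd_power)

lemma bdd_T: "(\<And>l. bdd (g l)) \<Longrightarrow> bdd (T g l)"
  by (induction l rule: coordinate_induct) (simp_all add: T_outside T_rec bdd_diff bdd_tw bdd_mult bdd_A)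

lemma bdd_N: "bdd (N m l)" by (simp add: N_def bdd_mult bdd_power)

lemma T_inj:
  assumes "T g = T h" "\<And>l. l \<notin> {1..r} \<Longrightarrow> g l = h l"
  shows "g = h"
proof
  fix l show "g l = h l"
  proof (cases "l \<in> {1..r}")
    case True
    then have "tw 1 (g l) = tw 1 (h l)"
      using T_rec[OF True, of g] T_rec[OF True, of h] assms(1) by simp
    then show ?thesis by (simp add: fps_eq_iff fr_inj del: One_nat_def)
  qed (rule assms(2))
qed

lemma Om_nonzero: "Om \<noteq> 0" using Om_iOm by auto

lemma N_inj: "N m = N m' \<Longrightarrow> m = m'"
  using Om_nonzero by (auto simp: N_def fun_eq_iff fps_of_poly_eq_iff)

lemma N_add: "N (\<lambda>l. m l + m' l) = (\<lambda>l. N m l + N m' l)"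
  by (simp add: N_def fps_of_poly_add algebra_simps fun_eq_iff)
lemma N_mult: "N (\<lambda>l. p * m l) = (\<lambda>l. fps_of_poly p * N m l)"
  by (simp add: N_def fps_of_poly_mult algebra_simps fun_eq_iff)
lemma N_0: "N (\<lambda>l. 0) = (\<lambda>l. 0)" by (simp add: N_def fun_eq_iff)
lemma N_outside: "m \<in> motive \<Longrightarrow> l \<notin> {1..r} \<Longrightarrow> N m l = 0" by (simp add: N_def motive_outside)

lemma tw_Om_lin: "tw 1 (Om * lin \<theta>) = Om"
  using Om_functional by (simp add: tw_mult tw_lin mult.commute del: One_nat_def)

lemma Om_A: "l \<in> {1..r} \<Longrightarrow> A l * (Om ^ \<d> (Suc l) * f) = Om ^ \<d> l * (fps_of_poly (Q l) * f)"
  by (simp add: A_def d_rec[of l] power_add algebra_simps)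

lemma T_N_lin:
  assumes "l \<in> {1..r}" "m l = t_theta ^ \<d> l * h"
  shows "tw 1 (N m l) = Om ^ \<d> l * tw 1 (fps_of_poly h)"
proof -
  have "N m l = (Om * lin \<theta>) ^ \<d> l * fps_of_poly h"
    unfolding N_def assms(2)
    by (simp add: fps_of_poly_mult fps_of_poly_power fps_of_poly_t_theta power_mult_distrib mult.assoc)
  then show ?thesis by (simp only: tw_mult[of 1 "_ ^ _"] tw_power tw_Om_lin)
qed

text \<open>The twist of \<open>Om * lin \<theta>\<close> is \<open>Om\<close>, so the powers of
  \<open>t - \<theta>\<close> produced by \<open>sigma\<close> restore the powers of Omega; the
  superdiagonal term then cancels against \<open>A l\<close> times the next coordinate.\<close>

lemma T_N_sigma:
  assumes "m \<in> motive" shows "T (N (sigma m)) = N m"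
proof
  show "T (N (sigma m)) l = N m l" for l
  proof (induction l rule: coordinate_induct)
    case (1 l)
    then show ?case using assms by (simp add: T_outside N_outside)
  next
    case (2 l)
    have "tw 1 (N (sigma m) l)
        = Om ^ \<d> l * (fps_of_poly (m l) + fps_of_poly (m (Suc l)) * fps_of_poly (Q l))"
      using T_N_lin[OF 2(1), of "sigma m"] 2(1) assms Q_Kpoly[OF 2(1)]
      by (simp add: sigma_nth fps_of_poly_add fps_of_poly_mult tw_add tw_mult tw_twist_m1 motive_Kpoly
          del: One_nat_def)
    then show ?case
      unfolding T_rec[OF 2(1)] 2(2)
      by (simp add: N_def Om_A[OF 2(1)]) (simp add: algebra_simps)
  qed
qed

text \<open>Transfers identities from \<open>T\<close>, which is explicit and involves only positive
  twists, to \<open>sigma\<close>, whose definition contains q-th roots.\<close>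

lemma sigma_eqI:
  assumes "m \<in> motive" "m' \<in> motive" "T (N m') = N m" shows "sigma m = m'"
  by (rule N_inj, rule T_inj) (use assms T_N_sigma sigma_motive N_outside in auto)

lemma sigma_inj: "m \<in> motive \<Longrightarrow> m' \<in> motive \<Longrightarrow> sigma m = sigma m' \<Longrightarrow> m = m'"
  using T_N_sigma N_inj by metis

lemma sigma_add:
  assumes "m \<in> motive" "m' \<in> motive"
  shows "sigma (\<lambda>k. m k + m' k) = (\<lambda>k. sigma m k + sigma m' k)"
  by (rule sigma_eqI) (use assms in \<open>auto simp: motive_add sigma_motive N_add T_add T_N_sigma\<close>)

lemma sigma_0: "sigma (\<lambda>k. 0) = (\<lambda>k. 0)"
  by (rule sigma_eqI) (auto simp: motive_0 N_0 T_0)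

lemma sigma_cmult:
  assumes "m \<in> motive" "c \<in> Kbar"
  shows "sigma (\<lambda>k. [:fr 1 c:] * m k) = (\<lambda>k. [:c:] * sigma m k)"
proof (rule sigma_eqI)
  show "T (N (\<lambda>k. [:c:] * sigma m k)) = N (\<lambda>k. [:fr 1 c:] * m k)"
    unfolding N_mult T_mult T_N_sigma[OF assms(1)]
    by (simp add: fps_of_poly_const tw_const del: One_nat_def)
  show "(\<lambda>k. [:fr 1 c:] * m k) \<in> motive" using assms by (intro motive_mult Kpoly_const Kbar_fr)
  show "(\<lambda>k. [:c:] * sigma m k) \<in> motive" using assms by (intro motive_mult Kpoly_const sigma_motive)
qed

lemma sigma_poly_t:
  assumes "m \<in> motive"
  shows "sigma (\<lambda>k. poly_t a * m k) = (\<lambda>k. poly_t a * sigma m k)"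
proof (rule sigma_eqI)
  show "T (N (\<lambda>k. poly_t a * sigma m k)) = N (\<lambda>k. poly_t a * m k)"
    unfolding N_mult T_mult T_N_sigma[OF assms(1)] tw_poly_t ..
qed (use assms in \<open>auto intro: motive_mult Kpoly_poly_t sigma_motive\<close>)

lemma sigma_pow_add:
  "m \<in> motive \<Longrightarrow> m' \<in> motive \<Longrightarrow>
    (sigma ^^ i) (\<lambda>k. m k + m' k) = (\<lambda>k. (sigma ^^ i) m k + (sigma ^^ i) m' k)"
  by (induction i) (simp_all add: sigma_add sigma_pow_motive)

lemma sigma_pow_0: "(sigma ^^ i) (\<lambda>k. 0) = (\<lambda>k. 0)"
  by (induction i) (simp_all add: sigma_0)

lemma sigma_pow_cmult:
  "m \<in> motive \<Longrightarrow> c \<in> Kbar \<Longrightarrow> (sigma ^^ i) (\<lambda>k. [:fr i c:] * m k) = (\<lambda>k. [:c:] * (sigma ^^ i) m k)"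
proof (induction i arbitrary: c)
  case (Suc i)
  have "(sigma ^^ Suc i) (\<lambda>k. [:fr (Suc i) c:] * m k) = sigma (\<lambda>k. [:fr 1 c:] * (sigma ^^ i) m k)"
    using Suc(1)[of "fr 1 c"] Suc(2,3) by (simp add: fr_fr Kbar_fr)
  also have "\<dots> = (\<lambda>k. [:c:] * (sigma ^^ Suc i) m k)"
    using Suc(2,3) by (simp only: sigma_cmult sigma_pow_motive funpow.simps o_apply)
  finally show ?case .
qed simp

lemma sigma_pow_poly_t:
  "m \<in> motive \<Longrightarrow> (sigma ^^ i) (\<lambda>k. poly_t a * m k) = (\<lambda>k. poly_t a * (sigma ^^ i) m k)"
  by (induction i) (simp_all add: sigma_poly_t sigma_pow_motive)

lemma sigma_pow_sum:
  assumes "\<And>a. a \<in> S \<Longrightarrow> m a \<in> motive"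
  shows "(sigma ^^ i) (\<lambda>k. \<Sum>a\<in>S. m a k) = (\<lambda>k. \<Sum>a\<in>S. (sigma ^^ i) (m a) k)"
  using assms
proof (induction S rule: infinite_finite_induct)
  case (insert x F)
  then have "(sigma ^^ i) (\<lambda>k. m x k + (\<Sum>a\<in>F. m a k))
      = (\<lambda>k. (sigma ^^ i) (m x) k + (sigma ^^ i) (\<lambda>k. \<Sum>a\<in>F. m a k) k)"
    by (intro sigma_pow_add motive_sum) auto
  with insert show ?case by simp
qed (simp_all add: sigma_pow_0)

text \<open>Every vector whose l-th coordinate is divisible by \<open>t_theta ^ \<d> l\<close> lies
  in the image of \<open>sigma\<close>; the preimage is solved from the top coordinate down. Its
  recursion is part of the conclusion because the existence of expansions needs the degree of the
  top coordinate.\<close>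

lemma sigma_surj:
  assumes h: "\<And>l. h l \<in> Kpoly" and g: "\<And>l. g l = (if l \<in> {1..r} then t_theta ^ \<d> l * h l else 0)"
  obtains f where "f \<in> motive" "sigma f = g"
    "\<And>l. l \<notin> {1..r} \<Longrightarrow> f l = 0"
    "\<And>l. l \<in> {1..r} \<Longrightarrow> f l = map_poly (fr 1) (h l) - Q l * f (Suc l)"
proof -
  define tp where "tp = map_poly (fr 1)"
  have tp_coeff: "coeff (tp p) i = fr 1 (coeff p i)" for p i
    unfolding tp_def by (rule coeff_map_poly) simp
  have tp_fps: "fps_of_poly (tp p) = tw 1 (fps_of_poly p)" for p
    by (rule fps_ext) (simp add: tp_coeff del: One_nat_def)
  have tp_K: "tp p \<in> Kpoly" if "p \<in> Kpoly" for p using that by (simp add: Kpoly_def tp_coeff Kbar_fr)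
  define f where "f l = (if l = 0 then 0 else \<Sum>k=l..r. (-1) ^ (k - l) * (\<Prod>j=l..<k. Q j) * tp (h k))" for l
  have f_out: "f l = 0" if "l \<notin> {1..r}" for l using that by (auto simp: f_def)
  have f_rec: "f l = tp (h l) - Q l * f (Suc l)" if "l \<in> {1..r}" for l
    using that alternating_sum_rec[of l r Q "\<lambda>k. tp (h k)"] by (simp add: f_def)
  have fm: "f \<in> motive"
  proof -
    have "f l \<in> Kpoly" for l
      by (induction l rule: coordinate_induct)
        (auto simp: f_out f_rec intro!: Kpoly_diff Kpoly_mult tp_K h Q_Kpoly)
    then show ?thesis by (simp add: motive_iff f_out)
  qed
  have gm: "g \<in> motive"
    by (auto simp: motive_iff g intro!: Kpoly_mult Kpoly_power Kpoly_t_theta h)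
  have "T (N g) l = N f l" for l
  proof (induction l rule: coordinate_induct)
    case (1 l) then show ?case using fm by (simp add: T_outside N_outside)
  next
    case (2 l)
    show ?case
    proof -
      have g': "g l = t_theta ^ \<d> l * h l" using g[of l] 2(1) by simp
      have "A l * N f (Suc l) = Om ^ \<d> l * (fps_of_poly (Q l) * fps_of_poly (f (Suc l)))"
        unfolding N_def by (rule Om_A[OF 2(1)])
      then show ?thesis
        unfolding T_rec[OF 2(1)] 2(2) T_N_lin[of l g, OF 2(1) g'] N_def[of f l] f_rec[OF 2(1)]
        by (simp add: fps_of_poly_diff fps_of_poly_mult tp_fps right_diff_distrib del: One_nat_def)
    qed
  qed
  then have "sigma f = g" by (intro sigma_eqI fm gm ext)
  then show thesis using that[of f] fm f_out f_rec by (simp add: tp_def)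
qed

section \<open>Expansions in powers of \<open>\<sigma>\<close>\<close>

text \<open>The map \<open>delta0\<close> in the scaled coordinates of \<open>N\<close>: the power
  of \<open>iOm\<close> undoes the scaling, and \<open>D\<close> replaces analytic Taylor
  coefficients.\<close>

definition dl0 :: "(nat \<Rightarrow> 'c fps) \<Rightarrow> nat \<Rightarrow> 'c" where
  "dl0 g j = D (ixe j) (g (ixl j) * iOm ^ \<d> (ixl j))"

definition comb :: "(nat \<Rightarrow> 'c) \<Rightarrow> nat \<Rightarrow> 'c poly" where
  "comb v = (\<lambda>k. \<Sum>j<dim_E. [:v j:] * (w ! j) k)"

lemma comb_motive: "(\<And>j. v j \<in> Kbar) \<Longrightarrow> comb v \<in> motive"
  unfolding comb_def by (intro motive_sum motive_mult Kpoly_const motive_w) auto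

lemma comb_0: "comb (\<lambda>_. 0) = (\<lambda>_. 0)" by (simp add: comb_def)
lemma comb_add: "comb (\<lambda>j. u j + v j) = (\<lambda>k. comb u k + comb v k)"
  unfolding comb_def by (simp add: smult_add_left sum.distrib)
lemma comb_cmult: "comb (\<lambda>j. c * v j) = (\<lambda>k. [:c:] * comb v k)"
proof -
  have "[:c * v j:] * p = [:c:] * ([:v j:] * p)" for j p by (simp add: mult.commute)
  then show ?thesis unfolding comb_def by (simp only: sum_distrib_left)
qed
lemma comb_sum: "comb (\<lambda>j. \<Sum>a\<in>S. v a j) = (\<lambda>k. \<Sum>a\<in>S. comb (v a) k)"
  by (induction S rule: infinite_finite_induct) (simp_all add: comb_0 comb_add)

lemma iOm_cancel: "(Om ^ n * f) * iOm ^ n = f"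
proof -
  have "Om ^ n * iOm ^ n = 1" by (simp add: Om_iOm flip: power_mult_distrib)
  then show ?thesis by (metis mult.commute mult.left_commute mult_1_right)
qed

lemma dl0_N: "dl0 (N m) j = D (ixe j) (fps_of_poly (m (ixl j)))"
  by (simp add: dl0_def N_def iOm_cancel)

lemma bdd_iOm_mult: "bdd f \<Longrightarrow> bdd (f * iOm ^ n)" by (simp add: bdd_mult bdd_power)

lemma dl0_add: "(\<And>l. bdd (g l)) \<Longrightarrow> (\<And>l. bdd (h l)) \<Longrightarrow> dl0 (\<lambda>l. g l + h l) j = dl0 g j + dl0 h j"
  by (simp add: dl0_def distrib_right D_add bdd_iOm_mult)
lemma dl0_cmult: "(\<And>l. bdd (g l)) \<Longrightarrow> dl0 (\<lambda>l. fps_const c * g l) j = c * dl0 g j"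
  by (simp add: dl0_def mult.assoc D_cmult bdd_iOm_mult)
lemma dl0_sum: "(\<And>a l. a \<in> S \<Longrightarrow> bdd (g a l)) \<Longrightarrow> dl0 (\<lambda>l. \<Sum>a\<in>S. g a l) j = (\<Sum>a\<in>S. dl0 (g a) j)"
  by (simp add: dl0_def sum_distrib_right D_sum bdd_iOm_mult)

lemma dl0_N_w:
  assumes "i < dim_E" "j < dim_E" shows "dl0 (N (w ! i)) j = (if i = j then 1 else 0)"
  using ix_inj[OF assms] assms
  by (auto simp: dl0_N w_nth fps_of_poly_power fps_of_poly_t_theta D_lin_pow)

lemma dl0_N_sigma: assumes "m \<in> motive" "j < dim_E" shows "dl0 (N (sigma m)) j = 0"
  using ix_nth[OF assms(2)]
  by (simp add: dl0_N sigma_nth[OF assms(1)] fps_of_poly_mult fps_of_poly_power fps_of_poly_t_theta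
      D_lin_pow_mult)

lemma N_comb: "N (comb v) = (\<lambda>l. \<Sum>j<dim_E. fps_const (v j) * N (w ! j) l)"
  by (simp add: N_def comb_def fps_of_poly_sum fps_of_poly_smult fun_eq_iff sum_distrib_left
      fps_const_mult_apply_left algebra_simps)

lemma dl0_N_comb: assumes "j < dim_E" shows "dl0 (N (comb v)) j = v j"
proof -
  have "dl0 (N (comb v)) j = (\<Sum>i<dim_E. v i * dl0 (N (w ! i)) j)"
    unfolding N_comb by (subst dl0_sum) (auto simp: bdd_mult bdd_N dl0_cmult)
  also have "\<dots> = (\<Sum>i<dim_E. if i = j then v j else 0)"
    by (rule sum.cong) (auto simp: dl0_N_w assms)
  finally show ?thesis using assms by simp
qed

text \<open>\<open>expansion m n e\<close> collects the coefficients as \<open>e\<^sub>i\<^sub>j = c\<^sub>i\<^sub>j\<^bsup>q^i\<^esup>\<close>, so that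
  \<open>\<delta>\<^sub>1\<close> is their plain sum over \<open>i\<close>.\<close>
definition expansion :: "(nat \<Rightarrow> 'c poly) \<Rightarrow> nat \<Rightarrow> (nat \<Rightarrow> nat \<Rightarrow> 'c) \<Rightarrow> bool" where
  "expansion m n e \<longleftrightarrow> (\<forall>i j. e i j \<in> Kbar) \<and> (\<forall>i j. n \<le> i \<or> dim_E \<le> j \<longrightarrow> e i j = 0) \<and>
     m = (\<lambda>k. \<Sum>i<n. (sigma ^^ i) (comb (e i)) k)"

lemma expansion_mono: assumes "expansion m n e" "n \<le> n'" shows "expansion m n' e"
proof -
  have z: "e i = (\<lambda>_. 0)" if "n \<le> i" for i using assms(1) that by (auto simp: expansion_def)
  have "(\<Sum>i<n'. (sigma ^^ i) (comb (e i)) k) = (\<Sum>i<n. (sigma ^^ i) (comb (e i)) k)" for k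
    by (rule sum.mono_neutral_right) (use assms(2) z in \<open>auto simp: comb_0 sigma_pow_0\<close>)
  then show ?thesis using assms by (auto simp: expansion_def)
qed

lemma expansion_motive: assumes "expansion m n e" shows "m \<in> motive"
  using assms unfolding expansion_def by (auto intro!: motive_sum sigma_pow_motive comb_motive)

lemma expansion_add:
  assumes "expansion m n e" "expansion m' n e'"
  shows "expansion (\<lambda>k. m k + m' k) n (\<lambda>i j. e i j + e' i j)"
proof -
  have "(sigma ^^ i) (comb (\<lambda>j. e i j + e' i j)) = (\<lambda>k. (sigma ^^ i) (comb (e i)) k + (sigma ^^ i) (comb (e' i)) k)" for i
    unfolding comb_add by (rule sigma_pow_add) (use assms in \<open>auto simp: expansion_def intro: comb_motive\<close>)
  then show ?thesis using assms by (auto simp: expansion_def sum.distrib Kbar_add)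
qed

lemma expansion_cmult:
  assumes "expansion m n e" "c \<in> Kbar"
  shows "expansion (\<lambda>k. [:c:] * m k) n (\<lambda>i j. fr i c * e i j)"
proof -
  have "(sigma ^^ i) (comb (\<lambda>j. fr i c * e i j)) = (\<lambda>k. [:c:] * (sigma ^^ i) (comb (e i)) k)" for i
    unfolding comb_cmult by (rule sigma_pow_cmult) (use assms in \<open>auto simp: expansion_def intro: comb_motive\<close>)
  moreover have "m = (\<lambda>k. \<Sum>i<n. (sigma ^^ i) (comb (e i)) k)" using assms by (simp add: expansion_def)
  then have "(\<lambda>k. [:c:] * m k) = (\<lambda>k. \<Sum>i<n. [:c:] * (sigma ^^ i) (comb (e i)) k)"
    by (simp only: sum_distrib_left)
  ultimately show ?thesis using assms unfolding expansion_def by (simp only: Kbar_mult Kbar_fr) simp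
qed

lemma expansion_comb:
  assumes "\<And>j. v j \<in> Kbar" "\<And>j. dim_E \<le> j \<Longrightarrow> v j = 0"
  shows "expansion (comb v) 1 (\<lambda>i j. if i = 0 then v j else 0)"
  using assms by (auto simp: expansion_def)

lemma expansion_sigma_shift:
  assumes "\<And>i j. e i j \<in> Kbar"
  shows "sigma (\<lambda>k. \<Sum>i<n. (sigma ^^ i) (comb (e i)) k) = (\<lambda>k. \<Sum>i<n. (sigma ^^ Suc i) (comb (e i)) k)"
  using sigma_pow_sum[of "{..<n}" "\<lambda>i. (sigma ^^ i) (comb (e i))" 1] assms
  by (simp add: sigma_pow_motive comb_motive)

lemma expansion_sigma:
  assumes "expansion m n e"
  shows "expansion (sigma m) (Suc n) (\<lambda>i j. if i = 0 then 0 else e (i - 1) j)"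
proof -
  have e: "\<And>i j. e i j \<in> Kbar" and m: "m = (\<lambda>k. \<Sum>i<n. (sigma ^^ i) (comb (e i)) k)"
    using assms by (auto simp: expansion_def)
  have "sigma m = (\<lambda>k. \<Sum>i<n. (sigma ^^ Suc i) (comb (e i)) k)"
    unfolding m by (rule expansion_sigma_shift[OF e])
  also have "\<dots> = (\<lambda>k. \<Sum>i<Suc n. (sigma ^^ i) (comb (\<lambda>j. if i = 0 then 0 else e (i - 1) j)) k)"
    by (rule ext, subst sum.lessThan_Suc_shift) (simp add: comb_0 del: funpow.simps(2))
  finally show ?thesis using assms by (auto simp: expansion_def)
qed

text \<open>The coefficients with index 0 are recovered by \<open>dl0\<close>, which kills
  everything in the image of \<open>sigma\<close>. Subtracting them and cancelling one
  \<open>sigma\<close> leaves a shorter expansion.\<close>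

lemma expansion_unique:
  assumes "expansion m n e" "expansion m n e'"
  shows "e = e'"
  using assms
proof (induction n arbitrary: m e e')
  case 0
  then show ?case by (auto simp: expansion_def fun_eq_iff)
next
  case (Suc n)
  define tl where "tl e = (\<lambda>k. \<Sum>i<n. (sigma ^^ i) (comb (e (Suc i))) k)" for e
  have split: "m = (\<lambda>k. comb (e 0) k + sigma (tl e) k)" "tl e \<in> motive" "e 0 j = (if j < dim_E then dl0 (N m) j else 0)"
    "expansion (tl e) n (\<lambda>i. e (Suc i))"
    if "expansion m (Suc n) e" for e j
  proof -
    have e: "\<And>i j. e i j \<in> Kbar" and m: "m = (\<lambda>k. \<Sum>i<Suc n. (sigma ^^ i) (comb (e i)) k)"
      using that by (auto simp: expansion_def)
    show ex: "expansion (tl e) n (\<lambda>i. e (Suc i))" using that by (auto simp: expansion_def tl_def)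
    then show tm: "tl e \<in> motive" by (rule expansion_motive)
    show 1: "m = (\<lambda>k. comb (e 0) k + sigma (tl e) k)"
      unfolding m tl_def using expansion_sigma_shift[of "\<lambda>i. e (Suc i)" n] e
      by (simp add: sum.lessThan_Suc_shift del: sum.lessThan_Suc funpow.simps(2))
    show "e 0 j = (if j < dim_E then dl0 (N m) j else 0)"
    proof (cases "j < dim_E")
      case True
      have "dl0 (N m) j = e 0 j"
        unfolding 1 N_add using True tm by (subst dl0_add) (auto simp: bdd_N dl0_N_comb dl0_N_sigma)
      then show ?thesis using True by simp
    next
      case False then show ?thesis using that by (simp add: expansion_def)
    qed
  qed
  have e0: "e 0 = e' 0" by (rule ext) (simp only: split(3)[OF Suc.prems(1)] split(3)[OF Suc.prems(2)])
  have "sigma (tl e) = sigma (tl e')"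
    using split(1)[OF Suc.prems(1)] split(1)[OF Suc.prems(2)] e0 by (metis (no_types, lifting) add_left_cancel ext)
  then have "tl e = tl e'"
    using sigma_inj split(2)[OF Suc.prems(1)] split(2)[OF Suc.prems(2)] by blast
  then have "(\<lambda>i. e (Suc i)) = (\<lambda>i. e' (Suc i))"
    using Suc.IH split(4)[OF Suc.prems(1)] split(4)[OF Suc.prems(2)] by metis
  then show ?case using e0 by (metis (no_types, lifting) ext not0_implies_Suc)
qed

section \<open>Division by powers of t - theta and existence of expansions\<close>

definition sd :: "'c poly \<Rightarrow> 'c poly" where "sd p = synthetic_div p \<theta>"

lemma sd_decomp: "p = [:poly p \<theta>:] + t_theta * sd p"
  using synthetic_div_correct'[of \<theta> p] by (simp add: sd_def algebra_simps)

lemma Kbar_poly_theta: "p \<in> Kpoly \<Longrightarrow> poly p \<theta> \<in> Kbar"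
  unfolding poly_altdef by (intro Kbar_sum Kbar_mult Kbar_power Kbar_theta) (simp add: Kpoly_def)

lemma Kpoly_sd: "p \<in> Kpoly \<Longrightarrow> sd p \<in> Kpoly"
proof (induction p)
  case (pCons a p)
  have "coeff (pCons a p) (Suc i) \<in> Kbar" for i using pCons(3) unfolding Kpoly_def by blast
  then have "p \<in> Kpoly" by (simp add: Kpoly_def)
  with pCons show ?case by (auto simp: sd_def Kpoly_def coeff_pCons Kbar_poly_theta split: nat.split)
qed (simp add: sd_def)

lemma Kpoly_sd_pow: "p \<in> Kpoly \<Longrightarrow> (sd ^^ n) p \<in> Kpoly"
  by (induction n) (auto intro: Kpoly_sd)

lemma sd_pow_decomp: "p = (\<Sum>e<n. [:poly ((sd ^^ e) p) \<theta>:] * t_theta ^ e) + t_theta ^ n * (sd ^^ n) p"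
proof (induction n)
  case (Suc n)
  have gen: "u ^ n * (c + u * h) = c * u ^ n + u ^ Suc n * h" for u c h :: "'c poly"
    by (simp add: algebra_simps)
  have "t_theta ^ n * (sd ^^ n) p
      = [:poly ((sd ^^ n) p) \<theta>:] * t_theta ^ n + t_theta ^ Suc n * (sd ^^ Suc n) p"
    unfolding gen[symmetric] using sd_decomp[of "(sd ^^ n) p"] by simp
  then show ?case using Suc by (simp only: sum.lessThan_Suc add.assoc)
qed simp

lemma sd_0 [simp]: "sd 0 = 0" by (simp add: sd_def)

lemma degree_sd_pow: "degree ((sd ^^ n) p) = degree p - n"
  by (induction n) (simp_all add: sd_def degree_synthetic_div)

lemma sd_pow_0: "degree p < n \<Longrightarrow> (sd ^^ n) p = 0"
proof -
  assume d: "degree p < n"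
  then obtain k where n: "n = k + Suc (degree p)" by (metis add.commute less_imp_Suc_add add_Suc_right)
  have "sd ((sd ^^ degree p) p) = 0"
    using degree_sd_pow[of "degree p" p] by (simp add: sd_def synthetic_div_eq_0_iff)
  then have "(sd ^^ n) p = (sd ^^ k) 0" unfolding n funpow_add by simp
  moreover have "(sd ^^ k) 0 = 0" by (induction k) simp_all
  ultimately show ?thesis by simp
qed

lemma comb_ix:
  assumes "\<And>j. j < dim_E \<Longrightarrow> v j = c (ixl j) (ixe j)"
  shows "comb v k = (if k \<in> {1..r} then \<Sum>e<\<d> k. [:c k e:] * t_theta ^ e else 0)"
proof -
  have "comb v k = (\<Sum>j<dim_E. if k = ixl j then [:c (ixl j) (ixe j):] * t_theta ^ ixe j else 0)"
    unfolding comb_def by (rule sum.cong) (auto simp: w_nth assms)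
  also have "\<dots> = (\<Sum>l=1..r. \<Sum>e<\<d> l. if k = l then [:c l e:] * t_theta ^ e else 0)"
    by (rule sum_ix)
  also have "\<dots> = (\<Sum>l=1..r. if k = l then \<Sum>e<\<d> k. [:c k e:] * t_theta ^ e else 0)"
    by (rule sum.cong) auto
  finally show ?thesis by (simp add: sum.delta')
qed

text \<open>In each coordinate the Taylor polynomial at \<open>\<theta>\<close> of order below
  \<open>\<d> l\<close> is a combination of the \<open>w ! j\<close>; the rest is divisible by
  \<open>t_theta ^ \<d> l\<close>, hence in the image of \<open>sigma\<close>.\<close>

lemma motive_decomp:
  assumes "m \<in> motive"
  obtains v f where "\<And>j. v j \<in> Kbar" "\<And>j. dim_E \<le> j \<Longrightarrow> v j = 0" "f \<in> motive"
    "m = (\<lambda>k. comb v k + sigma f k)"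
    "\<And>l. l \<in> {1..r} \<Longrightarrow> f l = map_poly (fr 1) ((sd ^^ \<d> l) (m l)) - Q l * f (Suc l)"
proof -
  define v where "v j = (if j < dim_E then poly ((sd ^^ ixe j) (m (ixl j))) \<theta> else 0)" for j
  have cv: "comb v k = (if k \<in> {1..r} then \<Sum>e<\<d> k. [:poly ((sd ^^ e) (m k)) \<theta>:] * t_theta ^ e else 0)" for k
    by (rule comb_ix) (simp add: v_def)
  obtain f where f: "f \<in> motive" "sigma f = (\<lambda>l. if l \<in> {1..r} then t_theta ^ \<d> l * (sd ^^ \<d> l) (m l) else 0)"
    "\<And>l. l \<in> {1..r} \<Longrightarrow> f l = map_poly (fr 1) ((sd ^^ \<d> l) (m l)) - Q l * f (Suc l)"
    by (rule sigma_surj[of "\<lambda>l. (sd ^^ \<d> l) (m l)" "\<lambda>l. if l \<in> {1..r} then t_theta ^ \<d> l * (sd ^^ \<d> l) (m l) else 0"])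
      (auto intro: Kpoly_sd_pow motive_Kpoly[OF assms])
  have "m k = comb v k + sigma f k" for k
    unfolding f(2) cv using sd_pow_decomp[of "m k" "\<d> k"] motive_outside[OF assms, of k] by auto
  then show thesis
    using f by (intro that[of v f]) (auto simp: v_def intro!: Kbar_poly_theta Kpoly_sd_pow motive_Kpoly[OF assms])
qed

text \<open>Passing to the preimage \<open>f\<close> lowers the degree of the top nonzero coordinate
  by \<open>\<d> l >= 1\<close>, but may raise the degrees below it because of the
  \<open>Q l\<close>. Hence the nested induction: on the index of the top coordinate, then on its
  degree. Once that degree is below \<open>\<d> l\<close>, the coordinate disappears.\<close>

lemma expansion_exists: assumes "m \<in> motive" obtains n e where "expansion m n e"
proof -
  have step: "\<exists>n e. expansion m n e"
    if f: "\<exists>n e. expansion f n e" and m: "m = (\<lambda>k. comb v k + sigma f k)"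
      and v: "\<And>j. v j \<in> Kbar" "\<And>j. dim_E \<le> j \<Longrightarrow> v j = 0" for m f v
  proof -
    obtain n e where e: "expansion f n e" using f by blast
    have "expansion (comb v) (Suc n) (\<lambda>i j. if i = 0 then v j else 0)"
      by (rule expansion_mono[OF expansion_comb]) (use v in auto)
    from expansion_add[OF this expansion_sigma[OF e]] show ?thesis unfolding m by blast
  qed
  have "\<exists>n e. expansion m n e" if "m \<in> motive" "\<And>l. L < l \<Longrightarrow> m l = 0" for L m
    using that
  proof (induction L arbitrary: m)
    case 0
    have "m l = 0" for l using 0(2)[of l] motive_outside[OF 0(1), of 0] by (cases l) auto
    then have "expansion m 0 (\<lambda>_ _. 0)" by (auto simp: expansion_def)
    then show ?case by blast
  next
    case (Suc L)
    show ?case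
      using Suc.prems
    proof (induction "degree (m (Suc L))" arbitrary: m rule: less_induct)
      case less
      obtain v f where vf: "\<And>j. v j \<in> Kbar" "\<And>j. dim_E \<le> j \<Longrightarrow> v j = 0" "f \<in> motive"
        "m = (\<lambda>k. comb v k + sigma f k)"
        "\<And>l. l \<in> {1..r} \<Longrightarrow> f l = map_poly (fr 1) ((sd ^^ \<d> l) (m l)) - Q l * f (Suc l)"
        by (rule motive_decomp[OF less.prems(1)]) blast
      have f_high: "f l = 0" if "Suc L < l" for l
        using that
      proof (induction l rule: coordinate_induct)
        case (1 l) then show ?case using motive_outside[OF vf(3)] by blast
      next
        case (2 l)
        have "m l = 0" using less.prems(2) 2 by blast
        moreover have "(sd ^^ n) 0 = 0" for n by (induction n) simp_all
        ultimately show ?case using vf(5)[OF 2(1)] 2 by simp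
      qed
      have "\<exists>n e. expansion f n e"
      proof (cases "Suc L \<in> {1..r}")
        case False
        then have "f l = 0" if "L < l" for l
          using that f_high motive_outside[OF vf(3), of l] by (cases "l = Suc L") auto
        then show ?thesis using Suc.IH vf(3) by blast
      next
        case True
        have fL: "f (Suc L) = map_poly (fr 1) ((sd ^^ \<d> (Suc L)) (m (Suc L)))"
          using vf(5)[OF True] f_high[of "Suc (Suc L)"] by simp
        show ?thesis
        proof (cases "degree (m (Suc L)) < \<d> (Suc L)")
          case True
          then have "f (Suc L) = 0" unfolding fL by (simp add: sd_pow_0)
          then have "f l = 0" if "L < l" for l using that f_high by (cases "l = Suc L") auto
          then show ?thesis using Suc.IH vf(3) by blast
        next
          case False
          have "degree (f (Suc L)) \<le> degree ((sd ^^ \<d> (Suc L)) (m (Suc L)))"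
            unfolding fL by (rule degree_le) (simp add: coeff_map_poly[of "fr 1"] coeff_eq_0 del: One_nat_def)
          also have "\<dots> < degree (m (Suc L))"
            unfolding degree_sd_pow using d_pos[OF True] False by linarith
          finally show ?thesis using less.hyps vf(3) f_high by blast
        qed
      qed
      then show ?case using step[OF _ vf(4,1,2)] by blast
    qed
  qed
  from this[OF assms, of r] motive_outside[OF assms] show thesis using that by auto
qed

section \<open>The map \<open>\<delta>\<^sub>1\<close>\<close>

lemma fr_root_exists: "c \<in> Kbar \<Longrightarrow> \<exists>x\<in>Kbar. fr i x = c"
proof (induction i arbitrary: c)
  case (Suc i)
  obtain y where y: "y \<in> Kbar" "fr 1 y = c" using Kbar_qroot[OF Suc.prems] .
  obtain x where "x \<in> Kbar" "fr i x = y" using Suc.IH[OF y(1)] by blast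
  then show ?case using y(2) fr_fr[of 1 i x] by auto
qed auto

text \<open>A scalar in front of \<open>sigma ^^ i\<close> becomes its \<open>q ^ i\<close>-th power
  when moved inside, which is the passage between the two kinds of coefficients.\<close>

lemma is_sigma_expansion_iff:
  "is_sigma_expansion m c \<longleftrightarrow> (\<forall>i j. c i j \<in> Kbar) \<and> (\<exists>n. expansion m n (\<lambda>i j. fr i (c i j)))"
proof -
  have s: "(\<Sum>j<dim_E. [:c i j:] * (sigma ^^ i) (w ! j) k) = (sigma ^^ i) (comb (\<lambda>j. fr i (c i j))) k"
    if "\<forall>i j. c i j \<in> Kbar" for i k
  proof -
    have "(sigma ^^ i) (comb (\<lambda>j. fr i (c i j)))
        = (\<lambda>k. \<Sum>j<dim_E. (sigma ^^ i) (\<lambda>k. [:fr i (c i j):] * (w ! j) k) k)"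
      unfolding comb_def
      by (rule sigma_pow_sum) (use that in \<open>intro motive_mult Kpoly_const Kbar_fr motive_w; auto\<close>)
    then have "(sigma ^^ i) (comb (\<lambda>j. fr i (c i j))) k
        = (\<Sum>j<dim_E. (sigma ^^ i) (\<lambda>k. [:fr i (c i j):] * (w ! j) k) k)" by (simp only:)
    also have "\<dots> = (\<Sum>j<dim_E. [:c i j:] * (sigma ^^ i) (w ! j) k)"
      by (rule sum.cong[OF refl]) (use that in \<open>simp only: sigma_pow_cmult motive_w lessThan_iff\<close>)
    finally show ?thesis by (rule sym)
  qed
  have sums: "(\<Sum>i | \<exists>j. c i j \<noteq> 0. \<Sum>j<dim_E. [:c i j:] * (sigma ^^ i) (w ! j) k)
      = (\<Sum>i<n. (sigma ^^ i) (comb (\<lambda>j. fr i (c i j))) k)"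
    if K: "\<forall>i j. c i j \<in> Kbar" and n: "{i. \<exists>j. c i j \<noteq> 0} \<subseteq> {..<n}" for n k
  proof -
    have "(\<Sum>i | \<exists>j. c i j \<noteq> 0. \<Sum>j<dim_E. [:c i j:] * (sigma ^^ i) (w ! j) k)
      = (\<Sum>i<n. \<Sum>j<dim_E. [:c i j:] * (sigma ^^ i) (w ! j) k)"
      by (rule sum.mono_neutral_left) (use n in auto)
    then show ?thesis by (simp only: s[OF K])
  qed
  show ?thesis
  proof
    assume a: "is_sigma_expansion m c"
    then have Kc: "\<forall>i j. c i j \<in> Kbar" and z: "\<And>i j. dim_E \<le> j \<Longrightarrow> c i j = 0"
      and fin: "finite {i. \<exists>j. c i j \<noteq> 0}"
      and m: "m = (\<lambda>k. \<Sum>i | \<exists>j. c i j \<noteq> 0. \<Sum>j<dim_E. [:c i j:] * (sigma ^^ i) (w ! j) k)"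
      unfolding is_sigma_expansion_def by blast+
    obtain n where n: "{i. \<exists>j. c i j \<noteq> 0} \<subseteq> {..<n}"
      using fin unfolding finite_nat_iff_bounded by blast
    have zn: "c i j = 0" if "n \<le> i" for i j
    proof (rule ccontr)
      assume "c i j \<noteq> 0"
      then have "i \<in> {i. \<exists>j. c i j \<noteq> 0}" by blast
      then have "i < n" using n by blast
      with that show False by simp
    qed
    have "expansion m n (\<lambda>i j. fr i (c i j))"
      unfolding expansion_def
    proof (intro conjI)
      show "m = (\<lambda>k. \<Sum>i<n. (sigma ^^ i) (comb (\<lambda>j. fr i (c i j))) k)"
        by (subst m) (simp only: sums[OF Kc n])
    qed (use Kc z zn in \<open>auto intro: Kbar_fr\<close>)
    with Kc show "(\<forall>i j. c i j \<in> Kbar) \<and> (\<exists>n. expansion m n (\<lambda>i j. fr i (c i j)))" by blast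
  next
    assume a: "(\<forall>i j. c i j \<in> Kbar) \<and> (\<exists>n. expansion m n (\<lambda>i j. fr i (c i j)))"
    then obtain n where ex: "expansion m n (\<lambda>i j. fr i (c i j))" by blast
    from a have Kc: "\<forall>i j. c i j \<in> Kbar" by blast
    have z: "c i j = 0" if "n \<le> i \<or> dim_E \<le> j" for i j
      using ex that unfolding expansion_def by (metis fr_eq_0)
    have n: "{i. \<exists>j. c i j \<noteq> 0} \<subseteq> {..<n}"
      using z by (force simp: not_le[symmetric])
    have m: "m = (\<lambda>k. \<Sum>i<n. (sigma ^^ i) (comb (\<lambda>j. fr i (c i j))) k)"
      using ex unfolding expansion_def by blast
    show "is_sigma_expansion m c"
      unfolding is_sigma_expansion_def
    proof (intro conjI)
      show "m = (\<lambda>k. \<Sum>i | \<exists>j. c i j \<noteq> 0. \<Sum>j<dim_E. [:c i j:] * (sigma ^^ i) (w ! j) k)"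
        by (subst m) (simp only: sums[OF Kc n])
    qed (use Kc z finite_subset[OF n] in auto)
  qed
qed

text \<open>Roots of the \<open>e i j\<close> in \<open>Kbar\<close> give an expansion in the
  official sense. After enlarging both bounds, uniqueness of expansions shows that the description
  in \<open>sigma_coeff\<close> picks this one.\<close>

lemma delta1_expansion:
  assumes "expansion m n e" shows "delta1 m = vec dim_E (\<lambda>j. \<Sum>i<n. e i j)"
proof -
  define c where "c i j = (SOME x. x \<in> Kbar \<and> fr i x = e i j)" for i j
  have c: "c i j \<in> Kbar" "fr i (c i j) = e i j" for i j
    using someI_ex[of "\<lambda>x. x \<in> Kbar \<and> fr i x = e i j"] fr_root_exists[of "e i j" i] assms
    unfolding c_def expansion_def by blast+
  have ise: "is_sigma_expansion m c"
    unfolding is_sigma_expansion_iff using c assms by auto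
  have "c' = c" if c': "is_sigma_expansion m c'" for c'
  proof -
    obtain n' where "expansion m n' (\<lambda>i j. fr i (c' i j))"
      using c' unfolding is_sigma_expansion_iff by blast
    then have "expansion m (n + n') (\<lambda>i j. fr i (c' i j))" "expansion m (n + n') e"
      using assms by (auto intro: expansion_mono)
    then have "(\<lambda>i j. fr i (c' i j)) = e" by (rule expansion_unique)
    then show ?thesis using c(2) by (metis (no_types, lifting) ext fr_inj)
  qed
  then have sc: "sigma_coeff m = c" unfolding sigma_coeff_def using ise by blast
  have "c i j = 0" if "n \<le> i" for i j
    using assms c(2)[of i j] that unfolding expansion_def by (metis fr_eq_0)
  then have sub: "{i. \<exists>j. c i j \<noteq> 0} \<subseteq> {..<n}" by (force simp: not_le[symmetric])
  have ez: "e i j = 0" if "c i j = 0" for i j using c(2)[of i j] that by simp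
  have "(\<Sum>i | \<exists>j. c i j \<noteq> 0. frob (int i) (c i j)) = (\<Sum>i<n. e i j)" for j
    unfolding frob_of_nat c(2) by (rule sum.mono_neutral_left) (use sub ez in auto)
  then show ?thesis unfolding delta1_def sc by simp
qed

lemma dim_delta1 [simp]: "dim_vec (delta1 m) = dim_E" by (simp add: delta1_def)

lemma delta1_Kbar:
  assumes "m \<in> motive" "j < dim_E" shows "delta1 m $ j \<in> Kbar"
proof -
  obtain n e where "expansion m n e" by (rule expansion_exists[OF assms(1)])
  then show ?thesis using assms(2) by (auto simp: delta1_expansion expansion_def intro!: Kbar_sum)
qed

lemma delta1_add:
  assumes "m \<in> motive" "m' \<in> motive"
  shows "delta1 (\<lambda>k. m k + m' k) = delta1 m + delta1 m'"
proof -
  obtain n e n' e' where "expansion m n e" "expansion m' n' e'"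
    using expansion_exists[OF assms(1)] expansion_exists[OF assms(2)] by metis
  then have "expansion m (n + n') e" "expansion m' (n + n') e'" by (auto intro: expansion_mono)
  from delta1_expansion[OF expansion_add[OF this]] delta1_expansion[OF this(1)] delta1_expansion[OF this(2)]
  show ?thesis by (auto simp: sum.distrib)
qed

text \<open>Applying \<open>sigma\<close> shifts the coefficient rows by one and leaves their sum
  unchanged.\<close>

lemma delta1_sigma: assumes "m \<in> motive" shows "delta1 (sigma m) = delta1 m"
proof -
  obtain n e where e: "expansion m n e" by (rule expansion_exists[OF assms(1)])
  show ?thesis
    unfolding delta1_expansion[OF expansion_sigma[OF e]] delta1_expansion[OF e]
    by (simp add: sum.lessThan_Suc_shift del: sum.lessThan_Suc)
qed

lemma delta1_sigma_pow: "m \<in> motive \<Longrightarrow> delta1 ((sigma ^^ i) m) = delta1 m"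
  by (induction i) (simp_all add: delta1_sigma sigma_pow_motive)

lemma delta1_comb:
  assumes "\<And>j. v j \<in> Kbar" "\<And>j. dim_E \<le> j \<Longrightarrow> v j = 0"
  shows "delta1 (comb v) = vec dim_E v"
proof -
  have "expansion (comb v) 1 (\<lambda>i j. if i = 0 then v j else 0)"
    by (rule expansion_comb) (use assms in auto)
  from delta1_expansion[OF this] show ?thesis by simp
qed

lemma delta1_0: "delta1 (\<lambda>k. 0) = 0\<^sub>v dim_E"
  using delta1_comb[of "\<lambda>_. 0"] by (simp add: comb_0 zero_vec_def)

lemma delta1_sum_nth:
  assumes "\<And>a. a \<in> S \<Longrightarrow> m a \<in> motive" "j < dim_E"
  shows "delta1 (\<lambda>k. \<Sum>a\<in>S. m a k) $ j = (\<Sum>a\<in>S. delta1 (m a) $ j)"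
  using assms(1)
proof (induction S rule: infinite_finite_induct)
  case (insert x F)
  have "delta1 (\<lambda>k. m x k + (\<Sum>a\<in>F. m a k)) = delta1 (m x) + delta1 (\<lambda>k. \<Sum>a\<in>F. m a k)"
    using insert by (intro delta1_add motive_sum) auto
  then show ?case using insert assms(2) by simp
qed (simp_all add: delta1_0 assms(2))

section \<open>The \<open>t\<close>-module\<close>

definition ecf :: "(nat \<Rightarrow> 'c poly) \<Rightarrow> nat \<Rightarrow> nat \<Rightarrow> 'c" where
  "ecf m = (SOME e. \<exists>n. expansion m n e)"

lemma ecf: assumes "m \<in> motive" obtains n where "expansion m n (ecf m)"
proof -
  obtain n e where "expansion m n e" by (rule expansion_exists[OF assms])
  then have "\<exists>e n. expansion m n e" by blast
  then have "\<exists>n. expansion m n (ecf m)" unfolding ecf_def by (rule someI_ex)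
  then show thesis using that by blast
qed

definition wa :: "'f poly \<Rightarrow> nat \<Rightarrow> nat \<Rightarrow> 'c poly" where "wa a j = (\<lambda>l. poly_t a * (w ! j) l)"

lemma wa_motive: "j < dim_E \<Longrightarrow> wa a j \<in> motive"
  unfolding wa_def by (intro motive_mult Kpoly_poly_t motive_w)

text \<open>Column \<open>j\<close> consists of the expansion coefficients of \<open>a(t)\<close>
  times \<open>w ! j\<close>; stored as q-power images, they are already the entries multiplying the
  n-th twist.\<close>

definition Em :: "'f poly \<Rightarrow> nat \<Rightarrow> 'c mat" where
  "Em a n = mat dim_E dim_E (\<lambda>(k, j). ecf (wa a j) n k)"

lemma Em_bound: obtains n where "\<And>j. j < dim_E \<Longrightarrow> expansion (wa a j) n (ecf (wa a j))"
proof -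
  have "\<exists>n. expansion (wa a j) n (ecf (wa a j))" if "j < dim_E" for j
    using ecf[OF wa_motive[OF that, of a]] by blast
  then obtain f where f: "\<And>j. j < dim_E \<Longrightarrow> expansion (wa a j) (f j) (ecf (wa a j))" by metis
  have "f j \<le> (\<Sum>j<dim_E. f j)" if "j < dim_E" for j using that by (intro member_le_sum) auto
  then show thesis using that f expansion_mono by blast
qed

lemma Em_carrier [simp]: "Em a n \<in> carrier_mat dim_E dim_E" by (simp add: Em_def)

lemma tau_apply_nth:
  assumes "\<And>k. E k \<in> carrier_mat dim_E dim_E" "\<And>k. n \<le> k \<Longrightarrow> E k = 0\<^sub>m dim_E dim_E"
    "dim_vec u = dim_E" "j < dim_E"
  shows "tau_apply E u $ j = (\<Sum>k<n. \<Sum>i<dim_E. E k $$ (j, i) * fr k (u $ i))"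
proof -
  have e: "(E k *\<^sub>v map_vec (frob (int k)) u) $ j = (\<Sum>i<dim_E. E k $$ (j, i) * fr k (u $ i))" for k
    using assms(1)[of k] assms(3,4)
    by (auto simp: scalar_prod_def frob_of_nat atLeast0LessThan intro!: sum.cong)
  have sub: "{k. E k \<noteq> 0\<^sub>m dim_E dim_E} \<subseteq> {..<n}" using assms(2) by (force simp: not_le[symmetric])
  have "tau_apply E u $ j = (\<Sum>k | E k \<noteq> 0\<^sub>m dim_E dim_E. \<Sum>i<dim_E. E k $$ (j, i) * fr k (u $ i))"
    using assms(4) by (simp add: tau_apply_def e)
  also have "\<dots> = (\<Sum>k<n. \<Sum>i<dim_E. E k $$ (j, i) * fr k (u $ i))"
    by (rule sum.mono_neutral_left) (use sub assms(4) in auto)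
  finally show ?thesis .
qed

text \<open>Modulo \<open>(\<sigma> - 1)M\<close>, which is stable under \<open>a(t)\<close> and killed by \<open>\<delta>\<^sub>1\<close>, every \<open>m\<close> is congruent
  to a combination of the \<open>w\<^sub>j\<close>.\<close>
lemma delta1_poly_t:
  assumes "m \<in> motive"
  shows "delta1 (\<lambda>l. poly_t a * m l) = delta1 (\<lambda>l. poly_t a * comb (\<lambda>j. if j < dim_E then delta1 m $ j else 0) l)"
    (is "_ = delta1 (\<lambda>l. _ * comb ?v l)")
proof -
  obtain n e where e: "expansion m n e" by (rule expansion_exists[OF assms])
  have K: "\<And>i j. e i j \<in> Kbar" and z: "\<And>i j. dim_E \<le> j \<Longrightarrow> e i j = 0"
    and m: "m = (\<lambda>k. \<Sum>i<n. (sigma ^^ i) (comb (e i)) k)" using e unfolding expansion_def by blast+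
  have v: "?v = (\<lambda>j. \<Sum>i<n. e i j)"
    unfolding delta1_expansion[OF e] by (auto simp: z)
  have cm: "comb (e i) \<in> motive" for i by (rule comb_motive[OF K])
  have am: "(\<lambda>l. poly_t a * comb (e i) l) \<in> motive" for i by (intro motive_mult Kpoly_poly_t cm)
  have 1: "(\<lambda>l. poly_t a * m l) = (\<lambda>l. \<Sum>i<n. (sigma ^^ i) (\<lambda>l. poly_t a * comb (e i) l) l)"
    by (simp only: m sum_distrib_left sigma_pow_poly_t[OF cm])
  have 2: "(\<lambda>l. poly_t a * comb ?v l) = (\<lambda>l. \<Sum>i<n. poly_t a * comb (e i) l)"
    by (simp only: v comb_sum sum_distrib_left)
  show ?thesis
  proof (rule eq_vecI)
    fix j assume "j < dim_vec (delta1 (\<lambda>l. poly_t a * comb ?v l))"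
    then have j: "j < dim_E" by simp
    show "delta1 (\<lambda>l. poly_t a * m l) $ j = delta1 (\<lambda>l. poly_t a * comb ?v l) $ j"
      unfolding 1 2 using j am
      by (subst (1 2) delta1_sum_nth) (simp_all add: sigma_pow_motive delta1_sigma_pow)
  qed simp
qed

lemma tau_apply_Em:
  assumes "m \<in> motive"
  shows "tau_apply (Em a) (delta1 m) = delta1 (\<lambda>l. poly_t a * m l)"
proof (rule eq_vecI)
  let ?v = "\<lambda>j. if j < dim_E then delta1 m $ j else 0"
  fix k assume "k < dim_vec (delta1 (\<lambda>l. poly_t a * m l))"
  then have k: "k < dim_E" by simp
  obtain n where n: "\<And>j. j < dim_E \<Longrightarrow> expansion (wa a j) n (ecf (wa a j))" using Em_bound[of a] by blast
  have E0: "Em a i = 0\<^sub>m dim_E dim_E" if "n \<le> i" for i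
    by (rule eq_matI) (use n that in \<open>auto simp: Em_def expansion_def\<close>)
  have K: "?v j \<in> Kbar" for j using delta1_Kbar[OF assms] by simp
  have 1: "(\<lambda>l. poly_t a * comb ?v l) = (\<lambda>l. \<Sum>j<dim_E. [:?v j:] * wa a j l)"
    by (simp add: comb_def wa_def sum_distrib_left mult.left_commute del: mult_pCons_left)
  have "delta1 (\<lambda>l. poly_t a * m l) $ k = (\<Sum>j<dim_E. delta1 (\<lambda>l. [:?v j:] * wa a j l) $ k)"
    unfolding delta1_poly_t[OF assms] 1
    using k by (intro delta1_sum_nth motive_mult Kpoly_const wa_motive K) auto
  also have "\<dots> = (\<Sum>j<dim_E. \<Sum>i<n. fr i (?v j) * ecf (wa a j) i k)"
  proof (rule sum.cong[OF refl])
    fix j assume "j \<in> {..<dim_E}"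
    then have "expansion (\<lambda>l. [:?v j:] * wa a j l) n (\<lambda>i k. fr i (?v j) * ecf (wa a j) i k)"
      using n by (intro expansion_cmult K) auto
    then show "delta1 (\<lambda>l. [:?v j:] * wa a j l) $ k = (\<Sum>i<n. fr i (?v j) * ecf (wa a j) i k)"
      using k by (subst delta1_expansion) auto
  qed
  also have "\<dots> = (\<Sum>i<n. \<Sum>j<dim_E. Em a i $$ (k, j) * fr i (delta1 m $ j))"
    using k by (subst sum.swap) (auto simp: Em_def mult.commute intro!: sum.cong)
  also have "\<dots> = tau_apply (Em a) (delta1 m) $ k"
    using k E0 by (intro tau_apply_nth[symmetric]) auto
  finally show "tau_apply (Em a) (delta1 m) $ k = delta1 (\<lambda>l. poly_t a * m l) $ k" by simp
qed (simp add: tau_apply_def)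

text \<open>The exponents \<open>q ^ k\<close> are distinct, so the sum is an ordinary polynomial
  with these coefficients, and it has infinitely many roots. This separates the matrices of a
  t-module by their action on points.\<close>

lemma additive_poly_zero:
  assumes "\<And>x. x \<in> Kbar \<Longrightarrow> (\<Sum>k<n. c k * fr k x) = 0" "k < n"
  shows "c k = 0"
proof -
  define p where "p = (\<Sum>k<n. monom (c k) (q ^ k))"
  have "poly p x = 0" if "x \<in> Kbar" for x
    using assms(1)[OF that] by (simp add: p_def poly_sum poly_monom fr_def)
  then have "Kbar \<subseteq> {x. poly p x = 0}" by blast
  then have "p = 0" using poly_roots_finite[of p] infinite_Kbar finite_subset by blast
  then have "coeff p (q ^ k) = 0" by simp
  moreover have "q ^ i = q ^ k \<longleftrightarrow> i = k" for i using q_ge_2 by (simp add: power_inject_exp)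
  ultimately show ?thesis using assms(2) by (simp add: p_def coeff_sum)
qed

lemma t_module_eq: "t_module a = Em a"
  unfolding t_module_def
proof (rule the_equality)
  obtain n where n: "\<And>j. j < dim_E \<Longrightarrow> expansion (wa a j) n (ecf (wa a j))" using Em_bound[of a] by blast
  have E0: "Em a i = 0\<^sub>m dim_E dim_E" if "n \<le> i" for i
    by (rule eq_matI) (use n that in \<open>auto simp: Em_def expansion_def\<close>)
  show "(\<forall>k. Em a k \<in> carrier_mat dim_E dim_E \<and> elements_mat (Em a k) \<subseteq> Kbar) \<and>
     finite {k. Em a k \<noteq> 0\<^sub>m dim_E dim_E} \<and>
     (\<forall>m\<in>motive. tau_apply (Em a) (delta1 m) = delta1 (\<lambda>l. poly_t a * m l))"
  proof (intro conjI allI ballI tau_apply_Em)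
    show "elements_mat (Em a k) \<subseteq> Kbar" for k
      using n by (auto simp: elements_mat_def Em_def expansion_def)
    show "finite {k. Em a k \<noteq> 0\<^sub>m dim_E dim_E}"
      by (rule finite_subset[of _ "{..<n}"]) (use E0 in \<open>force simp: not_le[symmetric]\<close>)+
  qed simp_all
  fix E assume "(\<forall>k. E k \<in> carrier_mat dim_E dim_E \<and> elements_mat (E k) \<subseteq> Kbar) \<and>
     finite {k. E k \<noteq> 0\<^sub>m dim_E dim_E} \<and>
     (\<forall>m\<in>motive. tau_apply E (delta1 m) = delta1 (\<lambda>l. poly_t a * m l))"
  then have E: "\<And>k. E k \<in> carrier_mat dim_E dim_E" "finite {k. E k \<noteq> 0\<^sub>m dim_E dim_E}"
    "\<And>m. m \<in> motive \<Longrightarrow> tau_apply E (delta1 m) = tau_apply (Em a) (delta1 m)"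
    using tau_apply_Em by auto
  obtain n' where n': "{k. E k \<noteq> 0\<^sub>m dim_E dim_E} \<subseteq> {..<n'}"
    using E(2) unfolding finite_nat_iff_bounded by blast
  define b where "b = n + n'"
  have E0': "E k = 0\<^sub>m dim_E dim_E" if "n' \<le> k" for k
    using n' that by (metis (mono_tags, lifting) lessThan_iff mem_Collect_eq not_le subsetD)
  have z: "E k = 0\<^sub>m dim_E dim_E" "Em a k = 0\<^sub>m dim_E dim_E" if "b \<le> k" for k
    using E0' E0 that by (auto simp: b_def)
  show "E = Em a"
  proof
    fix k
    show "E k = Em a k"
    proof (rule eq_matI)
      fix i j assume "i < dim_row (Em a k)" "j < dim_col (Em a k)"
      then have ij: "i < dim_E" "j < dim_E" by (auto simp: Em_def)
      show "E k $$ (i, j) = Em a k $$ (i, j)"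
      proof (cases "k < b")
        case True
        have "E k $$ (i, j) - Em a k $$ (i, j) = 0"
        proof (rule additive_poly_zero[OF _ True])
          fix x assume x: "x \<in> Kbar"
          \<comment> \<open>A point with the single entry \<open>x\<close> at position
            \<open>j\<close> isolates column \<open>j\<close>; as \<open>x\<close> runs through
            \<open>Kbar\<close>, the coefficients are determined.\<close>
          let ?v = "\<lambda>l. if l = j then x else 0"
          have cm: "comb ?v \<in> motive" by (rule comb_motive) (use x in auto)
          have d: "delta1 (comb ?v) = vec dim_E ?v" by (rule delta1_comb) (use x ij in auto)
          have val: "tau_apply F (delta1 (comb ?v)) $ i = (\<Sum>k<b. F k $$ (i, j) * fr k x)"
            if "\<And>k. F k \<in> carrier_mat dim_E dim_E" "\<And>k. b \<le> k \<Longrightarrow> F k = 0\<^sub>m dim_E dim_E" for F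
          proof -
            have "tau_apply F (delta1 (comb ?v)) $ i
                = (\<Sum>k<b. \<Sum>l<dim_E. F k $$ (i, l) * fr k (vec dim_E ?v $ l))"
              unfolding d using that ij by (intro tau_apply_nth) auto
            also have "\<dots> = (\<Sum>k<b. \<Sum>l<dim_E. if l = j then F k $$ (i, j) * fr k x else 0)"
              by (intro sum.cong) auto
            finally show ?thesis using ij by simp
          qed
          show "(\<Sum>k<b. (E k $$ (i, j) - Em a k $$ (i, j)) * fr k x) = 0"
            using val[of E] val[of "Em a"] E(1) E(3)[OF cm] z by (simp add: left_diff_distrib sum_subtractf)
        qed
        then show ?thesis by simp
      qed (use z in simp)
    qed (use E(1)[of k] in \<open>auto simp: Em_def\<close>)
  qed
qed

section \<open>Twisted power series of matrices\<close>

definition mseq :: "(nat \<Rightarrow> 'c mat) \<Rightarrow> bool" where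
  "mseq U \<longleftrightarrow> (\<forall>i. U i \<in> carrier_mat dim_E dim_E)"

abbreviation tau_one :: "nat \<Rightarrow> 'c mat" where "tau_one \<equiv> tau_const (1\<^sub>m dim_E)"

lemma mseqD: assumes "mseq U" shows "dim_row (U i) = dim_E" "dim_col (U i) = dim_E"
  using assms carrier_matD by (auto simp: mseq_def)

lemma mseq_eqI:
  assumes "mseq U" "mseq B" "\<And>n i j. i < dim_E \<Longrightarrow> j < dim_E \<Longrightarrow> U n $$ (i, j) = B n $$ (i, j)"
  shows "U = B"
proof (intro ext eq_matI)
  show "dim_row (U n) = dim_row (B n)" "dim_col (U n) = dim_col (B n)" for n
    using assms(1,2) by (simp_all add: mseqD)
  show "U n $$ (i, j) = B n $$ (i, j)" if "i < dim_row (B n)" "j < dim_col (B n)" for n i j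
    using that assms(2,3) by (simp add: mseqD)
qed

lemma mseq_tau_mult [simp]: "mseq (tau_mult U B)" by (simp add: mseq_def tau_mult_def)
lemma mseq_tau_const [simp]: "M \<in> carrier_mat dim_E dim_E \<Longrightarrow> mseq (tau_const M)"
  by (simp add: mseq_def tau_const_def)
lemma mseq_Em [simp]: "mseq (Em a)" by (simp add: mseq_def)

lemma tau_mult_entry:
  assumes "mseq U" "mseq B" "i < dim_E" "j < dim_E"
  shows "tau_mult U B n $$ (i, j) = (\<Sum>k\<le>n. \<Sum>h<dim_E. U k $$ (i, h) * fr k (B (n - k) $$ (h, j)))"
proof -
  have "(U k * map_mat (frob (int k)) (B (n - k))) $$ (i, j)
      = (\<Sum>h<dim_E. U k $$ (i, h) * fr k (B (n - k) $$ (h, j)))" for k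
    using assms unfolding mseq_def
    by (auto simp: scalar_prod_def frob_of_nat atLeast0LessThan carrier_matD[of "U k" dim_E dim_E]
        carrier_matD[of "B (n - k)" dim_E dim_E] intro!: sum.cong)
  then show ?thesis using assms by (simp add: tau_mult_def)
qed

text \<open>Both sides are triple convolutions of the same \<open>F\<close>, whose last factor
  carries the total twist \<open>m + b\<close>. The reindexing is that of power series
  multiplication.\<close>

lemma tau_mult_assoc:
  assumes "mseq U" "mseq B" "mseq C"
  shows "tau_mult (tau_mult U B) C = tau_mult U (tau_mult B C)"
proof (rule mseq_eqI)
  fix n i j assume ij: "i < dim_E" "j < dim_E"
  define F where "F m b c = (\<Sum>g<dim_E. \<Sum>h<dim_E. U m $$ (i, g) * fr m (B b $$ (g, h)) * fr (m + b) (C c $$ (h, j)))"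
    for m b c
  have "tau_mult (tau_mult U B) C n $$ (i, j)
      = (\<Sum>k=0..n. \<Sum>m=0..k. F m (k - m) (n - k))"
  proof -
    have "(\<Sum>h<dim_E. tau_mult U B k $$ (i, h) * fr k (C (n - k) $$ (h, j))) = (\<Sum>m=0..k. F m (k - m) (n - k))" for k
    proof -
      have "(\<Sum>h<dim_E. tau_mult U B k $$ (i, h) * fr k (C (n - k) $$ (h, j)))
        = (\<Sum>h<dim_E. \<Sum>m\<le>k. \<Sum>g<dim_E. U m $$ (i, g) * fr m (B (k - m) $$ (g, h)) * fr k (C (n - k) $$ (h, j)))"
        using assms ij by (simp add: tau_mult_entry sum_distrib_right)
      also have "\<dots> = (\<Sum>m\<le>k. \<Sum>h<dim_E. \<Sum>g<dim_E. U m $$ (i, g) * fr m (B (k - m) $$ (g, h)) * fr k (C (n - k) $$ (h, j)))"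
        by (rule sum.swap)
      also have "\<dots> = (\<Sum>m\<le>k. F m (k - m) (n - k))"
        unfolding F_def by (rule sum.cong[OF refl], subst sum.swap) auto
      finally show ?thesis by (simp add: atMost_atLeast0)
    qed
    then show ?thesis using assms ij by (simp add: tau_mult_entry[of "tau_mult U B"] atMost_atLeast0)
  qed
  also have "\<dots> = (\<Sum>m=0..n. \<Sum>b=0..n - m. F m b (n - m - b))"
    by (rule fps_mult_assoc_lemma)
  also have "\<dots> = tau_mult U (tau_mult B C) n $$ (i, j)"
  proof -
    have "(\<Sum>g<dim_E. U m $$ (i, g) * fr m (tau_mult B C (n - m) $$ (g, j))) = (\<Sum>b=0..n - m. F m b (n - m - b))" for m
    proof -
      have "(\<Sum>g<dim_E. U m $$ (i, g) * fr m (tau_mult B C (n - m) $$ (g, j)))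
        = (\<Sum>g<dim_E. \<Sum>b\<le>n - m. \<Sum>h<dim_E. U m $$ (i, g) * fr m (B b $$ (g, h)) * fr (m + b) (C (n - m - b) $$ (h, j)))"
        using assms ij by (simp add: tau_mult_entry fr_sum fr_mult fr_fr sum_distrib_left mult.assoc)
      also have "\<dots> = (\<Sum>b\<le>n - m. F m b (n - m - b))"
        unfolding F_def by (rule sum.swap)
      finally show ?thesis by (simp add: atMost_atLeast0)
    qed
    then show ?thesis using assms ij by (simp add: tau_mult_entry[of U "tau_mult B C"] atMost_atLeast0)
  qed
  finally show "tau_mult (tau_mult U B) C n $$ (i, j) = tau_mult U (tau_mult B C) n $$ (i, j)" .
qed simp_all

lemma tau_const_mult_entry:
  assumes "M \<in> carrier_mat dim_E dim_E" "mseq B" "i < dim_E" "j < dim_E"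
  shows "tau_mult (tau_const M) B n $$ (i, j) = (\<Sum>h<dim_E. M $$ (i, h) * B n $$ (h, j))"
proof -
  have "tau_mult (tau_const M) B n $$ (i, j)
      = (\<Sum>k\<le>n. if k = 0 then \<Sum>h<dim_E. M $$ (i, h) * B n $$ (h, j) else 0)"
    unfolding tau_mult_entry[OF mseq_tau_const[OF assms(1)] assms(2-4)]
    by (rule sum.cong) (use assms in \<open>auto simp: tau_const_def\<close>)
  then show ?thesis by simp
qed

lemma mult_tau_const_entry:
  assumes "M \<in> carrier_mat dim_E dim_E" "mseq B" "i < dim_E" "j < dim_E"
  shows "tau_mult B (tau_const M) n $$ (i, j) = (\<Sum>h<dim_E. B n $$ (i, h) * fr n (M $$ (h, j)))"
proof -
  have "tau_mult B (tau_const M) n $$ (i, j)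
      = (\<Sum>k\<le>n. if k = n then \<Sum>h<dim_E. B n $$ (i, h) * fr n (M $$ (h, j)) else 0)"
    unfolding tau_mult_entry[OF assms(2) mseq_tau_const[OF assms(1)] assms(3,4)]
    by (rule sum.cong) (use assms in \<open>auto simp: tau_const_def\<close>)
  then show ?thesis by simp
qed

lemma tau_one_mult: assumes "mseq U" shows "tau_mult tau_one U = U"
proof (rule mseq_eqI)
  fix n i j assume ij: "i < dim_E" "j < dim_E"
  have "tau_mult tau_one U n $$ (i, j) = (\<Sum>h<dim_E. if h = i then U n $$ (i, j) else 0)"
    unfolding tau_const_mult_entry[OF one_carrier_mat assms ij] by (rule sum.cong) (use ij in auto)
  then show "tau_mult tau_one U n $$ (i, j) = U n $$ (i, j)" using ij by simp
qed (use assms in auto)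

lemma mult_tau_one: assumes "mseq U" shows "tau_mult U tau_one = U"
proof (rule mseq_eqI)
  fix n i j assume ij: "i < dim_E" "j < dim_E"
  have "tau_mult U tau_one n $$ (i, j) = (\<Sum>h<dim_E. if h = j then U n $$ (i, j) else 0)"
    unfolding mult_tau_const_entry[OF one_carrier_mat assms ij] by (rule sum.cong) (use ij in auto)
  then show "tau_mult U tau_one n $$ (i, j) = U n $$ (i, j)" using ij by simp
qed (use assms in auto)

text \<open>The n-th coefficient equation of \<open>U V = 1\<close>, solved for the n-th coefficient
  of \<open>V\<close> when the constant term of \<open>U\<close> is the identity.\<close>

fun rinv :: "(nat \<Rightarrow> 'c mat) \<Rightarrow> nat \<Rightarrow> nat \<Rightarrow> nat \<Rightarrow> 'c" where
  "rinv U n i j = (if n = 0 then (if i = j then 1 else 0)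
     else - (\<Sum>k<n. \<Sum>h<dim_E. U (n - k) $$ (i, h) * fr (n - k) (rinv U k h j)))"

declare rinv.simps [simp del]

lemma right_inverse_exists:
  assumes "mseq U" "U 0 = 1\<^sub>m dim_E"
  obtains V where "mseq V" "V 0 = 1\<^sub>m dim_E" "tau_mult U V = tau_one"
proof -
  define V where "V n = mat dim_E dim_E (\<lambda>(i, j). rinv U n i j)" for n
  have V: "mseq V" by (simp add: mseq_def V_def)
  have X0: "V 0 = 1\<^sub>m dim_E" by (rule eq_matI) (auto simp: V_def rinv.simps)
  have "tau_mult U V = tau_one"
  proof (rule mseq_eqI)
    fix n i j assume ij: "i < dim_E" "j < dim_E"
    have "tau_mult U V n $$ (i, j) = (\<Sum>k\<le>n. \<Sum>h<dim_E. U (n - k) $$ (i, h) * fr (n - k) (V k $$ (h, j)))"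
      unfolding tau_mult_entry[OF assms(1) V ij]
      by (rule sum.reindex_bij_witness[of _ "\<lambda>k. n - k" "\<lambda>k. n - k"]) auto
    also have "\<dots> = (\<Sum>k<n. \<Sum>h<dim_E. U (n - k) $$ (i, h) * fr (n - k) (V k $$ (h, j)))
        + (\<Sum>h<dim_E. U 0 $$ (i, h) * V n $$ (h, j))"
      by (simp add: lessThan_Suc_atMost[symmetric])
    also have "(\<Sum>h<dim_E. U 0 $$ (i, h) * V n $$ (h, j)) = (\<Sum>h<dim_E. if h = i then rinv U n i j else 0)"
      by (rule sum.cong) (use ij in \<open>auto simp: assms(2) V_def\<close>)
    also have "\<dots> = rinv U n i j" using ij by simp
    also have "(\<Sum>k<n. \<Sum>h<dim_E. U (n - k) $$ (i, h) * fr (n - k) (V k $$ (h, j)))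
        = (\<Sum>k<n. \<Sum>h<dim_E. U (n - k) $$ (i, h) * fr (n - k) (rinv U k h j))"
      by (intro sum.cong) (use ij in \<open>auto simp: V_def\<close>)
    finally show "tau_mult U V n $$ (i, j) = tau_one n $$ (i, j)"
      using ij rinv.simps[of U n i j] by (auto simp: tau_const_def)
  qed (use V in auto)
  with V X0 show thesis using that by blast
qed

text \<open>The right inverse \<open>V\<close> has itself a right inverse \<open>Y\<close>;
  associativity forces \<open>Y = U\<close>, so \<open>V\<close> is two-sided.\<close>

lemma inverse_exists:
  assumes "mseq U" "U 0 = 1\<^sub>m dim_E"
  obtains V where "mseq V" "V 0 = 1\<^sub>m dim_E" "tau_mult U V = tau_one" "tau_mult V U = tau_one"
proof -
  obtain V where V: "mseq V" "V 0 = 1\<^sub>m dim_E" "tau_mult U V = tau_one"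
    by (rule right_inverse_exists[OF assms])
  obtain Y where Y: "mseq Y" "tau_mult V Y = tau_one"
    by (rule right_inverse_exists[OF V(1,2)])
  have "U = tau_mult U (tau_mult V Y)" by (simp add: Y(2) mult_tau_one assms(1))
  also have "\<dots> = tau_mult (tau_mult U V) Y"
    by (rule tau_mult_assoc[symmetric, OF assms(1) V(1) Y(1)])
  also have "\<dots> = Y" by (simp add: V(3) tau_one_mult Y(1))
  finally have "tau_mult V U = tau_one" using Y(2) by simp
  with V show thesis using that by blast
qed

section \<open>The logarithm\<close>

definition Pm :: "nat \<Rightarrow> 'c mat" where
  "Pm i = mat dim_E dim_E (\<lambda>(k, j). dl0 ((T ^^ i) (N (w ! j))) k)"

lemma mseq_Pm [simp]: "mseq Pm" by (simp add: mseq_def Pm_def)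

lemma Pm_0: "Pm 0 = 1\<^sub>m dim_E"
  by (rule eq_matI) (auto simp: Pm_def dl0_N_w)

lemma bdd_T_pow: "(\<And>l. bdd (g l)) \<Longrightarrow> bdd ((T ^^ i) g l)"
  by (induction i arbitrary: l) (auto intro: bdd_T)

lemma T_pow_add: "(T ^^ i) (\<lambda>l. g l + h l) = (\<lambda>l. (T ^^ i) g l + (T ^^ i) h l)"
  by (induction i) (simp_all add: T_add)

lemma T_pow_0: "(T ^^ i) (\<lambda>l. 0) = (\<lambda>l. 0)"
  by (induction i) (simp_all add: T_0)

lemma T_pow_mult: "(T ^^ i) (\<lambda>l. f * g l) = (\<lambda>l. tw i f * (T ^^ i) g l)"
  by (induction i) (simp_all add: T_mult tw_tw del: One_nat_def, simp)

lemma T_pow_sum: "(T ^^ i) (\<lambda>l. \<Sum>a\<in>S. g a l) = (\<lambda>l. \<Sum>a\<in>S. (T ^^ i) (g a) l)"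
  by (induction S rule: infinite_finite_induct) (simp_all add: T_pow_0 T_pow_add)

lemma T_pow_N_sigma_pow:
  assumes "m \<in> motive"
  shows "(T ^^ i) (N ((sigma ^^ n) m)) = (if n \<le> i then (T ^^ (i - n)) (N m) else N ((sigma ^^ (n - i)) m))"
proof (induction n arbitrary: i)
  case (Suc n)
  show ?case
  proof (cases i)
    case (Suc i')
    have "(T ^^ Suc i') (N ((sigma ^^ Suc n) m)) = (T ^^ i') (T (N (sigma ((sigma ^^ n) m))))"
      by (simp add: funpow_Suc_right del: funpow.simps(2)) (simp add: funpow_swap1)
    also have "\<dots> = (T ^^ i') (N ((sigma ^^ n) m))" using assms by (simp add: T_N_sigma sigma_pow_motive)
    finally show ?thesis using Suc.IH[of i'] Suc by (simp del: funpow.simps(2))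
  qed simp
qed simp

lemma dl0_T_pow_comb:
  assumes "k < dim_E"
  shows "dl0 ((T ^^ i) (N (comb v))) k = (\<Sum>j<dim_E. Pm i $$ (k, j) * fr i (v j))"
proof -
  have "(T ^^ i) (N (comb v)) = (\<lambda>l. \<Sum>j<dim_E. fps_const (fr i (v j)) * (T ^^ i) (N (w ! j)) l)"
    by (simp only: N_comb T_pow_sum T_pow_mult tw_const)
  then have "dl0 ((T ^^ i) (N (comb v))) k
      = (\<Sum>j<dim_E. dl0 (\<lambda>l. fps_const (fr i (v j)) * (T ^^ i) (N (w ! j)) l) k)"
    by (simp only:) (rule dl0_sum, intro bdd_mult bdd_const bdd_T_pow bdd_N)
  then show ?thesis using assms by (simp add: dl0_cmult bdd_T_pow bdd_N Pm_def mult.commute)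
qed

text \<open>In \<open>T ^^ i\<close> applied to the expansion, summands with more than
  \<open>i\<close> factors \<open>sigma\<close> keep one and are killed by \<open>dl0\<close>; the
  others give columns of \<open>Pm\<close>. The result is the i-th coefficient of the product of
  \<open>Pm\<close> with the expansion coefficients.\<close>

lemma dl0_T_pow_expansion:
  assumes "expansion m n e" "k < dim_E"
  shows "dl0 ((T ^^ i) (N m)) k = (\<Sum>a\<le>i. \<Sum>j<dim_E. Pm a $$ (k, j) * fr a (e (i - a) j))"
proof -
  have K: "\<And>i j. e i j \<in> Kbar" and z: "\<And>i j. n \<le> i \<Longrightarrow> e i j = 0"
    and m: "m = (\<lambda>k. \<Sum>i<n. (sigma ^^ i) (comb (e i)) k)" using assms(1) unfolding expansion_def by blast+
  have cm: "comb (e a) \<in> motive" for a by (rule comb_motive[OF K])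
  have Nm: "N m = (\<lambda>l. \<Sum>a<n. N ((sigma ^^ a) (comb (e a))) l)"
    by (simp add: m N_def fps_of_poly_sum sum_distrib_left fun_eq_iff)
  let ?f = "\<lambda>a. \<Sum>j<dim_E. Pm (i - a) $$ (k, j) * fr (i - a) (e a j)"
  have t: "dl0 ((T ^^ i) (N ((sigma ^^ a) (comb (e a))))) k = (if a \<le> i then ?f a else 0)" for a
  proof (cases "a \<le> i")
    case True
    then show ?thesis using assms(2) by (simp add: T_pow_N_sigma_pow[OF cm] dl0_T_pow_comb)
  next
    case False
    then obtain b where b: "a - i = Suc b" by (metis diff_is_0_eq not0_implies_Suc)
    have "dl0 (N ((sigma ^^ (a - i)) (comb (e a)))) k = 0"
      unfolding b using assms(2) cm by (simp add: dl0_N_sigma sigma_pow_motive)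
    then show ?thesis using False by (simp add: T_pow_N_sigma_pow[OF cm])
  qed
  have "dl0 ((T ^^ i) (N m)) k = (\<Sum>a<n. if a \<le> i then ?f a else 0)"
    unfolding Nm T_pow_sum t[symmetric] by (rule dl0_sum) (intro bdd_T_pow bdd_N)
  also have "\<dots> = (\<Sum>a\<in>{..<n} \<inter> {a. a \<le> i}. ?f a)" by (simp add: sum.If_cases)
  also have "\<dots> = (\<Sum>a\<le>i. ?f a)"
  proof (rule sum.mono_neutral_left)
    show "\<forall>a\<in>{..i} - {..<n} \<inter> {a. a \<le> i}. ?f a = 0"
    proof
      fix a assume "a \<in> {..i} - {..<n} \<inter> {a. a \<le> i}"
      then have "n \<le> a" by auto
      then show "?f a = 0" by (simp add: z)
    qed
  qed auto
  also have "\<dots> = (\<Sum>a\<le>i. \<Sum>j<dim_E. Pm a $$ (k, j) * fr a (e (i - a) j))"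
    by (rule sum.reindex_bij_witness[of _ "\<lambda>a. i - a" "\<lambda>a. i - a"]) auto
  finally show ?thesis .
qed

lemma Em_0_entry:
  assumes "k < dim_E" "j < dim_E" shows "Em a 0 $$ (k, j) = dl0 (N (wa a j)) k"
proof -
  obtain n where "expansion (wa a j) n (ecf (wa a j))" by (rule ecf[OF wa_motive[OF assms(2)]])
  from dl0_T_pow_expansion[OF this assms(1), of 0]
  have "dl0 (N (wa a j)) k = (\<Sum>i<dim_E. Pm 0 $$ (k, i) * ecf (wa a j) 0 i)" by simp
  also have "\<dots> = (\<Sum>i<dim_E. if i = k then ecf (wa a j) 0 k else 0)"
    by (rule sum.cong) (use assms(1) in \<open>auto simp: Pm_0\<close>)
  finally show ?thesis using assms by (simp add: Em_def)
qed

text \<open>Only Taylor coefficients of order below \<open>\<d> l\<close> matter, because a multiple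
  of \<open>lin \<theta> ^ \<d> l\<close> remains one after multiplication by \<open>a(t)\<close>.
  Hence \<open>Em a 0\<close>, defined from the \<open>w ! j\<close>, describes this multiplication
  on all bounded power series.\<close>

lemma dl0_poly_t:
  assumes "\<And>l. bdd (g l)" "k < dim_E"
  shows "dl0 (\<lambda>l. fps_of_poly (poly_t a) * g l) k = (\<Sum>j<dim_E. Em a 0 $$ (k, j) * dl0 g j)"
proof -
  let ?p = "fps_of_poly (poly_t a)" and ?l = "ixl k" and ?x = "ixe k"
  define G where "G l = g l * iOm ^ \<d> l" for l
  have bG: "bdd (G l)" for l by (simp add: G_def assms(1) bdd_iOm_mult)
  let ?H = "(dq \<theta> ^^ \<d> ?l) (G ?l)"
  have lk: "?l \<in> {1..r}" "?x < \<d> ?l" using ix_nth[OF assms(2)] by auto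
  have "?p * G ?l = (\<Sum>e<\<d> ?l. fps_const (D e (G ?l)) * (?p * lin \<theta> ^ e)) + lin \<theta> ^ \<d> ?l * (?p * ?H)"
    by (subst D_expand[OF bG, of ?l "\<d> ?l"]) (simp add: distrib_left sum_distrib_left ac_simps)
  moreover have "D ?x (\<dots>) = (\<Sum>e<\<d> ?l. D e (G ?l) * D ?x (?p * lin \<theta> ^ e)) + 0"
    using lk by (simp add: D_add D_sum D_cmult D_lin_pow_mult bdd_sum bdd_mult bdd_power bdd_dq_pow bG)
  ultimately have 1: "D ?x (?p * G ?l) = (\<Sum>e<\<d> ?l. D e (G ?l) * D ?x (?p * lin \<theta> ^ e))" by simp
  have "(\<Sum>j<dim_E. Em a 0 $$ (k, j) * dl0 g j)
      = (\<Sum>j<dim_E. if ?l = ixl j then D ?x (?p * lin \<theta> ^ ixe j) * D (ixe j) (G (ixl j)) else 0)"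
    by (rule sum.cong) (use assms(2) in \<open>auto simp: Em_0_entry dl0_N wa_def w_nth fps_of_poly_mult
          fps_of_poly_power fps_of_poly_t_theta dl0_def[of g] G_def\<close>)
  also have "\<dots> = (\<Sum>l=1..r. \<Sum>e<\<d> l. if ?l = l then D ?x (?p * lin \<theta> ^ e) * D e (G l) else 0)"
    by (rule sum_ix)
  also have "\<dots> = (\<Sum>l=1..r. if ?l = l then \<Sum>e<\<d> ?l. D e (G ?l) * D ?x (?p * lin \<theta> ^ e) else 0)"
    by (rule sum.cong) (auto simp: mult.commute)
  also have "\<dots> = D ?x (?p * G ?l)" using lk 1 by simp
  finally show ?thesis by (simp add: dl0_def[of "\<lambda>l. _ * g l"] G_def mult.assoc)
qed

text \<open>Both sides compute \<open>dl0\<close> of \<open>T ^^ n\<close> on \<open>a(t)\<close>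
  times \<open>w ! b\<close>: once by expanding the product, once by pulling out
  \<open>a(t)\<close>, which twisting fixes.\<close>

lemma Pm_intertwine: "tau_mult Pm (Em a) = tau_mult (tau_const (Em a 0)) Pm"
proof (rule mseq_eqI)
  fix n k b assume kb: "k < dim_E" "b < dim_E"
  obtain c where c: "expansion (wa a b) c (ecf (wa a b))" by (rule ecf[OF wa_motive[OF kb(2)]])
  have "tau_mult Pm (Em a) n $$ (k, b) = (\<Sum>i\<le>n. \<Sum>h<dim_E. Pm i $$ (k, h) * fr i (ecf (wa a b) (n - i) h))"
    using kb by (simp add: tau_mult_entry Em_def)
  also have "\<dots> = dl0 ((T ^^ n) (N (wa a b))) k"
    by (rule dl0_T_pow_expansion[OF c kb(1), symmetric])
  also have "(T ^^ n) (N (wa a b)) = (\<lambda>l. fps_of_poly (poly_t a) * (T ^^ n) (N (w ! b)) l)"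
    by (simp only: wa_def N_mult T_pow_mult tw_poly_t)
  also have "dl0 \<dots> k = (\<Sum>j<dim_E. Em a 0 $$ (k, j) * dl0 ((T ^^ n) (N (w ! b))) j)"
    by (intro dl0_poly_t bdd_T_pow bdd_N kb)
  also have "\<dots> = tau_mult (tau_const (Em a 0)) Pm n $$ (k, b)"
    using kb by (subst tau_const_mult_entry) (auto simp: Pm_def)
  finally show "tau_mult Pm (Em a) n $$ (k, b) = tau_mult (tau_const (Em a 0)) Pm n $$ (k, b)" .
qed simp_all

text \<open>For \<open>q\<^sup>N\<close> large, \<open>t\<^bsup>q^N\<^esup> - \<theta>\<^bsup>q^N\<^esup> = (t - \<theta>)\<^bsup>q^N\<^esup>\<close> is killed by \<open>\<delta>\<^sub>0\<close>, so \<open>d[\<theta>\<^bsup>q^N\<^esup>]\<close> is scalar.\<close>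
lemma Em_scalar:
  assumes "i < dim_E" "j < dim_E"
  shows "Em (monom 1 (q ^ dim_E)) 0 $$ (i, j) = (if i = j then \<theta> ^ (q ^ dim_E) else 0)"
proof -
  let ?M = "q ^ dim_E"
  have lp: "lin \<theta> ^ q ^ M = fps_X ^ q ^ M - fps_const (\<theta> ^ q ^ M)" for M
  proof (induction M)
    case (Suc M)
    have p: "(f - g) ^ q = f ^ q - g ^ q" for f g :: "'c fps"
      using power_add_of_choose_eq_0[of q "f - g" g]
      by (simp add: of_nat_q_choose fps_const_0_eq_0 flip: fps_of_nat)
    have "lin \<theta> ^ q ^ Suc M = (lin \<theta> ^ q ^ M) ^ q" by (simp add: mult.commute flip: power_mult)
    also have "\<dots> = fps_X ^ q ^ Suc M - fps_const (\<theta> ^ q ^ Suc M)"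
      unfolding Suc p by (simp add: fps_const_power mult.commute flip: power_mult)
    finally show ?case .
  qed (simp add: lin_def)
  \<comment> \<open>Each \<open>\<d> l\<close> is a summand of \<open>dim_E\<close>, and
    \<open>n < q ^ n\<close>; so the exponent \<open>q ^ dim_E\<close> exceeds every order that
    \<open>dl0\<close> can see.\<close>
  have "\<d> (ixl i) \<le> dim_E"
    using ix_nth[OF assms(1)] unfolding dim_E_def by (intro member_le_sum) auto
  also have "dim_E < ?M"
    using less_le_trans[OF less_exp power_mono[of 2 q dim_E]] q_ge_2 by simp
  finally have big: "ixe i < ?M" using ix_nth(2)[OF assms(1)] by simp
  let ?g = "N (w ! j)"
  have V: "fps_of_poly (monom 1 ?M) = lin \<theta> ^ ?M + fps_const (\<theta> ^ ?M)"
    by (simp add: lp fps_of_poly_monom')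
  have "N (wa (monom 1 ?M) j) = (\<lambda>l. lin \<theta> ^ ?M * ?g l + fps_const (\<theta> ^ ?M) * ?g l)"
    unfolding wa_def N_mult poly_t_monom V by (simp add: distrib_right)
  then have "dl0 (N (wa (monom 1 ?M) j)) i = dl0 (\<lambda>l. lin \<theta> ^ ?M * ?g l) i + \<theta> ^ ?M * dl0 ?g i"
    by (simp add: dl0_add dl0_cmult bdd_mult bdd_power bdd_N)
  also have "dl0 (\<lambda>l. lin \<theta> ^ ?M * ?g l) i = 0"
    using big by (simp add: dl0_def mult.assoc D_lin_pow_mult bdd_iOm_mult bdd_N)
  finally show ?thesis using assms by (simp add: Em_0_entry dl0_N_w)
qed

text \<open>Commuting with the scalar matrix of \<open>Em_scalar\<close> gives
  \<open>Z n * c ^ (q ^ n) = c * Z n\<close> for a power \<open>c\<close> of \<open>\<theta>\<close>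
  with positive exponent. For \<open>n > 0\<close> the two factors differ in absolute value, so
  \<open>Z n\<close> vanishes.\<close>

lemma commuting_series_trivial:
  assumes "mseq Z" "Z 0 = 1\<^sub>m dim_E"
    "\<And>a. tau_mult Z (tau_const (Em a 0)) = tau_mult (tau_const (Em a 0)) Z"
  shows "Z = tau_one"
proof (rule mseq_eqI)
  fix n i j assume ij: "i < dim_E" "j < dim_E"
  show "Z n $$ (i, j) = tau_one n $$ (i, j)"
  proof (cases n)
    case 0 then show ?thesis by (simp add: assms(2) tau_const_def)
  next
    case (Suc n')
    let ?M = "q ^ dim_E" and ?a = "monom (1::'f) (q ^ dim_E)"
    have "tau_mult Z (tau_const (Em ?a 0)) n $$ (i, j) = (\<Sum>h<dim_E. if h = j then Z n $$ (i, j) * fr n (\<theta> ^ ?M) else 0)"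
      unfolding mult_tau_const_entry[OF Em_carrier assms(1) ij]
      by (rule sum.cong) (use ij in \<open>auto simp: Em_scalar\<close>)
    moreover have "tau_mult (tau_const (Em ?a 0)) Z n $$ (i, j) = (\<Sum>h<dim_E. if h = i then \<theta> ^ ?M * Z n $$ (i, j) else 0)"
      unfolding tau_const_mult_entry[OF Em_carrier assms(1) ij]
      by (rule sum.cong) (use ij in \<open>auto simp: Em_scalar\<close>)
    ultimately have "Z n $$ (i, j) * fr n (\<theta> ^ ?M) = \<theta> ^ ?M * Z n $$ (i, j)"
      using assms(3)[of ?a] ij by (simp only: sum.delta finite_lessThan lessThan_iff if_True)
    moreover have "fr n (\<theta> ^ ?M) \<noteq> \<theta> ^ ?M"
    proof
      assume "fr n (\<theta> ^ ?M) = \<theta> ^ ?M"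
      then have "\<theta> ^ (?M * q ^ n) = \<theta> ^ ?M" by (simp add: fr_def power_mult)
      then have "?M * q ^ n = ?M" by (rule theta_power_inj)
      then have "q ^ n = 1" using q_ge_2 by simp
      then show False using Suc q_ge_2 by simp
    qed
    ultimately have "Z n $$ (i, j) = 0" by (simp add: mult.commute)
    then show ?thesis using Suc ij by (simp add: tau_const_def)
  qed
qed (use assms in auto)

text \<open>The inverse \<open>V\<close> of \<open>Pm\<close> satisfies the equations of Exp. For
  any other solution \<open>Y\<close>, the product of \<open>Pm\<close> and \<open>Y\<close>
  commutes with every \<open>d[a]\<close>, hence is 1 and \<open>Y = V\<close>. Both descriptions
  are thereby resolved.\<close>

lemma Log_coeff_eq: "Log_coeff = Pm"
proof -
  obtain V where V: "mseq V" "V 0 = 1\<^sub>m dim_E" "tau_mult Pm V = tau_one" "tau_mult V Pm = tau_one"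
    by (rule inverse_exists[OF mseq_Pm Pm_0])
  note as = tau_mult_assoc
  have mc: "mseq (tau_const (Em a 0))" for a by simp
  have Xint: "tau_mult V (tau_const (Em a 0)) = tau_mult (Em a) V" for a
  proof -
    have "tau_mult V (tau_const (Em a 0)) = tau_mult (tau_mult V (tau_const (Em a 0))) (tau_mult Pm V)"
      by (simp add: V(3) mult_tau_one)
    also have "\<dots> = tau_mult (tau_mult V (tau_mult (tau_const (Em a 0)) Pm)) V"
      using V(1) mc by (simp add: as)
    also have "\<dots> = tau_mult (tau_mult (tau_mult V Pm) (Em a)) V"
      unfolding Pm_intertwine[symmetric] using V(1) by (simp add: as)
    finally show ?thesis by (simp add: V(4) tau_one_mult)
  qed
  have "Exp_coeff = V"
    unfolding Exp_coeff_def t_module_eq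
  proof (rule the_equality)
    show "(\<forall>i. V i \<in> carrier_mat dim_E dim_E) \<and> V 0 = 1\<^sub>m dim_E \<and>
      (\<forall>a. tau_mult V (tau_const (Em a 0)) = tau_mult (Em a) V)"
      using V(1,2) Xint by (simp add: mseq_def)
    fix Y assume "(\<forall>i. Y i \<in> carrier_mat dim_E dim_E) \<and> Y 0 = 1\<^sub>m dim_E \<and>
      (\<forall>a. tau_mult Y (tau_const (Em a 0)) = tau_mult (Em a) Y)"
    then have Y: "mseq Y" "Y 0 = 1\<^sub>m dim_E" "\<And>a. tau_mult Y (tau_const (Em a 0)) = tau_mult (Em a) Y"
      by (auto simp: mseq_def)
    have "tau_mult Pm Y = tau_one"
    proof (rule commuting_series_trivial)
      show "tau_mult Pm Y 0 = 1\<^sub>m dim_E"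
      proof (rule eq_matI)
        fix i j assume "i < dim_row (1\<^sub>m dim_E)" "j < dim_col (1\<^sub>m dim_E)"
        then have ij: "i < dim_E" "j < dim_E" by auto
        have "tau_mult Pm Y 0 $$ (i, j) = (\<Sum>h<dim_E. if h = i then (1\<^sub>m dim_E :: 'c mat) $$ (i, j) else 0)"
          unfolding tau_mult_entry[OF mseq_Pm Y(1) ij] Pm_0 Y(2) atMost_0
          by (simp only: sum.insert finite.emptyI empty_iff not_False_eq_True sum.empty add_0_right diff_0_eq_0 Pm_0 Y(2))
            (rule sum.cong, use ij in auto)
        then show "tau_mult Pm Y 0 $$ (i, j) = 1\<^sub>m dim_E $$ (i, j)" using ij by simp
      qed (simp_all add: tau_mult_def)
      fix a
      have "tau_mult (tau_mult Pm Y) (tau_const (Em a 0)) = tau_mult (tau_mult Pm (Em a)) Y"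
        using Y(1) mc by (simp add: as Y(3))
      also have "\<dots> = tau_mult (tau_const (Em a 0)) (tau_mult Pm Y)"
        unfolding Pm_intertwine using Y(1) mc by (simp add: as)
      finally show "tau_mult (tau_mult Pm Y) (tau_const (Em a 0)) = tau_mult (tau_const (Em a 0)) (tau_mult Pm Y)" .
    qed simp
    then have "tau_mult V (tau_mult Pm Y) = V" using V(1) by (simp add: mult_tau_one)
    then show "Y = V" using V(1,4) Y(1) by (simp add: as[symmetric] tau_one_mult)
  qed
  show ?thesis
    unfolding Log_coeff_def \<open>Exp_coeff = V\<close>
  proof (rule the_equality)
    show "(\<forall>i. Pm i \<in> carrier_mat dim_E dim_E) \<and> tau_mult Pm V = tau_one \<and> tau_mult V Pm = tau_one"
      using V mseq_Pm by (simp add: mseq_def)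
    fix P assume P: "(\<forall>i. P i \<in> carrier_mat dim_E dim_E) \<and> tau_mult P V = tau_one \<and> tau_mult V P = tau_one"
    then have "mseq P" by (simp add: mseq_def)
    then have "P = tau_mult (tau_mult P V) Pm" using V by (simp add: as mult_tau_one)
    then show "P = Pm" using P by (simp add: tau_one_mult)
  qed
qed

end

locale AT_bound = AT_setup q \<iota> r s Q \<eta>
  for q and \<iota> :: "'f::{field,finite} fls \<Rightarrow> 'c::{field,complete_space}"
    and r :: nat and s :: "nat \<Rightarrow> nat" and Q :: "nat \<Rightarrow> 'c poly" and \<eta> :: 'c +
  assumes norm_Qr: "gauss_norm (Q r) < absv \<theta> powr (real (s r) * real q / (real q - 1))"
    and norm_Qi: "\<And>i. i \<in> {1..<r} \<Longrightarrow>
      gauss_norm (Q i) \<le> absv \<theta> powr (real (s i) * real q / (real q - 1))"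
begin

section \<open>Norm estimates\<close>

definition \<kappa> :: real where "\<kappa> = absv \<eta> ^ q"

lemma kappa_pos: "\<kappa> > 0" using absv_eta_pos by (simp add: \<kappa>_def)

lemma theta_powr: "absv \<theta> powr (real n * real q / (real q - 1)) = \<kappa> ^ n"
proof -
  have "absv \<theta> powr (real n * real q / (real q - 1)) = (real q powr (real q / (real q - 1))) powr real n"
    by (simp add: absv_theta powr_powr mult.commute)
  also have "\<dots> = \<kappa> ^ n" using kappa_pos by (simp add: \<kappa>_def absv_eta_power[symmetric] powr_realpow)
  finally show ?thesis .
qed

text \<open>Ratio of the norm of \<open>Q i\<close> to its permitted bound; the hypotheses read
  \<open>\<rho> r < 1\<close> and \<open>\<rho> i \<le> 1\<close>.\<close>

definition \<rho> :: "nat \<Rightarrow> real" where "\<rho> i = gauss_norm (Q i) / \<kappa> ^ s i"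

lemma rho_nonneg: "0 \<le> \<rho> i" using kappa_pos gauss_norm_nonneg by (simp add: \<rho>_def)

lemma rho_r: "\<rho> r < 1" using norm_Qr kappa_pos by (simp add: \<rho>_def theta_powr)

lemma rho_le_1: "i \<in> {1..r} \<Longrightarrow> \<rho> i \<le> 1"
  using norm_Qi[of i] rho_r kappa_pos by (cases "i = r") (auto simp: \<rho>_def theta_powr)

text \<open>The decay rate of the n-th twist of anything that contains the factor
  \<open>Q r\<close>, and the common majorant of all later estimates.\<close>

definition \<epsilon> :: "nat \<Rightarrow> real" where "\<epsilon> n = \<rho> r ^ (q ^ n)"

lemma eps_nonneg: "0 \<le> \<epsilon> n" by (simp add: \<epsilon>_def rho_nonneg)

lemma eps_antimono: assumes "m \<le> n" shows "\<epsilon> n \<le> \<epsilon> m"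
proof -
  have "q ^ m \<le> q ^ n" using assms by (intro power_increasing) (simp_all add: Suc_le_eq)
  then show ?thesis
    unfolding \<epsilon>_def by (rule power_decreasing) (simp_all add: rho_nonneg less_imp_le[OF rho_r])
qed

lemma eps_tendsto: "\<epsilon> \<longlonglongrightarrow> 0"
proof (rule tendsto_zero_squeeze)
  show "(\<lambda>n. \<rho> r ^ n) \<longlonglongrightarrow> 0" using rho_nonneg rho_r by (intro LIMSEQ_power_zero) simp
  show "\<epsilon> n \<le> \<rho> r ^ n" for n
  proof -
    have "n \<le> q ^ n" using q_ge_2 by (intro less_imp_le[OF less_le_trans[OF less_exp power_mono]]) auto
    then show ?thesis
      unfolding \<epsilon>_def by (rule power_decreasing) (simp_all add: rho_nonneg less_imp_le[OF rho_r])
  qed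
qed (rule eps_nonneg)

lemma cmult_eps_tendsto: "(\<lambda>n. C * \<epsilon> n) \<longlonglongrightarrow> 0"
  using tendsto_mult[OF tendsto_const eps_tendsto, of C] by simp

lemma inverse_power_power_mult:
  "(inverse x ^ a) ^ b * y ^ a = (y / x ^ b) ^ a" for x y :: real
  by (simp add: divide_inverse power_mult_distrib power_inverse power_mult[symmetric] mult.commute)

lemma gb_tw_A: "gb (\<rho> i ^ (q ^ n) * R ^ degree (Q i)) (tw n (A i))"
proof -
  have "gb ((inverse (absv \<eta> ^ q) ^ (q ^ n)) ^ s i * (gauss_norm (Q i) ^ (q ^ n) * R ^ degree (Q i))) (tw n (A i))"
    unfolding A_def tw_mult tw_power by (intro gb_mult gb_power gb_tw_Om gb_tw_poly)
  moreover have "(inverse (absv \<eta> ^ q) ^ (q ^ n)) ^ s i * gauss_norm (Q i) ^ (q ^ n) = \<rho> i ^ (q ^ n)"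
    by (simp only: \<rho>_def \<kappa>_def inverse_power_power_mult)
  ultimately show ?thesis by (metis mult.assoc)
qed

lemma gb_tw_A_le: assumes "i \<in> {1..r}" shows "gb (R ^ degree (Q i)) (tw n (A i))"
proof (rule gb_mono[OF gb_tw_A])
  have "\<rho> i ^ (q ^ n) \<le> 1" using rho_nonneg rho_le_1[OF assms] by (intro power_le_one) auto
  then show "\<rho> i ^ (q ^ n) * R ^ degree (Q i) \<le> R ^ degree (Q i)"
    by (simp add: mult_left_le_one_le rho_nonneg)
qed

text \<open>One step of \<open>T\<close> twists the previous iterate, so the bound is carried for
  all twists \<open>k\<close> at once and depends only on \<open>i + k\<close>. The constant may
  change from coordinate to coordinate, but not with \<open>i\<close> or \<open>k\<close>.\<close>

lemma T_pow_gb: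
  assumes g: "\<And>l k. gb (C * \<epsilon> k) (tw k (g l))" and C: "C \<ge> 0"
  shows "\<exists>C'\<ge>0. \<forall>i k. gb (C' * \<epsilon> (i + k)) (tw k ((T ^^ i) g l))"
proof (induction l rule: coordinate_induct)
  case (1 l)
  have "gb (C * \<epsilon> (i + k)) (tw k ((T ^^ i) g l))" for i k
    by (cases i) (use g 1 in \<open>auto simp: T_outside C eps_nonneg intro!: gb_zero\<close>)
  then show ?case using C by blast
next
  case (2 l)
  then obtain C1 where C1: "C1 \<ge> 0" "\<And>i k. gb (C1 * \<epsilon> (i + k)) (tw k ((T ^^ i) g (Suc l)))" by blast
  define M where "M = R ^ degree (Q l)"
  have M: "M \<ge> 0" by (simp add: M_def)
  \<comment> \<open>One entry bounds the initial value and all twisted terms, the other the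
    contribution of coordinate \<open>l + 1\<close>. A maximum suffices because the norm is
    ultrametric; a sum would grow with \<open>i\<close>.\<close>
  define C2 where "C2 = max C (M * C1)"
  have "gb (C2 * \<epsilon> (i + k)) (tw k ((T ^^ i) g l))" for i k
  proof (induction i arbitrary: k)
    case 0
    show ?case
      by (rule gb_mono) (use g[of k l] in \<open>auto simp: C2_def eps_nonneg intro!: mult_right_mono\<close>)
  next
    case (Suc i)
    have "tw k ((T ^^ Suc i) g l) = tw (Suc k) ((T ^^ i) g l) - tw k (A l) * tw k ((T ^^ Suc i) g (Suc l))"
      using T_rec[OF 2(1), of "(T ^^ i) g"] by (simp add: tw_diff tw_mult tw_tw)
    moreover have "gb (C2 * \<epsilon> (Suc i + k)) (tw (Suc k) ((T ^^ i) g l))"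
      using Suc[of "Suc k"] by simp
    moreover have "gb (C2 * \<epsilon> (Suc i + k)) (tw k (A l) * tw k ((T ^^ Suc i) g (Suc l)))"
    proof (rule gb_mono)
      show "gb (M * (C1 * \<epsilon> (Suc i + k))) (tw k (A l) * tw k ((T ^^ Suc i) g (Suc l)))"
        unfolding M_def by (intro gb_mult gb_tw_A_le[OF 2(1)] C1(2))
      show "M * (C1 * \<epsilon> (Suc i + k)) \<le> C2 * \<epsilon> (Suc i + k)"
        unfolding mult.assoc[symmetric] C2_def by (intro mult_right_mono eps_nonneg) simp
    qed
    ultimately show ?case using gb_diff by simp
  qed
  moreover have "C2 \<ge> 0" using C by (simp add: C2_def)
  ultimately show ?case by blast
qed

lemma dl0_T_pow_tendsto:
  assumes g: "\<And>l k. gb (C * \<epsilon> k) (tw k (g l))" and C: "C \<ge> 0"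
  shows "(\<lambda>i. absv (dl0 ((T ^^ i) g) j)) \<longlonglongrightarrow> 0"
proof -
  obtain C' where C': "\<And>i k. gb (C' * \<epsilon> (i + k)) (tw k ((T ^^ i) g (ixl j)))"
    using T_pow_gb[where g = g and l = "ixl j", OF g C] by blast
  obtain B where B: "gb B (iOm ^ \<d> (ixl j))" using bdd_power[OF bdd_iOm] by (auto simp: bdd_def)
  have "absv (dl0 ((T ^^ i) g) j) \<le> (C' * B) * \<epsilon> i" for i
  proof -
    have "gb ((C' * \<epsilon> i) * B) ((T ^^ i) g (ixl j) * iOm ^ \<d> (ixl j))"
      using gb_mult[OF _ B] C'[of i 0] by simp
    from D_le[OF this] show ?thesis by (simp add: dl0_def mult_ac)
  qed
  then show ?thesis by (intro tendsto_zero_squeeze[OF cmult_eps_tendsto]) auto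
qed

section \<open>The special point\<close>

definition hp :: "nat \<Rightarrow> 'c poly" where
  "hp l = (if l \<in> {1..r} then (-1) ^ (r - l) * (\<Prod>k=l..r. Q k) else 0)"

lemma hp_outside: "l \<notin> {1..r} \<Longrightarrow> hp l = 0" by (auto simp: hp_def)

lemma hp_r: "hp r = Q r" using r_ge_1 by (simp add: hp_def)

lemma hp_rec: assumes "l \<in> {1..<r}" shows "hp l = - (Q l * hp (Suc l))"
proof -
  have "r - l = Suc (r - Suc l)" using assms by auto
  moreover have "(\<Prod>k=l..r. Q k) = Q l * (\<Prod>k=Suc l..r. Q k)"
    using assms by (intro prod.atLeast_Suc_atMost) auto
  ultimately show ?thesis using assms by (simp add: hp_def algebra_simps)
qed

lemma hp_motive: "hp \<in> motive"
proof -
  have "(-1 :: 'c poly) ^ n \<in> Kpoly" for n by (intro Kpoly_power Kpoly_uminus Kpoly_1)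
  then show ?thesis by (auto simp: motive_iff hp_def intro!: Kpoly_mult Kpoly_prod Q_Kpoly)
qed

text \<open>The coordinates of \<open>hp\<close> are those produced by \<open>T\<close>: the last is
  the twist of the last coordinate of the special element, where \<open>\<d> r = s r\<close>, and
  each lower one is forced by \<open>T_rec\<close>.\<close>

lemma special_eq_sigma:
  "sigma hp = (\<lambda>l. if l = r then twist_poly (- 1) (Q r) * t_theta ^ s r else 0)" (is "_ = ?sp")
proof (rule sigma_eqI[OF hp_motive])
  have r: "r \<in> {1..r}" using r_ge_1 by simp
  show sp: "?sp \<in> motive"
    using r_ge_1 by (auto simp: motive_iff intro!: Kpoly_mult Kpoly_power Kpoly_t_theta Kpoly_twist_m1 Q_Kpoly)
  have dr: "\<d> r = s r" by (simp add: tail_weight_def)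
  show "T (N ?sp) = N hp"
  proof
    show "T (N ?sp) l = N hp l" for l
    proof (induction l rule: coordinate_induct)
      case (1 l) then show ?case by (simp add: T_outside N_outside[OF hp_motive])
    next
      case (2 l)
      show ?case
      proof (cases "l = r")
        case True
        have "tw 1 (N ?sp r) = Om ^ \<d> r * tw 1 (fps_of_poly (twist_poly (-1) (Q r)))"
          by (rule T_N_lin[OF r]) (simp add: dr mult.commute)
        then show ?thesis unfolding True T_rec[OF r]
          by (simp add: T_outside N_def hp_r tw_twist_m1 Q_Kpoly[OF r] del: One_nat_def)
      next
        case False
        then have l: "l \<in> {1..<r}" using 2(1) by auto
        have "A l * N hp (Suc l) = Om ^ \<d> l * (fps_of_poly (Q l) * fps_of_poly (hp (Suc l)))"
          unfolding N_def by (rule Om_A[OF 2(1)])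
        then show ?thesis unfolding T_rec[OF 2(1)] 2(2)
          using False by (simp add: N_def[of ?sp] N_def[of hp l] hp_rec[OF l] fps_of_poly_uminus fps_of_poly_mult
              del: One_nat_def)
      qed
    qed
  qed
qed

section \<open>The pieces of h with constant coordinates, and their logarithms\<close>

definition hk :: "nat \<Rightarrow> nat \<Rightarrow> 'c poly" where "hk k l = [:coeff (hp l) k:]"

text \<open>A constant multiple of \<open>m_l\<close> sits at the basis element with exponent 0,
  present because \<open>\<d> l >= 1\<close>.\<close>

definition vk :: "nat \<Rightarrow> nat \<Rightarrow> 'c" where
  "vk k j = (if j < dim_E then if ixe j = 0 then coeff (hp (ixl j)) k else 0 else 0)"

lemma hk_comb: "hk k = comb (vk k)"
proof
  fix l
  have "comb (vk k) l = (if l \<in> {1..r} then \<Sum>e<\<d> l. [:if e = 0 then coeff (hp l) k else 0:] * t_theta ^ e else 0)"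
    by (rule comb_ix) (simp add: vk_def)
  also have "\<dots> = hk k l"
  proof (cases "l \<in> {1..r}")
    case True
    have "(\<Sum>e<\<d> l. [:if e = 0 then coeff (hp l) k else 0:] * t_theta ^ e)
        = (\<Sum>e<\<d> l. if e = 0 then [:coeff (hp l) k:] else 0)"
      by (rule sum.cong) auto
    then show ?thesis using True d_pos[OF True] by (simp add: hk_def)
  next
    case False
    then have "hk k l = 0" using hp_outside[OF False] by (simp add: hk_def)
    then show ?thesis using False by (simp only: if_False)
  qed
  finally show "hk k l = comb (vk k) l" by simp
qed

lemma vk_Kbar: "vk k j \<in> Kbar"
  using motive_Kpoly[OF hp_motive] by (auto simp: vk_def Kpoly_def)

lemma hk_motive: "hk k \<in> motive"
  unfolding hk_comb by (rule comb_motive) (rule vk_Kbar)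

lemma delta1_hk: "delta1 (hk k) = vec dim_E (vk k)"
  unfolding hk_comb by (rule delta1_comb) (simp_all add: vk_Kbar, simp add: vk_def)

definition bnd :: nat where "bnd = Suc (\<Sum>l=1..r. degree (hp l))"

lemma degree_hp: "degree (hp l) < bnd"
proof (cases "l \<in> {1..r}")
  case True
  then have "degree (hp l) \<le> (\<Sum>l=1..r. degree (hp l))" by (intro member_le_sum) auto
  then show ?thesis by (simp add: bnd_def)
qed (simp add: hp_outside bnd_def)

lemma hp_hk: "hp = (\<lambda>l. \<Sum>k<bnd. poly_t (monom 1 k) * hk k l)"
proof
  fix l
  have "(\<Sum>k<bnd. poly_t (monom 1 k) * hk k l) = (\<Sum>k<bnd. monom (coeff (hp l) k) k)"
    by (simp add: poly_t_monom hk_def smult_monom mult.commute)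
  also have "\<dots> = (\<Sum>k\<le>degree (hp l). monom (coeff (hp l) k) k)"
    by (rule sum.mono_neutral_right) (use degree_hp[of l] in \<open>auto simp: coeff_eq_0\<close>)
  finally show "hp l = (\<Sum>k<bnd. poly_t (monom 1 k) * hk k l)" by (simp add: poly_as_sum_of_monoms)
qed

lemma gauss_norm_mult_le: "absv (coeff (p * p' :: 'c poly) n) \<le> gauss_norm p * gauss_norm p'"
  unfolding coeff_mult
  by (rule absv_sum_le) (auto simp: absv_mult gauss_norm_nonneg intro!: mult_mono gauss_norm_ge)

lemma gauss_norm_le: "(\<And>n. absv (coeff p n) \<le> C) \<Longrightarrow> gauss_norm (p :: 'c poly) \<le> C"
  unfolding gauss_norm_def by (intro Max.boundedI) auto

lemma gauss_norm_prod: "gauss_norm (\<Prod>k\<in>S. p k :: 'c poly) \<le> (\<Prod>k\<in>S. gauss_norm (p k))"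
proof (induction S rule: infinite_finite_induct)
  case (insert x F)
  have "gauss_norm (p x * prod p F) \<le> gauss_norm (p x) * gauss_norm (prod p F)"
    by (intro gauss_norm_le gauss_norm_mult_le)
  also have "\<dots> \<le> gauss_norm (p x) * (\<Prod>k\<in>F. gauss_norm (p k))"
    using insert by (intro mult_left_mono gauss_norm_nonneg)
  finally show ?case using insert by simp
qed (auto intro!: gauss_norm_le simp: coeff_1)

text \<open>Each coordinate is a product of the \<open>Q k\<close> with \<open>k\<close> from
  \<open>l\<close> to \<open>r\<close>, so \<open>Q r\<close> always occurs and contributes
  \<open>\<rho> r\<close>; the remaining ratios are at most 1. The power of \<open>\<kappa>\<close>
  is the one that scaling by Omega cancels.\<close>

lemma coeff_hp_le: assumes "l \<in> {1..r}" shows "absv (coeff (hp l) n) \<le> \<rho> r * \<kappa> ^ \<d> l"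
proof -
  let ?P = "\<Prod>k=l..r. Q k"
  have "hp l = ?P \<or> hp l = - ?P"
    using assms by (cases "even (r - l)") (auto simp: hp_def)
  then have "absv (coeff (hp l) n) = absv (coeff ?P n)" by auto
  also have "\<dots> \<le> (\<Prod>k=l..r. gauss_norm (Q k))"
    by (rule order_trans[OF gauss_norm_ge gauss_norm_prod])
  also have "\<dots> = (\<Prod>k=l..r. \<rho> k * \<kappa> ^ s k)"
    using kappa_pos by (intro prod.cong) (auto simp: \<rho>_def)
  also have "\<dots> = (\<Prod>k=l..r. \<rho> k) * \<kappa> ^ \<d> l"
    by (simp add: prod.distrib tail_weight_def power_sum)
  also have "\<dots> \<le> \<rho> r * \<kappa> ^ \<d> l"
  proof (rule mult_right_mono)
    have "(\<Prod>k=l..r. \<rho> k) = (\<Prod>k\<in>{l..r} - {r}. \<rho> k) * \<rho> r"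
      using assms by (subst prod.remove[of _ r]) auto
    also have "\<dots> \<le> 1 * \<rho> r"
      using assms rho_nonneg rho_le_1 by (intro mult_right_mono prod_le_1) auto
    finally show "(\<Prod>k=l..r. \<rho> k) \<le> \<rho> r" by simp
  qed (use kappa_pos in simp)
  finally show ?thesis .
qed

lemma gb_tw_N_hk: "gb (1 * \<epsilon> n) (tw n (N (hk k) l))"
proof (cases "l \<in> {1..r}")
  case False
  then show ?thesis using eps_nonneg by (simp add: N_outside[OF hk_motive] gb_zero)
next
  case True
  let ?b = "coeff (hp l) k"
  have "N (hk k) l = Om ^ \<d> l * fps_const ?b" by (simp add: N_def hk_def fps_of_poly_const)
  then have "gb ((inverse (absv \<eta> ^ q) ^ (q ^ n)) ^ \<d> l * absv (fr n ?b)) (tw n (N (hk k) l))"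
    by (simp only: tw_mult tw_power tw_const) (intro gb_mult gb_power gb_tw_Om gb_const)
  moreover have "(inverse (absv \<eta> ^ q) ^ (q ^ n)) ^ \<d> l * absv (fr n ?b) \<le> \<epsilon> n"
  proof -
    have "(inverse (absv \<eta> ^ q) ^ (q ^ n)) ^ \<d> l * absv (fr n ?b) = (absv ?b / \<kappa> ^ \<d> l) ^ (q ^ n)"
      by (simp only: absv_fr \<kappa>_def inverse_power_power_mult)
    also have "\<dots> \<le> \<rho> r ^ (q ^ n)"
      using coeff_hp_le[OF True, of k] kappa_pos by (intro power_mono) (auto simp: field_simps)
    finally show ?thesis by (simp add: \<epsilon>_def)
  qed
  ultimately show ?thesis by (simp add: gb_mono)
qed

lemma Log_hk_term:
  assumes "j < dim_E"
  shows "(Log_coeff i *\<^sub>v map_vec (frob (int i)) (delta1 (hk k))) $ j = dl0 ((T ^^ i) (N (hk k))) j"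
proof -
  have "(Pm i *\<^sub>v map_vec (fr i) (vec dim_E (vk k))) $ j = (\<Sum>b<dim_E. Pm i $$ (j, b) * fr i (vk k b))"
    using assms by (auto simp: Pm_def scalar_prod_def atLeast0LessThan intro!: sum.cong)
  then show ?thesis
    unfolding Log_coeff_eq frob_of_nat delta1_hk using assms by (simp add: hk_comb dl0_T_pow_comb)
qed

lemma Log_hk_summable: "summable (\<lambda>i. dl0 ((T ^^ i) (N (hk k))) j)"
  by (rule ct_summable, rule dl0_T_pow_tendsto[of 1]) (simp_all add: gb_tw_N_hk[simplified])

lemma hk_Log_domain: "delta1 (hk k) \<in> Log_domain"
proof -
  have "delta1 (hk k) \<in> carrier_vec dim_E" by (simp add: delta1_hk)
  then show ?thesis
    unfolding Log_domain_def by (auto simp: Log_hk_term Log_hk_summable)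
qed

lemma Log_hk_sums:
  assumes "j < dim_E" shows "(\<lambda>i. dl0 ((T ^^ i) (N (hk k))) j) sums (Log (delta1 (hk k)) $ j)"
  using summable_sums[OF Log_hk_summable] assms by (simp add: Log_def Log_hk_term)

lemma split_log_sums:
  assumes "j < dim_E"
  shows "(\<lambda>i. dl0 ((T ^^ i) (N hp)) j) sums
    (\<Sum>k<bnd. (t_module (monom 1 k) 0 *\<^sub>v Log (delta1 (hk k))) $ j)"
proof -
  have mv: "(t_module (monom 1 k) 0 *\<^sub>v Log (delta1 (hk k))) $ j
      = (\<Sum>b<dim_E. Em (monom 1 k) 0 $$ (j, b) * Log (delta1 (hk k)) $ b)" for k
    using assms by (auto simp: t_module_eq Em_def Log_def scalar_prod_def atLeast0LessThan intro!: sum.cong)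
  have "(\<lambda>i. \<Sum>k<bnd. \<Sum>b<dim_E. Em (monom 1 k) 0 $$ (j, b) * dl0 ((T ^^ i) (N (hk k))) b) sums
    (\<Sum>k<bnd. \<Sum>b<dim_E. Em (monom 1 k) 0 $$ (j, b) * Log (delta1 (hk k)) $ b)"
    by (intro ct_sums_sum ct_sums_cmult Log_hk_sums) simp
  moreover have "(\<Sum>k<bnd. \<Sum>b<dim_E. Em (monom 1 k) 0 $$ (j, b) * dl0 ((T ^^ i) (N (hk k))) b)
      = dl0 ((T ^^ i) (N hp)) j" for i
  proof -
    have "N hp = (\<lambda>l. \<Sum>k<bnd. fps_of_poly (poly_t (monom 1 k)) * N (hk k) l)"
      by (subst hp_hk) (simp add: N_def fps_of_poly_sum fps_of_poly_mult sum_distrib_left fun_eq_iff mult_ac)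
    then have "(T ^^ i) (N hp) = (\<lambda>l. \<Sum>k<bnd. fps_of_poly (poly_t (monom 1 k)) * (T ^^ i) (N (hk k)) l)"
      by (simp only: T_pow_sum T_pow_mult tw_poly_t)
    then have "dl0 ((T ^^ i) (N hp)) j
        = (\<Sum>k<bnd. dl0 (\<lambda>l. fps_of_poly (poly_t (monom 1 k)) * (T ^^ i) (N (hk k)) l) j)"
      by (simp only:) (rule dl0_sum, intro bdd_mult bdd_of_poly bdd_T_pow bdd_N)
    also have "\<dots> = (\<Sum>k<bnd. \<Sum>b<dim_E. Em (monom 1 k) 0 $$ (j, b) * dl0 ((T ^^ i) (N (hk k))) b)"
      by (intro sum.cong refl dl0_poly_t bdd_T_pow bdd_N assms)
    finally show ?thesis by simp
  qed
  ultimately show ?thesis by (simp add: mv)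
qed

lemma special_point_split:
  "special_point = vec dim_E (\<lambda>j. \<Sum>k<bnd. tau_apply (t_module (monom 1 k)) (delta1 (hk k)) $ j)"
proof (rule eq_vecI)
  have sp: "special_point = delta1 hp"
    unfolding special_point_def special_eq_sigma[symmetric] by (rule delta1_sigma[OF hp_motive])
  fix j assume "j < dim_vec (vec dim_E (\<lambda>j. \<Sum>k<bnd. tau_apply (t_module (monom 1 k)) (delta1 (hk k)) $ j))"
  then have j: "j < dim_E" by simp
  have "delta1 hp $ j = (\<Sum>k<bnd. delta1 (\<lambda>l. poly_t (monom 1 k) * hk k l) $ j)"
    by (subst hp_hk) (rule delta1_sum_nth[OF _ j], intro motive_mult Kpoly_poly_t hk_motive)
  then show "special_point $ j = vec dim_E (\<lambda>j. \<Sum>k<bnd. tau_apply (t_module (monom 1 k)) (delta1 (hk k)) $ j) $ j"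
    using j by (simp add: sp t_module_eq tau_apply_Em hk_motive)
qed (simp add: special_point_def)

end

section \<open>The series \<open>L\<^sup>*\<close>\<close>

context C_infinity
begin

text \<open>Connects the unordered sum in \<open>L_star\<close> with a series of finite blocks. Any
  finite set containing the first blocks adds only small terms, and in an ultrametric their sum is
  just as small.\<close>

lemma has_sum_by_finite_blocks:
  fixes x :: "'a \<Rightarrow> 'c" and idx :: "'a \<Rightarrow> nat"
  assumes fin: "\<And>i. finite {f \<in> S. idx f = i}"
    and le: "\<And>f. f \<in> S \<Longrightarrow> absv (x f) \<le> b (idx f)" and b: "b \<longlonglongrightarrow> 0"
    and sums: "(\<lambda>i. \<Sum>f | f \<in> S \<and> idx f = i. x f) sums L"
  shows "(x has_sum L) S"
  unfolding has_sum_def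
proof (rule tendstoI)
  fix e :: real assume e: "e > 0"
  then have "eventually (\<lambda>i. b i < e / 2) sequentially" using order_tendstoD(2)[OF b, of "e / 2"] by simp
  then obtain n where n: "\<And>i. i \<ge> n \<Longrightarrow> b i < e / 2" by (auto simp: eventually_sequentially)
  let ?blk = "\<lambda>i. \<Sum>f | f \<in> S \<and> idx f = i. x f"
  define F where "F = {f \<in> S. idx f < n}"
  have "F = (\<Union>i<n. {f \<in> S. idx f = i})" by (auto simp: F_def)
  then have finF: "finite F" using fin by simp
  have small: "absv (x f) \<le> e / 2" if "f \<in> S" "n \<le> idx f" for f
    using le[OF that(1)] n[OF that(2)] by linarith
  have F: "sum x F = (\<Sum>i<n. ?blk i)"
  proof -
    have "(\<Sum>i<n. \<Sum>f | f \<in> F \<and> idx f = i. x f) = sum x F"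
      by (rule sum.group) (use finF in \<open>auto simp: F_def\<close>)
    moreover have "(\<Sum>f | f \<in> F \<and> idx f = i. x f) = ?blk i" if "i < n" for i
      by (rule sum.cong) (use that in \<open>auto simp: F_def\<close>)
    ultimately show ?thesis by simp
  qed
  have tail: "absv (L - sum x F) \<le> e / 2"
    unfolding F
  proof (rule ct_sums_tail_le[OF sums])
    show "absv (?blk i) \<le> e / 2" if "n \<le> i" for i
      using e that by (intro absv_sum_le small) auto
  qed (use e in simp)
  have "dist (sum x Y) L < e" if "finite Y" "F \<subseteq> Y" "Y \<subseteq> S" for Y
  proof -
    have "sum x Y = sum x F + sum x (Y - F)" using that by (metis add.commute sum.subset_diff)
    moreover have "absv (sum x (Y - F)) \<le> e / 2"
      by (intro absv_sum_le small) (use e that in \<open>auto simp: F_def\<close>)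
    ultimately have "absv (sum x Y - L) \<le> e / 2"
      using absv_diff_le[of "sum x (Y - F)" "e / 2" "L - sum x F"] tail by (simp add: algebra_simps)
    then show ?thesis using e by (simp add: dist_absv)
  qed
  then show "eventually (\<lambda>Y. dist (sum x Y) L < e) (finite_subsets_at_top S)"
    unfolding eventually_finite_subsets_at_top using finF
    by (intro exI[of _ F]) (auto simp: F_def)
qed

end

context AT_bound
begin

definition Chains :: "nat \<Rightarrow> (nat \<Rightarrow> nat) set" where
  "Chains l = {f \<in> {l..r} \<rightarrow>\<^sub>E (UNIV :: nat set). \<forall>k\<in>{l..<r}. f k \<le> f (Suc k)}"

definition chain_term :: "nat \<Rightarrow> (nat \<Rightarrow> nat) \<Rightarrow> 'c fps" where
  "chain_term l f = (\<Prod>k=l..r. tw (f k) (A k))"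

definition chain_sum :: "nat \<Rightarrow> nat \<Rightarrow> 'c fps" where
  "chain_sum i l = (\<Sum>f | f \<in> Chains l \<and> f r = i. chain_term l f)"

lemma Chains_mono:
  assumes "f \<in> Chains l" "l \<le> j" "j \<le> k" "k \<le> r" shows "f j \<le> f k"
  using assms(3,4)
proof (induction k rule: dec_induct)
  case (step n)
  then have "f n \<le> f (Suc n)" using assms(1,2) by (auto simp: Chains_def)
  with step show ?case by simp
qed simp

lemma finite_Chains: "finite {f \<in> Chains l. f r = i}"
proof (rule finite_subset)
  show "finite ({l..r} \<rightarrow>\<^sub>E {..i})" by (intro finite_PiE) auto
  show "{f \<in> Chains l. f r = i} \<subseteq> {l..r} \<rightarrow>\<^sub>E {..i}"
  proof
    fix f assume f: "f \<in> {f \<in> Chains l. f r = i}"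
    then have "f k \<le> i" if "k \<in> {l..r}" for k using Chains_mono[of f l k r] that by auto
    then show "f \<in> {l..r} \<rightarrow>\<^sub>E {..i}" using f by (auto simp: Chains_def PiE_iff)
  qed
qed

lemma chain_sum_0: assumes "l \<in> {1..r}" shows "chain_sum 0 l = (\<Prod>k=l..r. A k)"
proof -
  have "{f. f \<in> Chains l \<and> f r = 0} = {restrict (\<lambda>_. 0) {l..r}}"
  proof (intro equalityI subsetI)
    fix f assume f: "f \<in> {f. f \<in> Chains l \<and> f r = 0}"
    have "f k = restrict (\<lambda>_. 0) {l..r} k" for k
    proof (cases "k \<in> {l..r}")
      case True then show ?thesis using Chains_mono[of f l k r] f by auto
    next
      case False
      then have "f k = undefined" using f PiE_arb[of f "{l..r}" "\<lambda>_. UNIV" k] by (simp add: Chains_def)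
      then show ?thesis using False by (auto simp: restrict_def)
    qed
    then show "f \<in> {restrict (\<lambda>_. 0) {l..r}}" by auto
  qed (use assms in \<open>auto simp: Chains_def\<close>)
  then show ?thesis by (simp add: chain_sum_def chain_term_def)
qed

lemma chain_sum_r: "chain_sum i r = tw i (A r)"
proof -
  have "{f. f \<in> Chains r \<and> f r = i} = {restrict (\<lambda>_. i) {r}}"
  proof (intro equalityI subsetI)
    fix f assume f: "f \<in> {f. f \<in> Chains r \<and> f r = i}"
    have "f k = restrict (\<lambda>_. i) {r} k" for k
      using f PiE_arb[of f "{r..r}" "\<lambda>_. UNIV" k] by (cases "k = r") (auto simp: Chains_def)
    then show "f \<in> {restrict (\<lambda>_. i) {r}}" by auto
  qed (auto simp: Chains_def)
  then show ?thesis by (simp add: chain_sum_def chain_term_def)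
qed

text \<open>A chain either starts with \<open>0\<close>, or all its entries are positive and can be lowered by one.\<close>
lemma chain_sum_Suc:
  assumes l: "l \<in> {1..<r}"
  shows "chain_sum (Suc i) l = tw 1 (chain_sum i l) + A l * chain_sum (Suc i) (Suc l)"
proof -
  let ?Z = "{f. f \<in> Chains l \<and> f r = Suc i \<and> f l = 0}"
  let ?P = "{f. f \<in> Chains l \<and> f r = Suc i \<and> f l \<noteq> 0}"
  have lr: "l < r" using l by simp
  have fin: "finite ?Z" "finite ?P"
    by (rule finite_subset[OF _ finite_Chains[of l "Suc i"]], auto)+
  have "chain_sum (Suc i) l = sum (chain_term l) (?Z \<union> ?P)"
    unfolding chain_sum_def by (rule sum.cong) auto
  also have "\<dots> = sum (chain_term l) ?Z + sum (chain_term l) ?P"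
    by (rule sum.union_disjoint[OF fin]) auto
  also have "sum (chain_term l) ?Z = (\<Sum>f | f \<in> Chains (Suc l) \<and> f r = Suc i. A l * chain_term (Suc l) f)"
  proof (rule sum.reindex_bij_witness[of _ "\<lambda>g. g(l := 0)" "\<lambda>f. restrict f {Suc l..r}"])
    fix f assume f: "f \<in> ?Z"
    have fE: "f \<in> {l..r} \<rightarrow>\<^sub>E UNIV" using f by (simp add: Chains_def)
    show "(restrict f {Suc l..r})(l := 0) = f"
    proof
      fix k
      show "((restrict f {Suc l..r})(l := 0)) k = f k"
        using f PiE_arb[OF fE, of k] by (cases "k = l"; cases "k \<in> {Suc l..r}") auto
    qed
    show "restrict f {Suc l..r} \<in> {f. f \<in> Chains (Suc l) \<and> f r = Suc i}"
      using f lr by (auto simp: Chains_def)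
    have "(\<Prod>k=l..r. tw (f k) (A k)) = tw (f l) (A l) * (\<Prod>k=Suc l..r. tw (f k) (A k))"
      using lr by (intro prod.atLeast_Suc_atMost) simp
    then show "A l * chain_term (Suc l) (restrict f {Suc l..r}) = chain_term l f"
      using f by (simp add: chain_term_def)
  next
    fix g assume g: "g \<in> {f. f \<in> Chains (Suc l) \<and> f r = Suc i}"
    have gE: "g \<in> {Suc l..r} \<rightarrow>\<^sub>E UNIV" using g by (simp add: Chains_def)
    show "restrict (g(l := 0)) {Suc l..r} = g"
    proof
      fix k
      show "restrict (g(l := 0)) {Suc l..r} k = g k"
        using PiE_arb[OF gE, of k] by (cases "k \<in> {Suc l..r}") auto
    qed
    have "g k = undefined" if "k \<notin> {Suc l..r}" for k using PiE_arb[OF gE that] .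
    then have "g(l := 0) \<in> {l..r} \<rightarrow>\<^sub>E UNIV" using lr by (auto simp: PiE_iff extensional_def)
    moreover have "(g(l := 0)) k \<le> (g(l := 0)) (Suc k)" if "k \<in> {l..<r}" for k
      using g that by (cases "k = l") (auto simp: Chains_def)
    ultimately show "g(l := 0) \<in> ?Z" using g lr by (auto simp: Chains_def)
  qed
  also have "\<dots> = A l * chain_sum (Suc i) (Suc l)" by (simp add: chain_sum_def sum_distrib_left)
  also have "sum (chain_term l) ?P = (\<Sum>f | f \<in> Chains l \<and> f r = i. tw 1 (chain_term l f))"
  proof (rule sum.reindex_bij_witness[of _ "\<lambda>g. restrict (\<lambda>k. Suc (g k)) {l..r}" "\<lambda>f. restrict (\<lambda>k. f k - 1) {l..r}"])
    fix f assume f: "f \<in> ?P"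
    have fE: "f \<in> {l..r} \<rightarrow>\<^sub>E UNIV" using f by (simp add: Chains_def)
    have pos: "f k > 0" if "k \<in> {l..r}" for k
    proof -
      have "f l \<le> f k" using Chains_mono[of f l l k] f that by simp
      then show ?thesis using f by simp
    qed
    show "restrict (\<lambda>k. Suc (restrict (\<lambda>k. f k - 1) {l..r} k)) {l..r} = f"
    proof
      fix k
      show "restrict (\<lambda>k. Suc (restrict (\<lambda>k. f k - 1) {l..r} k)) {l..r} k = f k"
        using PiE_arb[OF fE, of k] pos[of k] by (cases "k \<in> {l..r}") auto
    qed
    show "restrict (\<lambda>k. f k - 1) {l..r} \<in> {f. f \<in> Chains l \<and> f r = i}"
      using f lr by (auto simp: Chains_def intro!: diff_le_mono)
    show "tw 1 (chain_term l (restrict (\<lambda>k. f k - 1) {l..r})) = chain_term l f"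
      unfolding chain_term_def tw_prod
      by (rule prod.cong) (use pos in \<open>auto simp: tw_tw\<close>)
  next
    fix g assume g: "g \<in> {f. f \<in> Chains l \<and> f r = i}"
    have gE: "g \<in> {l..r} \<rightarrow>\<^sub>E UNIV" using g by (simp add: Chains_def)
    show "restrict (\<lambda>k. restrict (\<lambda>k. Suc (g k)) {l..r} k - 1) {l..r} = g"
    proof
      fix k
      show "restrict (\<lambda>k. restrict (\<lambda>k. Suc (g k)) {l..r} k - 1) {l..r} k = g k"
        using PiE_arb[OF gE, of k] by (cases "k \<in> {l..r}") auto
    qed
    show "restrict (\<lambda>k. Suc (g k)) {l..r} \<in> ?P" using g lr by (auto simp: Chains_def)
  qed
  also have "\<dots> = tw 1 (chain_sum i l)" by (simp add: chain_sum_def tw_sum)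
  finally show ?thesis by (simp add: add.commute)
qed

text \<open>With the sign inserted, \<open>T_rec\<close> and \<open>chain_sum_Suc\<close> are the
  same recursion. It starts from the plain products for \<open>i = 0\<close> and from the single
  twisted factor for \<open>l = r\<close>.\<close>

lemma T_pow_N_hp:
  "l \<in> {1..r} \<Longrightarrow> (T ^^ i) (N hp) l = (-1) ^ (r - l) * chain_sum i l"
proof (induction i arbitrary: l)
  case 0
  have "Om ^ \<d> l * (\<Prod>k=l..r. fps_of_poly (Q k)) = (\<Prod>k=l..r. A k)"
    by (simp add: A_def prod.distrib tail_weight_def power_sum)
  moreover have "fps_of_poly ((-1) ^ n) = (-1 :: 'c fps) ^ n" for n
    by (simp add: fps_of_poly_power fps_of_poly_uminus)
  ultimately show ?case
    using 0 by (simp add: N_def hp_def chain_sum_0 fps_of_poly_mult fps_of_poly_prod mult.left_commute)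
next
  case (Suc i)
  show ?case
    using Suc.prems
  proof (induction l rule: coordinate_induct)
    case (2 l)
    have tw: "tw 1 ((T ^^ i) (N hp) l) = (-1) ^ (r - l) * tw 1 (chain_sum i l)"
      unfolding Suc.IH[OF 2(1)] by (simp add: tw_mult tw_power tw_uminus del: One_nat_def)
    show ?case
    proof (cases "l = r")
      case True
      then show ?thesis using T_rec[OF 2(1), of "(T ^^ i) (N hp)"] tw
        by (simp add: T_outside chain_sum_r tw_tw)
    next
      case False
      then have l: "l \<in> {1..<r}" using 2(1) by auto
      have e: "r - l = Suc (r - Suc l)" using l by auto
      have "(T ^^ Suc i) (N hp) (Suc l) = (-1) ^ (r - Suc l) * chain_sum (Suc i) (Suc l)"
        using 2(2) l by simp
      then show ?thesis
        using T_rec[OF 2(1), of "(T ^^ i) (N hp)"] tw unfolding chain_sum_Suc[OF l] e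
        by (simp add: algebra_simps del: One_nat_def)
    qed
  qed simp
qed

section \<open>Convergence of the chain sums in the Gauss norm\<close>

definition Mc :: real where "Mc = (\<Prod>k=1..r. R ^ degree (Q k))"

text \<open>The largest index of a chain twists \<open>A r\<close>, the factor with the strict
  bound, so the term decays in \<open>f r\<close> however the smaller indices are chosen.\<close>

lemma gb_chain_term:
  assumes "l \<in> {1..r}" shows "gb (Mc * \<epsilon> (f r)) (chain_term l f)"
proof (rule gb_mono)
  let ?C = "\<lambda>k. (if k = r then \<epsilon> (f r) else 1) * R ^ degree (Q k)"
  have t: "gb (?C k) (tw (f k) (A k))" if "k \<in> {l..r}" for k
    using gb_tw_A[of r "f r"] gb_tw_A_le[of k "f k"] that assms by (auto simp: \<epsilon>_def)
  show "gb (\<Prod>k=l..r. ?C k) (chain_term l f)"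
    unfolding chain_term_def by (rule gb_prod) (rule t)
  have "(\<Prod>k=l..r. ?C k) = \<epsilon> (f r) * (\<Prod>k=l..r. R ^ degree (Q k))"
    using assms by (simp add: prod.distrib)
  also have "\<dots> \<le> \<epsilon> (f r) * Mc"
  proof (rule mult_left_mono[OF _ eps_nonneg])
    show "(\<Prod>k=l..r. R ^ degree (Q k)) \<le> Mc"
      unfolding Mc_def using assms R_gt_1 by (intro prod_mono2) (auto intro: one_le_power)
  qed
  finally show "(\<Prod>k=l..r. ?C k) \<le> Mc * \<epsilon> (f r)" by (simp only: mult.commute)
qed

lemma Mc_nonneg: "Mc \<ge> 0" unfolding Mc_def by (intro prod_nonneg) simp

lemma gb_chain_sum: assumes "l \<in> {1..r}" shows "gb (Mc * \<epsilon> i) (chain_sum i l)"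
  unfolding chain_sum_def
  by (rule gb_sum) (use gb_chain_term[OF assms] Mc_nonneg eps_nonneg in auto)

abbreviation Ls :: "nat \<Rightarrow> 'c fps" where "Ls l \<equiv> L_star \<eta> s Q r l"

lemma chain_sum_nth_sums:
  assumes "l \<in> {1..r}" shows "(\<lambda>i. fps_nth (chain_sum i l) n) sums fps_nth (Ls l) n"
proof -
  have le: "absv (fps_nth g n) \<le> C" if "gb C g" for C g
  proof -
    have "absv (fps_nth g n) * 1 \<le> absv (fps_nth g n) * R ^ n"
      using R_gt_1 by (intro mult_left_mono one_le_power) auto
    then show ?thesis using that unfolding gb_def by (metis mult_1_right order_trans)
  qed
  have "(\<lambda>i. absv (fps_nth (chain_sum i l) n)) \<longlonglongrightarrow> 0"
    by (rule tendsto_zero_squeeze[OF cmult_eps_tendsto[of Mc]]) (simp_all add: le gb_chain_sum[OF assms])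
  then have sm: "(\<lambda>i. fps_nth (chain_sum i l) n) sums (\<Sum>i. fps_nth (chain_sum i l) n)"
    by (intro summable_sums ct_summable)
  have "((\<lambda>f. fps_nth (chain_term l f) n) has_sum (\<Sum>i. fps_nth (chain_sum i l) n)) (Chains l)"
  proof (rule has_sum_by_finite_blocks[where idx = "\<lambda>f. f r" and b = "\<lambda>i. Mc * \<epsilon> i"])
    show "finite {f \<in> Chains l. f r = i}" for i by (rule finite_Chains)
    show "absv (fps_nth (chain_term l f) n) \<le> Mc * \<epsilon> (f r)" for f by (rule le[OF gb_chain_term[OF assms]])
    show "(\<lambda>i. Mc * \<epsilon> i) \<longlonglongrightarrow> 0" by (rule cmult_eps_tendsto)
    show "(\<lambda>i. \<Sum>f | f \<in> Chains l \<and> f r = i. fps_nth (chain_term l f) n) sums (\<Sum>i. fps_nth (chain_sum i l) n)"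
      using sm by (simp add: chain_sum_def fps_sum_nth)
  qed
  then have "infsum (\<lambda>f. fps_nth (chain_term l f) n) (Chains l) = (\<Sum>i. fps_nth (chain_sum i l) n)"
    by (rule infsumI)
  moreover have "fps_nth (Ls l) n = infsum (\<lambda>f. fps_nth (chain_term l f) n) (Chains l)"
    by (simp add: L_star_def Chains_def chain_term_def A_def twist_fps_of_nat)
  ultimately show ?thesis using sm by simp
qed

text \<open>The tail bound holds for all coefficients simultaneously, with weights
  \<open>R ^ m\<close>. This upgrades the coefficientwise definition of \<open>L_star\<close> to
  Gauss norm convergence, as needed to apply \<open>D\<close> termwise.\<close>

lemma gb_Ls_tail:
  assumes "l \<in> {1..r}" shows "gb (Mc * \<epsilon> n) (Ls l - (\<Sum>i<n. chain_sum i l))"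
  unfolding gb_def
proof
  fix m
  have "absv (fps_nth (Ls l) m - (\<Sum>i<n. fps_nth (chain_sum i l) m)) \<le> Mc * \<epsilon> n / R ^ m"
  proof (rule ct_sums_tail_le[OF chain_sum_nth_sums[OF assms]])
    fix i assume "n \<le> i"
    have "absv (fps_nth (chain_sum i l) m) \<le> Mc * \<epsilon> i / R ^ m" by (rule gb_nth[OF gb_chain_sum[OF assms]])
    also have "\<dots> \<le> Mc * \<epsilon> n / R ^ m"
      using Mc_nonneg eps_antimono[OF \<open>n \<le> i\<close>] by (intro divide_right_mono mult_left_mono) auto
    finally show "absv (fps_nth (chain_sum i l) m) \<le> Mc * \<epsilon> n / R ^ m" .
  qed (use Mc_nonneg eps_nonneg in simp)
  then show "absv (fps_nth (Ls l - (\<Sum>i<n. chain_sum i l)) m) * R ^ m \<le> Mc * \<epsilon> n"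
    by (simp add: fps_sum_nth field_simps)
qed

lemma bdd_Ls: "l \<in> {1..r} \<Longrightarrow> bdd (Ls l)"
  using gb_Ls_tail[of l 0] by (auto simp: bdd_def)

lemma bdd_chain_sum: "l \<in> {1..r} \<Longrightarrow> bdd (chain_sum i l)"
  using gb_chain_sum by (auto simp: bdd_def)

lemma D_chain_sums:
  assumes l: "l \<in> {1..r}"
  shows "(\<lambda>i. D e (chain_sum i l * iOm ^ n)) sums D e (Ls l * iOm ^ n)"
proof -
  obtain B where B: "gb B (iOm ^ n)" using bdd_power[OF bdd_iOm] by (auto simp: bdd_def)
  have "absv ((\<Sum>i<m. D e (chain_sum i l * iOm ^ n)) - D e (Ls l * iOm ^ n)) \<le> (Mc * B) * \<epsilon> m" for m
  proof -
    have "(\<Sum>i<m. D e (chain_sum i l * iOm ^ n)) = D e ((\<Sum>i<m. chain_sum i l) * iOm ^ n)"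
      unfolding sum_distrib_right by (rule D_sum[symmetric]) (simp add: bdd_iOm_mult bdd_chain_sum[OF l])
    then have "D e (Ls l * iOm ^ n) - (\<Sum>i<m. D e (chain_sum i l * iOm ^ n))
        = D e ((Ls l - (\<Sum>i<m. chain_sum i l)) * iOm ^ n)"
      by (simp add: left_diff_distrib D_diff bdd_iOm_mult bdd_Ls[OF l] bdd_sum bdd_chain_sum[OF l])
    also have "absv \<dots> \<le> (Mc * \<epsilon> m) * B" by (rule D_le[OF gb_mult[OF gb_Ls_tail[OF l] B]])
    finally show ?thesis by (subst absv_minus_commute) (simp add: mult_ac)
  qed
  then show ?thesis
    unfolding sums_def tendsto_absv_iff
    by (intro tendsto_zero_squeeze[OF cmult_eps_tendsto]) auto
qed

definition gl :: "nat \<Rightarrow> 'c \<Rightarrow> 'c" where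
  "gl l x = (- 1) ^ (r - l) * fps_value (Ls l) x * inverse (fps_value Om x ^ (\<Sum>i=l..r. s i))"

text \<open>On the unit disc around \<open>\<theta>\<close> the series \<open>iOm\<close> converges
  to the inverse of the value of Omega, which is therefore nonzero there. So \<open>gl l\<close> is
  the value of one bounded power series.\<close>

lemma taylor_gl:
  assumes l: "l \<in> {1..r}"
  shows "taylor_coeff \<theta> (gl l) e = (-1) ^ (r - l) * D e (Ls l * iOm ^ \<d> l)"
proof -
  let ?f = "fps_const ((-1) ^ (r - l)) * (Ls l * iOm ^ \<d> l)"
  have b: "bdd (Ls l * iOm ^ \<d> l)" by (intro bdd_iOm_mult bdd_Ls l)
  have "taylor_coeff \<theta> (gl l) = (\<lambda>e. D e ?f)"
  proof (rule taylor_coeff_eq_D)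
    show "bdd ?f" by (intro bdd_mult bdd_const b)
    fix x assume "absv (x - \<theta>) \<le> 1"
    then have x: "absv x \<le> real q"
      using absv_add_le[of "x - \<theta>" "real q" \<theta>] q_ge_2 by simp
    have "fps_value Om x * fps_value iOm x = 1"
      using fps_value_mult[OF bdd_Om bdd_iOm x] fps_value_const[of 1 x] by (simp add: Om_iOm)
    then have "fps_value iOm x = inverse (fps_value Om x)" by (metis inverse_unique)
    then have "fps_value (iOm ^ \<d> l) x = inverse (fps_value Om x ^ \<d> l)"
      by (simp add: fps_value_power x power_inverse)
    moreover have "fps_value ?f x = (-1) ^ (r - l) * (fps_value (Ls l) x * fps_value (iOm ^ \<d> l) x)"
      unfolding fps_value_cmult[OF b x] using fps_value_mult[OF bdd_Ls[OF l] bdd_power[OF bdd_iOm] x] by simp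
    ultimately show "gl l x = fps_value ?f x" by (simp add: gl_def tail_weight_def mult.assoc)
  qed
  then show ?thesis using D_cmult[OF b] by simp
qed

lemma delta0_ix: "delta0 g = vec_of_list (map (\<lambda>(l, e). taylor_coeff \<theta> (g l) e) ix)"
  unfolding delta0_def ix_def map_concat by (simp add: o_def)

lemma delta0_nth: "j < dim_E \<Longrightarrow> delta0 g $ j = taylor_coeff \<theta> (g (ixl j)) (ixe j)"
  by (simp add: delta0_ix length_ix ixl_def ixe_def case_prod_beta vec_of_list_index)

lemma dim_delta0: "dim_vec (delta0 g) = dim_E"
  by (simp add: delta0_ix length_ix)

lemma split_log_special_point: "split_log special_point (delta0 gl)"
proof -
  have "delta0 gl = vec dim_E (\<lambda>j. \<Sum>k<bnd. (t_module (monom 1 k) 0 *\<^sub>v Log (delta1 (hk k))) $ j)" (is "_ = ?z")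
  proof (rule eq_vecI)
    fix j assume "j < dim_vec ?z"
    then have j: "j < dim_E" by simp
    let ?l = "ixl j" and ?c = "(-1 :: 'c) ^ (r - ixl j)"
    have l: "?l \<in> {1..r}" using ix_nth[OF j] by simp
    have "dl0 ((T ^^ i) (N hp)) j = ?c * D (ixe j) (chain_sum i ?l * iOm ^ \<d> ?l)" for i
    proof -
      have "(T ^^ i) (N hp) ?l * iOm ^ \<d> ?l = fps_const ?c * (chain_sum i ?l * iOm ^ \<d> ?l)"
        unfolding T_pow_N_hp[OF l]
        by (simp add: mult.assoc fps_const_power[symmetric] fps_const_neg[symmetric] del: fps_const_neg fps_const_power)
      then show ?thesis by (simp only: dl0_def D_cmult bdd_iOm_mult bdd_chain_sum[OF l])
    qed
    then have "(\<lambda>i. dl0 ((T ^^ i) (N hp)) j) sums (?c * D (ixe j) (Ls ?l * iOm ^ \<d> ?l))"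
      using ct_sums_cmult[OF D_chain_sums[OF l]] by simp
    \<comment> \<open>The same series has been summed twice: through the chain sums, and through the
      logarithms of the pieces of h.\<close>
    then have "?c * D (ixe j) (Ls ?l * iOm ^ \<d> ?l)
        = (\<Sum>k<bnd. (t_module (monom 1 k) 0 *\<^sub>v Log (delta1 (hk k))) $ j)"
      using split_log_sums[OF j] by (rule sums_unique2)
    then show "delta0 gl $ j = ?z $ j" using j l by (simp add: delta0_nth taylor_gl)
  qed (simp add: dim_delta0)
  then show ?thesis
    unfolding split_log_def using special_point_split hk_Log_domain
    by (intro exI[of _ bnd] exI[of _ "\<lambda>k. monom 1 k"] exI[of _ "\<lambda>k. delta1 (hk k)"]) simp
qed

end

theorem theorem4p3:
  fixes q r :: nat
    and \<iota> :: "'f::{field,finite} fls \<Rightarrow> 'c::{field,complete_space}"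
    and \<eta> :: 'c
    and s :: "nat \<Rightarrow> nat"
    and Q :: "nat \<Rightarrow> 'c poly"
  assumes "C_infinity q \<iota>"
    and "\<eta> ^ (q - 1) = - C_infinity.theta \<iota>"
    and "r \<ge> 1"
    and "\<And>i. i \<in> {1..r} \<Longrightarrow> s i \<ge> 1"
    and "\<And>i. i \<in> {1..r} \<Longrightarrow> set (coeffs (Q i)) \<subseteq> C_infinity.Kbar \<iota>"
    and "gauss_norm (Q r) < absv (C_infinity.theta \<iota>) powr (real (s r) * real q / (real q - 1))"
    and "\<And>i. i \<in> {1..<r} \<Longrightarrow>
      gauss_norm (Q i) \<le> absv (C_infinity.theta \<iota>) powr (real (s i) * real q / (real q - 1))"
  shows "Anderson_Thakur.split_log q \<iota> r s Q
    (Anderson_Thakur.special_point q \<iota> r s Q)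
    (Anderson_Thakur.delta0 \<iota> r s (\<lambda>l x.
      (- 1) ^ (r - l) * fps_value (C_infinity.L_star q \<iota> \<eta> s Q r l) x
        * inverse (fps_value (C_infinity.Omega q \<iota> \<eta>) x ^ (\<Sum>i=l..r. s i))))"
proof -
  interpret C_infinity q \<iota> by (rule assms(1))
  interpret AT_bound q \<iota> r s Q \<eta>
    by unfold_locales (use assms(2-7) in \<open>simp_all add: Kpoly_iff\<close>)
  show ?thesis using split_log_special_point unfolding gl_def[abs_def] .
qed

end
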